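(* Let $T_1$ and $T_2$ be disjoint locally compact Hausdorff spaces and $T=T_1\cup T_2$, where $T$ is a locally compact Hausdorff space with a bounded Radon measure $\mu$. Let $\mathfrak{A}$ be a $C^*$-algebra of Hilbert space operators, and let $\widetilde{A}=(A_t)_{t\in T}$ and $\widetilde{B}=(B_t)_{t\in T}$ be continuous fields of self-adjoint and strictly positive operators in $\mathfrak{A}$, respectively. Let $g$ be the perspective function of an operator convex function $f$. Then $$2g\left(\tfrac12(A,B)\right)\leq g(A_{T_1},B_{T_1})+g(A_{T_2},B_{T_2})\leq\Theta(\widetilde{A},\widetilde{B}),$$ where $A=\int_TA_t\,d\mu(t)$, $B=\int_TB_t\,d\mu(t)$, $A_{T_k}=\int_{T_k}A_t\,d\mu(t)$ and $B_{T_k}=\int_{T_k}B_t\,d\mu(t)$ for $k=1,2$.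
   Context: A bounded operator $X$ is positive if $\langle Xx,x\rangle\ge 0$ for all vectors $x$, and strictly positive if it is positive and invertible; $X\le Y$ means $Y-X$ is positive. A continuous real function $f$ on an interval $J$ is operator convex if $f(\lambda X+(1-\lambda)Y)\le\lambda f(X)+(1-\lambda)f(Y)$ for all self-adjoint operators $X,Y$ with spectra in $J$ and all $\lambda\in[0,1]$. A field $(A_t)_{t\in T}$ is continuous if $t\mapsto A_t$ is norm continuous; integrals of operator fields are Bochner integrals. For $f:[0,\infty)\to\mathbb{R}$, the perspective function of $f$ is $g(L,R)=R^{1/2}f(R^{-1/2}LR^{-1/2})R^{1/2}$ for $L$ self-adjoint and $R$ strictly positive, and the non-commutative $f$-divergence functional is $\Theta(\widetilde{A},\widetilde{B})=\int_TB_t^{1/2}f(B_t^{-1/2}A_tB_t^{-1/2})B_t^{1/2}\,d\mu(t)$. Here $\tfrac12(A,B)=(\tfrac12A,\tfrac12B)$. *)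

theory Defs
  imports "HOL-Analysis.Analysis" "HOL-Computational_Algebra.Polynomial"
begin

section \<open>Complex Hilbert spaces\<close>

text \<open>
  A complex Hilbert space is presented as a complete real inner product space whose real inner
  product is the real part of a sesquilinear form, linear in the first argument. Norm and
  completeness are those of the underlying real space.
\<close>

class complex_hilbert = real_inner + banach +
  fixes scaleC :: "complex \<Rightarrow> 'a \<Rightarrow> 'a"  (infixr "*\<^sub>C" 75)
    and cinner :: "'a \<Rightarrow> 'a \<Rightarrow> complex"
  assumes scaleC_add_right: "c *\<^sub>C (x + y) = c *\<^sub>C x + c *\<^sub>C y"
    and scaleC_add_left: "(c + d) *\<^sub>C x = c *\<^sub>C x + d *\<^sub>C x"
    and scaleC_scaleC: "c *\<^sub>C (d *\<^sub>C x) = (c * d) *\<^sub>C x"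
    and scaleC_of_real: "complex_of_real r *\<^sub>C x = r *\<^sub>R x"
    and cinner_commute: "cinner x y = cnj (cinner y x)"
    and cinner_add_left: "cinner (x + y) z = cinner x z + cinner y z"
    and cinner_scaleC_left: "cinner (c *\<^sub>C x) y = c * cinner x y"
    and inner_eq_Re_cinner: "inner x y = Re (cinner x y)"


section \<open>Bounded operators\<close>

text \<open>
  The type \<^typ>\<open>'h \<Rightarrow>\<^sub>L 'h\<close> consists of the bounded \<^emph>\<open>real\<close>-linear maps, with the operator norm.
  The bounded operators of the complex Hilbert space are those satisfying \<open>clinear_op\<close>; every notion
  of operator below is restricted to them.
\<close>

definition clinear_op :: "('h::complex_hilbert \<Rightarrow>\<^sub>L 'h) \<Rightarrow> bool" where
  "clinear_op X \<longleftrightarrow> (\<forall>c x. X (c *\<^sub>C x) = c *\<^sub>C X x)"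

definition scalar_op :: "complex \<Rightarrow> ('h::complex_hilbert \<Rightarrow>\<^sub>L 'h)" where
  "scalar_op c = Blinfun (\<lambda>x. c *\<^sub>C x)"

definition is_adjoint :: "('h::complex_hilbert \<Rightarrow>\<^sub>L 'h) \<Rightarrow> ('h \<Rightarrow>\<^sub>L 'h) \<Rightarrow> bool" where
  "is_adjoint Y X \<longleftrightarrow> clinear_op Y \<and> (\<forall>x y. cinner (X x) y = cinner x (Y y))"

definition self_adjoint_op :: "('h::complex_hilbert \<Rightarrow>\<^sub>L 'h) \<Rightarrow> bool" where
  "self_adjoint_op X \<longleftrightarrow> is_adjoint X X"

definition invertible_op :: "('h::complex_hilbert \<Rightarrow>\<^sub>L 'h) \<Rightarrow> bool" where
  "invertible_op X \<longleftrightarrow> (\<exists>Y. clinear_op Y \<and> X o\<^sub>L Y = id_blinfun \<and> Y o\<^sub>L X = id_blinfun)"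

definition positive_op :: "('h::complex_hilbert \<Rightarrow>\<^sub>L 'h) \<Rightarrow> bool" where
  "positive_op X \<longleftrightarrow> clinear_op X \<and> (\<forall>x. cinner (X x) x \<in> \<real>\<^sub>\<ge>\<^sub>0)"

definition strictly_positive_op :: "('h::complex_hilbert \<Rightarrow>\<^sub>L 'h) \<Rightarrow> bool" where
  "strictly_positive_op X \<longleftrightarrow> positive_op X \<and> invertible_op X"

definition op_le :: "('h::complex_hilbert \<Rightarrow>\<^sub>L 'h) \<Rightarrow> ('h \<Rightarrow>\<^sub>L 'h) \<Rightarrow> bool"  (infix "\<preceq>" 50) where
  "X \<preceq> Y \<longleftrightarrow> positive_op (Y - X)"

definition op_spectrum :: "('h::complex_hilbert \<Rightarrow>\<^sub>L 'h) \<Rightarrow> complex set" where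
  "op_spectrum X = {z. \<not> invertible_op (X - scalar_op z)}"

text \<open>A C*-algebra of operators: a norm-closed complex subalgebra of B(H) that is closed under
  adjoints. It is not required to contain the identity.\<close>

definition operator_Cstar_algebra :: "('h::complex_hilbert \<Rightarrow>\<^sub>L 'h) set \<Rightarrow> bool" where
  "operator_Cstar_algebra \<AA> \<longleftrightarrow>
     (\<forall>X\<in>\<AA>. clinear_op X) \<and> 0 \<in> \<AA> \<and>
     (\<forall>X\<in>\<AA>. \<forall>Y\<in>\<AA>. X + Y \<in> \<AA> \<and> X o\<^sub>L Y \<in> \<AA>) \<and>
     (\<forall>c. \<forall>X\<in>\<AA>. scalar_op c o\<^sub>L X \<in> \<AA>) \<and>
     (\<forall>X\<in>\<AA>. \<exists>Y\<in>\<AA>. is_adjoint Y X) \<and>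
     closed \<AA>"


section \<open>Continuous functional calculus and operator convexity\<close>

definition op_poly :: "real poly \<Rightarrow> ('h::complex_hilbert \<Rightarrow>\<^sub>L 'h) \<Rightarrow> ('h \<Rightarrow>\<^sub>L 'h)" where
  "op_poly p X = (\<Sum>i\<le>degree p. coeff p i *\<^sub>R (((o\<^sub>L) X) ^^ i) id_blinfun)"

text \<open>
  For self-adjoint \<open>X\<close> and \<open>f\<close> continuous on the (compact, real) spectrum of \<open>X\<close>, the operator
  \<open>f(X)\<close> is the norm limit of \<open>p\<^sub>n(X)\<close> for real polynomials \<open>p\<^sub>n\<close> converging to \<open>f\<close> uniformly on
  the spectrum.
\<close>

definition cfc :: "(real \<Rightarrow> real) \<Rightarrow> ('h::complex_hilbert \<Rightarrow>\<^sub>L 'h) \<Rightarrow> ('h \<Rightarrow>\<^sub>L 'h)" where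
  "cfc f X = (THE Y. \<exists>p :: nat \<Rightarrow> real poly.
     uniform_limit {r. complex_of_real r \<in> op_spectrum X} (\<lambda>n r. poly (p n) r) f sequentially \<and>
     (\<lambda>n. op_poly (p n) X) \<longlonglongrightarrow> Y)"

definition op_powr :: "('h::complex_hilbert \<Rightarrow>\<^sub>L 'h) \<Rightarrow> real \<Rightarrow> ('h \<Rightarrow>\<^sub>L 'h)" where
  "op_powr X a = cfc (\<lambda>r. r powr a) X"

text \<open>Operator convexity of \<open>f\<close> on \<open>J\<close>, with respect to the operators on the Hilbert space \<open>'k\<close>.\<close>

definition operator_convex_on ::
    "'k::complex_hilbert itself \<Rightarrow> real set \<Rightarrow> (real \<Rightarrow> real) \<Rightarrow> bool" where
  "operator_convex_on _ J f \<longleftrightarrow> continuous_on J f \<and>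
     (\<forall>(X :: 'k \<Rightarrow>\<^sub>L 'k) Y. \<forall>l\<in>{0..1}.
        self_adjoint_op X \<and> op_spectrum X \<subseteq> complex_of_real ` J \<and>
        self_adjoint_op Y \<and> op_spectrum Y \<subseteq> complex_of_real ` J \<longrightarrow>
        cfc f (l *\<^sub>R X + (1 - l) *\<^sub>R Y) \<preceq> l *\<^sub>R cfc f X + (1 - l) *\<^sub>R cfc f Y)"

text \<open>The argument of \<open>f\<close> in the perspective.\<close>

definition rel_op :: "('h::complex_hilbert \<Rightarrow>\<^sub>L 'h) \<Rightarrow> ('h \<Rightarrow>\<^sub>L 'h) \<Rightarrow> ('h \<Rightarrow>\<^sub>L 'h)" where
  "rel_op L R = op_powr R (- (1/2)) o\<^sub>L L o\<^sub>L op_powr R (- (1/2))"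

text \<open>
  Meant for strictly positive \<open>R\<close>. Note that \<^term>\<open>(0::real) powr a = 0\<close>, so the outer factors
  vanish for \<open>R = 0\<close> and the perspective takes the value \<open>0\<close> at \<open>(0, 0)\<close>.
\<close>

definition perspective ::
    "(real \<Rightarrow> real) \<Rightarrow> ('h::complex_hilbert \<Rightarrow>\<^sub>L 'h) \<Rightarrow> ('h \<Rightarrow>\<^sub>L 'h) \<Rightarrow> ('h \<Rightarrow>\<^sub>L 'h)" where
  "perspective f L R = op_powr R (1/2) o\<^sub>L cfc f (rel_op L R) o\<^sub>L op_powr R (1/2)"


section \<open>Radon measures and the Bochner integral\<close>

definition radon_measure :: "'t::t2_space measure \<Rightarrow> bool" where
  "radon_measure M \<longleftrightarrow> sets M = sets borel \<and>
     (\<forall>K. compact K \<longrightarrow> emeasure M K < \<infinity>) \<and>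
     (\<forall>E\<in>sets borel. emeasure M E = (INF U\<in>{U. open U \<and> E \<subseteq> U}. emeasure M U)) \<and>
     (\<forall>U. open U \<longrightarrow> emeasure M U = (SUP K\<in>{K. compact K \<and> K \<subseteq> U}. emeasure M K))"

text \<open>
  \<^const>\<open>has_bochner_integral\<close> requires a second countable codomain, which excludes the operators
  on an infinite-dimensional space. The following is the same definition for an arbitrary Banach
  space; as the approximating functions are simple, strong measurability is implied.
\<close>

definition has_bochner_int :: "'t measure \<Rightarrow> ('t \<Rightarrow> 'b::banach) \<Rightarrow> 'b \<Rightarrow> bool" where
  "has_bochner_int M F I \<longleftrightarrow> F \<in> borel_measurable M \<and>
     (\<exists>s. (\<forall>i. Bochner_Integration.simple_bochner_integrable M (s i)) \<and>
          (\<lambda>i. \<integral>\<^sup>+t. ennreal (norm (F t - s i t)) \<partial>M) \<longlonglongrightarrow> 0 \<and>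
          (\<lambda>i. Bochner_Integration.simple_bochner_integral M (s i)) \<longlonglongrightarrow> I)"

definition bochner_integrable :: "'t measure \<Rightarrow> ('t \<Rightarrow> 'b::banach) \<Rightarrow> bool" where
  "bochner_integrable M F \<longleftrightarrow> (\<exists>I. has_bochner_int M F I)"

definition bochner_int :: "'t measure \<Rightarrow> ('t \<Rightarrow> 'b::banach) \<Rightarrow> 'b" where
  "bochner_int M F = (THE I. has_bochner_int M F I)"

definition set_bochner_int :: "'t measure \<Rightarrow> 't set \<Rightarrow> ('t \<Rightarrow> 'b::banach) \<Rightarrow> 'b" where
  "set_bochner_int M S F = bochner_int M (\<lambda>t. indicat_real S t *\<^sub>R F t)"

definition f_divergence ::
    "'t measure \<Rightarrow> (real \<Rightarrow> real) \<Rightarrow> ('t \<Rightarrow> 'h::complex_hilbert \<Rightarrow>\<^sub>L 'h) \<Rightarrow> ('t \<Rightarrow> 'h \<Rightarrow>\<^sub>L 'h) \<Rightarrow> ('h \<Rightarrow>\<^sub>L 'h)"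
  where "f_divergence M f A B = bochner_int M (\<lambda>t. perspective f (A t) (B t))"

end

theory Submission
  imports Defs "HOL-Computational_Algebra.Fundamental_Theorem_Algebra"
begin

text \<open>
  Both inequalities are Jensen inequalities for the perspective \<open>g\<close>, the first one for two points, the
  second one for the integrals over \<open>T\<^sub>1\<close> and \<open>T\<^sub>2\<close>.

  The heart is the subadditivity \<open>g(L\<^sub>1 + L\<^sub>2, R\<^sub>1 + R\<^sub>2) \<le> g(L\<^sub>1, R\<^sub>1) + g(L\<^sub>2, R\<^sub>2)\<close>
  (\<open>perspective_subadditive\<close>). With \<open>R = R\<^sub>1 + R\<^sub>2\<close> the map \<open>V x = (R\<^sub>1\<^sup>\<onehalf>R\<^sup>-\<^sup>\<onehalf>x, R\<^sub>2\<^sup>\<onehalf>R\<^sup>-\<^sup>\<onehalf>x)\<close> into the direct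
  sum of two copies of the space is an isometry, and the claim is \<open>f(V\<^sup>*XV) \<le> V\<^sup>*f(X)V\<close> for the direct sum \<open>X\<close> of the two
  operators \<open>R\<^sub>i\<^sup>-\<^sup>\<onehalf>L\<^sub>iR\<^sub>i\<^sup>-\<^sup>\<onehalf>\<close>. This follows from operator convexity at the midpoint of \<open>X\<close> and \<open>SXS\<close>,
  where \<open>S\<close> is the reflection in the range of \<open>V\<close> (\<open>cfc_isometry_jensen\<close>). Since \<open>g\<close> is also homogeneous,
  \<open>2g(\<onehalf>(A, B)) = g(A, B)\<close>, and the first inequality is subadditivity at the integrals over \<open>T\<^sub>1\<close> and \<open>T\<^sub>2\<close>.

  Operator convexity is only given on some infinite-dimensional space. It carries over to any other
  Hilbert space (\<open>operator_convex_on_transport\<close>), because at a single vector the quadratic forms of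
  polynomials in an operator only see finitely many vectors, which embed isometrically.

  For integrals, subadditivity and homogeneity say that the triples \<open>(L, R, G)\<close> with \<open>g(L, R) \<le> G\<close> form a convex
  cone. An integral always belongs to the closure of a convex cone that contains the integrand
  (\<open>simple_approx_in_closure_cone\<close>), so \<open>(\<integral>A, \<integral>B, \<integral>g(A, B))\<close> is a limit of points of the cone, and norm continuity of \<open>g\<close> gives
  \<open>g(\<integral>A, \<integral>B) \<le> \<integral>g(A, B)\<close> (\<open>perspective_integral_le\<close>). What has to be checked is that \<open>(\<integral>A, \<integral>B)\<close> itself is in the
  domain of \<open>g\<close>: \<open>\<integral>B\<close> is invertible unless the set has measure zero, and the relative operator keeps its
  spectrum in \<open>J\<close> even where \<open>J\<close> does not contain its ends (\<open>integral_relative_lower_bound\<close>).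

  The functional calculus rests on the bound \<open>\<parallel>p(X)\<parallel> \<le> sup |p|\<close> over the spectrum, for real polynomials \<open>p\<close> and
  self-adjoint \<open>X\<close> (\<open>norm_op_poly_le\<close>): the norm of \<open>p(X)\<close>, up to sign, is in its spectrum, and spectral mapping
  leads back to a point of the spectrum of \<open>X\<close>.
\<close>

section \<open>Operators on a complex Hilbert space through the real inner product\<close>

lemma scaleC_scaleR_commute: "c *\<^sub>C (r *\<^sub>R x) = r *\<^sub>R (c *\<^sub>C (x::'a::complex_hilbert))"
  by (metis mult.commute scaleC_of_real scaleC_scaleC)

lemma cinner_scaleC_right: "cinner x (c *\<^sub>C y) = cnj c * cinner (x::'a::complex_hilbert) y"
  by (metis cinner_commute cinner_scaleC_left complex_cnj_mult)

lemma inner_scaleC_left: "inner (c *\<^sub>C x) y = inner (x::'a::complex_hilbert) (cnj c *\<^sub>C y)"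
  by (simp add: inner_eq_Re_cinner cinner_scaleC_left cinner_scaleC_right)

lemma cinner_eq_Complex: "cinner (x::'a::complex_hilbert) y = Complex (inner x y) (inner x (\<i> *\<^sub>C y))"
  by (simp add: complex_eq_iff inner_eq_Re_cinner cinner_scaleC_right)

lemma scaleC_one [simp]: "1 *\<^sub>C (x::'a::complex_hilbert) = x"
  by (metis of_real_1 scaleC_of_real scaleR_one)

lemma norm_scaleC: "norm (c *\<^sub>C (x::'a::complex_hilbert)) = cmod c * norm x"
proof -
  have "inner (c *\<^sub>C x) (c *\<^sub>C x) = inner x (complex_of_real ((cmod c)\<^sup>2) *\<^sub>C x)"
    by (simp add: inner_scaleC_left scaleC_scaleC complex_norm_square[symmetric] mult.commute[of "cnj c"] del: of_real_power)
  also have "\<dots> = (cmod c * norm x)\<^sup>2"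
    by (simp add: scaleC_of_real power_mult_distrib power2_norm_eq_inner)
  finally show ?thesis
    by (simp add: norm_eq_sqrt_inner real_sqrt_mult)
qed

lemma bounded_linear_scaleC: "bounded_linear (\<lambda>x::'a::complex_hilbert. c *\<^sub>C x)"
  by (rule bounded_linear_intro[where K = "cmod c"])
    (auto simp: scaleC_add_right scaleC_scaleR_commute norm_scaleC)

lemma scalar_op_apply [simp]: "scalar_op c x = c *\<^sub>C x"
  by (simp add: scalar_op_def bounded_linear_Blinfun_apply bounded_linear_scaleC)

lemma scalar_op_of_real: "scalar_op (complex_of_real r) = r *\<^sub>R id_blinfun"
  by (rule blinfun_eqI) (simp add: scaleC_of_real blinfun.scaleR_left)

lemmas scaleC_zero_right [simp] = linear_0[OF bounded_linear.linear[OF bounded_linear_scaleC]]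
lemmas scaleC_diff_right = linear_diff[OF bounded_linear.linear[OF bounded_linear_scaleC]]

lemma clinear_opD: "clinear_op X \<Longrightarrow> X (c *\<^sub>C x) = c *\<^sub>C X x"
  by (simp add: clinear_op_def)

lemma clinear_op_intros [intro]:
  "clinear_op id_blinfun" "clinear_op 0"
  "clinear_op X \<Longrightarrow> clinear_op Y \<Longrightarrow> clinear_op (X + Y)"
  "clinear_op X \<Longrightarrow> clinear_op Y \<Longrightarrow> clinear_op (X - Y)"
  "clinear_op X \<Longrightarrow> clinear_op (r *\<^sub>R X)"
  "clinear_op X \<Longrightarrow> clinear_op Y \<Longrightarrow> clinear_op (X o\<^sub>L Y)"
  "clinear_op (scalar_op c)"
  by (auto simp: clinear_op_def blinfun.bilinear_simps scaleC_add_right scaleC_diff_right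
      scaleC_scaleR_commute scaleC_scaleC mult.commute)

lemma clinear_op_lim:
  assumes "\<And>n. clinear_op (X n)" "X \<longlonglongrightarrow> Y"
  shows "clinear_op Y"
  unfolding clinear_op_def
proof (intro allI)
  fix c x
  have ap: "(\<lambda>n. X n z) \<longlonglongrightarrow> Y z" for z
    using assms(2) by (intro tendsto_intros)
  have "(\<lambda>n. c *\<^sub>C X n x) \<longlonglongrightarrow> c *\<^sub>C Y x"
    by (rule bounded_linear.tendsto[OF bounded_linear_scaleC ap])
  with ap[of "c *\<^sub>C x"] show "Y (c *\<^sub>C x) = c *\<^sub>C Y x"
    using assms(1) by (simp add: clinear_op_def LIMSEQ_unique)
qed

lemma self_adjoint_op_iff:
  "self_adjoint_op X \<longleftrightarrow> clinear_op X \<and> (\<forall>x y. inner (X x) y = inner x (X y))"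
  unfolding self_adjoint_op_def is_adjoint_def
  by (auto simp: cinner_eq_Complex clinear_opD[symmetric])

lemma self_adjoint_opD:
  "self_adjoint_op X \<Longrightarrow> clinear_op X"
  "self_adjoint_op X \<Longrightarrow> inner (X x) y = inner x (X y)"
  by (auto simp: self_adjoint_op_iff)

lemma self_adjoint_op_intros [intro]:
  "self_adjoint_op id_blinfun" "self_adjoint_op 0"
  "self_adjoint_op X \<Longrightarrow> self_adjoint_op Y \<Longrightarrow> self_adjoint_op (X + Y)"
  "self_adjoint_op X \<Longrightarrow> self_adjoint_op Y \<Longrightarrow> self_adjoint_op (X - Y)"
  "self_adjoint_op X \<Longrightarrow> self_adjoint_op (r *\<^sub>R X)"
  "self_adjoint_op X \<Longrightarrow> self_adjoint_op Y \<Longrightarrow> self_adjoint_op (X o\<^sub>L Y o\<^sub>L X)"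
  by (auto simp: self_adjoint_op_iff blinfun.bilinear_simps inner_simps)

lemma self_adjoint_op_compose:
  assumes "self_adjoint_op X" "self_adjoint_op Y" "X o\<^sub>L Y = Y o\<^sub>L X"
  shows "self_adjoint_op (X o\<^sub>L Y)"
proof -
  have "X (Y x) = Y (X x)" for x
    using assms(3) by (metis blinfun_apply_blinfun_compose)
  with assms(1,2) show ?thesis
    by (auto simp: self_adjoint_op_iff)
qed

lemma self_adjoint_op_lim:
  assumes "\<And>n. self_adjoint_op (X n)" "X \<longlonglongrightarrow> Y"
  shows "self_adjoint_op Y"
  unfolding self_adjoint_op_iff
proof (intro conjI allI)
  show "clinear_op Y"
    using assms clinear_op_lim self_adjoint_opD(1) by blast
  fix x y
  have ap: "(\<lambda>n. X n z) \<longlonglongrightarrow> Y z" for z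
    using assms(2) by (intro tendsto_intros)
  have "(\<lambda>n. inner (X n x) y) \<longlonglongrightarrow> inner (Y x) y" "(\<lambda>n. inner x (X n y)) \<longlonglongrightarrow> inner x (Y y)"
    by (intro tendsto_intros ap)+
  then show "inner (Y x) y = inner x (Y y)"
    using self_adjoint_opD(2)[OF assms(1)] by (simp add: LIMSEQ_unique)
qed

text \<open>
  That \<open>\<langle>Xx, x\<rangle>\<close> is real for all \<open>x\<close> says that \<open>K = \<i>X\<close> is skew for the real inner product; composing \<open>K\<close>
  with the skew multiplication by \<open>\<i>\<close>, with which it commutes, gives a symmetric map.
\<close>

lemma positive_op_iff:
  "positive_op X \<longleftrightarrow> self_adjoint_op X \<and> (\<forall>x. 0 \<le> inner (X x) x)"
proof
  assume X: "positive_op X"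
  then have lin: "clinear_op X" and pos: "0 \<le> inner (X x) x" and "inner (X x) (\<i> *\<^sub>C x) = 0" for x
    by (auto simp: positive_op_def cinner_eq_Complex complex_nonneg_Reals_iff)
  then have "inner (X (x + y)) (\<i> *\<^sub>C (x + y)) = 0" "inner (X x) (\<i> *\<^sub>C x) = 0"
      "inner (X y) (\<i> *\<^sub>C y) = 0" for x y
    by simp_all
  then have skew: "inner (X x) (\<i> *\<^sub>C y) = - inner (X y) (\<i> *\<^sub>C x)" for x y
    by (smt (verit) blinfun.add_right inner_add_left inner_add_right scaleC_add_right)
  have "inner (X x) y = inner x (X y)" for x y
  proof -
    have "inner (X x) y = inner (X (\<i> *\<^sub>C x)) (\<i> *\<^sub>C y)"
      using lin by (simp add: clinear_opD inner_scaleC_left scaleC_scaleC)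
    also have "\<dots> = - inner (X y) (\<i> *\<^sub>C \<i> *\<^sub>C x)"
      by (rule skew)
    also have "\<dots> = inner (X y) x"
      using scaleC_of_real[of "-1" x] by (simp add: scaleC_scaleC)
    finally show ?thesis
      by (simp add: inner_commute)
  qed
  with lin pos show "self_adjoint_op X \<and> (\<forall>x. 0 \<le> inner (X x) x)"
    by (simp add: self_adjoint_op_iff)
next
  assume X: "self_adjoint_op X \<and> (\<forall>x. 0 \<le> inner (X x) x)"
  have "inner (X x) (\<i> *\<^sub>C x) = 0" for x
  proof -
    have "inner (X x) (\<i> *\<^sub>C x) = inner x (X (\<i> *\<^sub>C x))"
      using X self_adjoint_opD(2) by blast
    also have "\<dots> = inner (cnj \<i> *\<^sub>C x) (X x)"
      using X by (simp add: clinear_opD[OF self_adjoint_opD(1)] inner_scaleC_left)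
    also have "cnj \<i> *\<^sub>C x = - (\<i> *\<^sub>C x)"
      using scaleC_scaleC[of "-1" \<i> x] scaleC_of_real[of "-1" "\<i> *\<^sub>C x"] by simp
    finally show ?thesis
      by (simp add: inner_commute)
  qed
  then show "positive_op X"
    using X by (auto simp: positive_op_def self_adjoint_opD cinner_eq_Complex complex_nonneg_Reals_iff)
qed

lemma op_leI:
  assumes "self_adjoint_op X" "self_adjoint_op Y" "\<And>x. inner (X x) x \<le> inner (Y x) x"
  shows "X \<preceq> Y"
  using assms by (auto simp: op_le_def positive_op_iff blinfun.bilinear_simps inner_simps)

lemma op_leD: "X \<preceq> Y \<Longrightarrow> inner (X x) x \<le> inner (Y x) x"
  by (auto simp: op_le_def positive_op_iff blinfun.bilinear_simps inner_simps)

lemma positive_op_lim: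
  assumes "\<And>n. positive_op (X n)" "X \<longlonglongrightarrow> Y"
  shows "positive_op Y"
  unfolding positive_op_iff
proof (intro conjI allI)
  show "self_adjoint_op Y"
    using assms self_adjoint_op_lim positive_op_iff by blast
  fix x
  have "(\<lambda>n. inner (X n x) x) \<longlonglongrightarrow> inner (Y x) x"
    using assms(2) by (intro tendsto_intros)
  then show "0 \<le> inner (Y x) x"
    using assms(1) by (auto simp: positive_op_iff intro: LIMSEQ_le_const)
qed

text \<open>
  All spectral conditions below are replaced by form bounds: these survive sums, compressions, limits and
  integrals, and for intervals they say the same as inclusion of the spectrum.
\<close>

definition form_bounds :: "real \<Rightarrow> real \<Rightarrow> ('h::complex_hilbert \<Rightarrow>\<^sub>L 'h) \<Rightarrow> bool" where
  "form_bounds a b X \<longleftrightarrow> self_adjoint_op X \<and>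
     (\<forall>x. a * inner x x \<le> inner (X x) x \<and> inner (X x) x \<le> b * inner x x)"

lemma form_boundsD:
  assumes "form_bounds a b X"
  shows "self_adjoint_op X" "a * inner x x \<le> inner (X x) x" "inner (X x) x \<le> b * inner x x"
  using assms by (auto simp: form_bounds_def)

lemma form_bounds_mono:
  assumes "form_bounds a b X" "a' \<le> a" "b \<le> b'"
  shows "form_bounds a' b' X"
proof -
  have "a' * inner x x \<le> a * inner x x" "b * inner x x \<le> b' * inner x x" for x :: 'a
    using assms by (auto intro: mult_right_mono)
  then show ?thesis
    using assms(1) unfolding form_bounds_def by (meson order_trans)
qed

lemma form_le_norm:
  fixes X :: "'h::real_inner \<Rightarrow>\<^sub>L 'h"
  shows "inner (X x) x \<le> norm X * inner x x"
proof -
  have "inner (X x) x \<le> norm (X x) * norm x" by (rule norm_cauchy_schwarz)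
  also have "\<dots> \<le> (norm X * norm x) * norm x"
    by (intro mult_right_mono norm_blinfun) auto
  finally show ?thesis by (simp add: power2_norm_eq_inner[symmetric] power2_eq_square)
qed

lemma form_bounds_norm:
  assumes "self_adjoint_op X"
  shows "form_bounds (- norm X) (norm X) X"
  unfolding form_bounds_def
proof (intro conjI allI)
  fix x
  show "- norm X * inner x x \<le> inner (X x) x" "inner (X x) x \<le> norm X * inner x x"
    using form_le_norm[of X x] form_le_norm[of "- X" x] by (simp_all add: blinfun.minus_left)
qed fact

lemma form_bounds_id: "form_bounds a a (a *\<^sub>R id_blinfun)"
  by (auto simp: form_bounds_def blinfun.scaleR_left intro!: self_adjoint_op_intros)

lemma form_bounds_trivial:
  assumes "\<not> (\<exists>x::'h::complex_hilbert. x \<noteq> 0)"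
  shows "form_bounds a b (X :: 'h \<Rightarrow>\<^sub>L 'h)"
proof -
  have [simp]: "x = 0" for x :: 'h
    using assms by blast
  have "inner x y = 0" for x y :: 'h
    by (metis \<open>\<And>x. x = 0\<close> inner_zero_left)
  moreover have "X = 0"
    by (rule blinfun_eqI) simp
  ultimately show ?thesis
    by (auto simp: form_bounds_def)
qed

section \<open>Invertibility and the spectrum of a self-adjoint operator\<close>

lemma invertible_op_compose:
  assumes "invertible_op X" "invertible_op Y"
  shows "invertible_op (X o\<^sub>L Y)"
proof -
  obtain X' Y' where "clinear_op X'" "X o\<^sub>L X' = id_blinfun" "X' o\<^sub>L X = id_blinfun"
    "clinear_op Y'" "Y o\<^sub>L Y' = id_blinfun" "Y' o\<^sub>L Y = id_blinfun"
    using assms by (auto simp: invertible_op_def)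
  then have inv: "X (X' x) = x" "X' (X x) = x" "Y (Y' x) = x" "Y' (Y x) = x" for x
    by (metis blinfun_apply_blinfun_compose blinfun_apply_id_blinfun)+
  show ?thesis
    unfolding invertible_op_def
    by (rule exI[of _ "Y' o\<^sub>L X'"])
      (auto intro!: blinfun_eqI \<open>clinear_op X'\<close> \<open>clinear_op Y'\<close> simp: inv)
qed

lemma invertible_op_factor:
  assumes "invertible_op (X o\<^sub>L Y)" "X o\<^sub>L Y = Y o\<^sub>L X" "clinear_op Y"
  shows "invertible_op X"
proof -
  obtain Z where Z: "clinear_op Z" "(X o\<^sub>L Y) o\<^sub>L Z = id_blinfun" "Z o\<^sub>L (X o\<^sub>L Y) = id_blinfun"
    using assms(1) by (auto simp: invertible_op_def)
  then have "X (Y (Z x)) = x" "Z (X (Y x)) = x" for x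
    by (metis blinfun_apply_blinfun_compose blinfun_apply_id_blinfun)+
  moreover have "X (Y x) = Y (X x)" for x
    using assms(2) by (metis blinfun_apply_blinfun_compose)
  ultimately have inv: "X (Y (Z x)) = x" "Y (Z (X x)) = x" for x
    by metis+
  show ?thesis
    unfolding invertible_op_def
    by (rule exI[of _ "Y o\<^sub>L Z"]) (auto intro!: blinfun_eqI assms Z(1) simp: inv)
qed

lemma invertible_op_scaleR:
  assumes "invertible_op X" "r \<noteq> 0"
  shows "invertible_op (r *\<^sub>R X)"
proof -
  obtain Z where Z: "clinear_op Z" "X o\<^sub>L Z = id_blinfun" "Z o\<^sub>L X = id_blinfun"
    using assms(1) by (auto simp: invertible_op_def)
  then have "X (Z x) = x" "Z (X x) = x" for x
    by (metis blinfun_apply_blinfun_compose blinfun_apply_id_blinfun)+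
  then show ?thesis
    unfolding invertible_op_def using assms(2)
    by (intro exI[of _ "inverse r *\<^sub>R Z"])
      (auto intro!: blinfun_eqI Z(1) simp: blinfun.bilinear_simps)
qed

lemma invertible_op_id: "invertible_op id_blinfun"
  unfolding invertible_op_def by (rule exI[of _ id_blinfun]) (auto intro: blinfun_eqI)

lemma invertible_op_id_minus:
  fixes S :: "'h::complex_hilbert \<Rightarrow>\<^sub>L 'h"
  assumes "clinear_op S" "norm S < 1"
  shows "invertible_op (id_blinfun - S)"
proof -
  define P where "P n = (((o\<^sub>L) S) ^^ n) id_blinfun" for n
  have P0: "P 0 = id_blinfun" and P_Suc: "P (Suc n) = S o\<^sub>L P n" for n
    by (simp_all add: P_def)
  have P_Suc': "P (Suc n) = P n o\<^sub>L S" for n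
  proof (induction n)
    case 0
    show ?case by (auto intro: blinfun_eqI simp: P_Suc P0)
  next
    case (Suc n)
    then show ?case
      by (metis (no_types, lifting) P_Suc blinfun_compose.abs_eq blinfun_eqI blinfun_apply_blinfun_compose)
  qed
  have clin_P: "clinear_op (P n)" for n
    by (induction n) (auto simp: P0 P_Suc assms(1))
  have norm_P: "norm (P n) \<le> norm S ^ n" for n
  proof (induction n)
    case 0
    show ?case by (simp add: P0 norm_blinfun_id_le)
  next
    case (Suc n)
    have "norm (P (Suc n)) \<le> norm S * norm (P n)"
      by (simp add: P_Suc norm_blinfun_compose)
    also have "\<dots> \<le> norm S * norm S ^ n"
      by (intro mult_left_mono Suc) auto
    finally show ?case by simp
  qed
  have "summable (\<lambda>n. norm S ^ n)"
    using assms(2) by (intro summable_geometric) auto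
  then have "summable P"
    by (rule summable_comparison_test[rotated]) (use norm_P in auto)
  then obtain Y where Y: "P sums Y" by (auto simp: summable_def)
  have clin_Y: "clinear_op Y"
  proof (rule clinear_op_lim)
    show "(\<lambda>n. \<Sum>i<n. P i) \<longlonglongrightarrow> Y"
      using Y by (simp add: sums_def)
    show "clinear_op (\<Sum>i<n. P i)" for n
      by (induction n) (auto simp: clin_P)
  qed
  have shift: "(\<lambda>n. P (Suc n)) sums (Y - id_blinfun)"
    using Y by (subst sums_Suc_iff) (simp add: P0)
  have "(\<lambda>n. S o\<^sub>L P n) sums (S o\<^sub>L Y)"
    by (rule bounded_linear.sums[OF bounded_bilinear.bounded_linear_right[OF bounded_bilinear_blinfun_compose] Y])
  moreover have "(\<lambda>n. P n o\<^sub>L S) sums (Y o\<^sub>L S)"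
    by (rule bounded_linear.sums[OF bounded_bilinear.bounded_linear_left[OF bounded_bilinear_blinfun_compose] Y])
  ultimately have "S o\<^sub>L Y = Y - id_blinfun" "Y o\<^sub>L S = Y - id_blinfun"
    using shift by (auto simp: P_Suc[symmetric] P_Suc'[symmetric] intro: sums_unique2)
  then have "S (Y x) = Y x - x" "Y (S x) = Y x - x" for x
    by (metis blinfun_apply_blinfun_compose blinfun.diff_left blinfun_apply_id_blinfun)+
  then show ?thesis
    unfolding invertible_op_def using clin_Y
    by (intro exI[of _ Y]) (auto intro!: blinfun_eqI simp: blinfun.bilinear_simps)
qed

text \<open>Polarisation turns the bounds at \<open>x + y\<close> and \<open>x - y\<close> into one for \<open>\<langle>Sx, y\<rangle>\<close>; take \<open>y\<close> parallel to \<open>Sx\<close>.\<close>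

lemma norm_le_form_bound:
  assumes S: "self_adjoint_op S" and s: "0 \<le> s" and bd: "\<And>x. \<bar>inner (S x) x\<bar> \<le> s * inner x x"
  shows "norm S \<le> s"
proof (rule norm_blinfun_bound[OF s])
  fix x
  show "norm (S x) \<le> s * norm x"
  proof (cases "S x = 0 \<or> x = 0")
    case True
    then show ?thesis using s by auto
  next
    case False
    \<comment> \<open>the scaling makes \<open>y\<close> as long as \<open>x\<close>\<close>
    define k where "k = norm x / norm (S x)"
    define y where "y = k *\<^sub>R S x"
    have yy: "inner y y = inner x x"
      using False by (simp add: y_def k_def power2_norm_eq_inner[symmetric] field_simps power2_eq_square)
    have "4 * inner (S x) y = inner (S (x + y)) (x + y) - inner (S (x - y)) (x - y)"
      using self_adjoint_opD(2)[OF S, of y x]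
      by (simp add: blinfun.bilinear_simps inner_simps inner_commute)
    also have "\<dots> \<le> s * inner (x + y) (x + y) + s * inner (x - y) (x - y)"
      using bd[of "x + y"] bd[of "x - y"] by linarith
    also have "\<dots> = 4 * s * (norm x)\<^sup>2"
      by (simp add: power2_norm_eq_inner yy inner_simps algebra_simps)
    finally have "inner (S x) y \<le> s * (norm x)\<^sup>2"
      by simp
    moreover have "inner (S x) y = norm x * norm (S x)"
      using False by (simp add: y_def k_def power2_norm_eq_inner[symmetric] power2_eq_square)
    ultimately have "norm x * norm (S x) \<le> norm x * (s * norm x)"
      by (simp add: power2_eq_square mult.left_commute)
    then show ?thesis
      using False by simp
  qed
qed

text \<open>
  An operator with \<open>0 < c \<le> T\<close> is a multiple of \<open>1 - S\<close> with \<open>0 \<le> S < 1\<close>, so the Neumann series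
  inverts it.
\<close>

lemma invertible_op_of_form_ge:
  assumes T: "self_adjoint_op T" and c: "0 < c" and ge: "\<And>x. c * inner x x \<le> inner (T x) x"
  shows "invertible_op T"
proof -
  define C where "C = norm T + c"
  have C: "0 < C" "c \<le> C" using c by (auto simp: C_def add_nonneg_pos)
  define S where "S = id_blinfun - (1 / C) *\<^sub>R T"
  have S: "self_adjoint_op S"
    unfolding S_def by (intro self_adjoint_op_intros T)
  have Sx: "inner (S x) x = inner x x - inner (T x) x / C" for x
    by (simp add: S_def blinfun.bilinear_simps inner_simps)
  have "norm S \<le> 1 - c / C"
  proof (rule norm_le_form_bound[OF S])
    show "0 \<le> 1 - c / C" using C by simp
    fix x
    have "inner (T x) x \<le> C * inner x x"
      using form_boundsD(3)[OF form_bounds_norm[OF T], of x] c unfolding C_def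
      by (smt (verit) distrib_right inner_ge_zero mult_nonneg_nonneg)
    then have "inner (T x) x / C \<le> inner x x"
      using C by (simp add: pos_divide_le_eq mult.commute)
    moreover have "c * inner x x / C \<le> inner (T x) x / C"
      using C ge[of x] by (simp add: divide_right_mono)
    ultimately show "\<bar>inner (S x) x\<bar> \<le> (1 - c / C) * inner x x"
      by (simp add: Sx algebra_simps)
  qed
  also have "\<dots> < 1" using C c by simp
  finally have "invertible_op (id_blinfun - S)"
    using invertible_op_id_minus S self_adjoint_opD(1) by blast
  then have "invertible_op (C *\<^sub>R (id_blinfun - S))"
    using C by (intro invertible_op_scaleR) auto
  also have "C *\<^sub>R (id_blinfun - S) = T"
    using C by (auto intro!: blinfun_eqI simp: S_def blinfun.bilinear_simps)
  finally show ?thesis .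
qed

lemma self_adjoint_op_square_plus:
  assumes X: "self_adjoint_op X" and b: "b \<noteq> 0"
  shows "invertible_op (((X - a *\<^sub>R id_blinfun) o\<^sub>L (X - a *\<^sub>R id_blinfun)) + b\<^sup>2 *\<^sub>R id_blinfun)"
proof -
  define Y where "Y = X - a *\<^sub>R id_blinfun"
  have Y: "self_adjoint_op Y"
    unfolding Y_def by (intro self_adjoint_op_intros X)
  have "invertible_op ((Y o\<^sub>L Y) + b\<^sup>2 *\<^sub>R id_blinfun)"
  proof (rule invertible_op_of_form_ge)
    show "self_adjoint_op ((Y o\<^sub>L Y) + b\<^sup>2 *\<^sub>R id_blinfun)"
      by (intro self_adjoint_op_intros self_adjoint_op_compose Y refl)
    show "0 < b\<^sup>2" using b by simp
    show "b\<^sup>2 * inner x x \<le> inner (((Y o\<^sub>L Y) + b\<^sup>2 *\<^sub>R id_blinfun) x) x" for x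
      using self_adjoint_opD(2)[OF Y, of "Y x" x]
      by (simp add: blinfun.bilinear_simps inner_simps)
  qed
  then show ?thesis by (simp add: Y_def)
qed

text \<open>\<open>(X - z)(X - cnj z) = (X - Re z)\<^sup>2 + (Im z)\<^sup>2\<close> is invertible, hence so is its factor \<open>X - z\<close>.\<close>

lemma op_spectrum_self_adjoint_real:
  assumes X: "self_adjoint_op X" and z: "z \<in> op_spectrum X"
  shows "z = complex_of_real (Re z)"
proof (rule ccontr)
  assume "z \<noteq> complex_of_real (Re z)"
  then have b: "Im z \<noteq> 0" by (auto simp: complex_eq_iff)
  have comm: "X (c *\<^sub>C x) = c *\<^sub>C X x" for c x
    using X by (simp add: self_adjoint_opD clinear_opD)
  have zz: "z + cnj z = complex_of_real (2 * Re z)" "z * cnj z = complex_of_real ((Re z)\<^sup>2 + (Im z)\<^sup>2)"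
    by (auto simp: complex_eq_iff power2_eq_square)
  have lin: "z *\<^sub>C x + cnj z *\<^sub>C x = (2 * Re z) *\<^sub>R x" for x :: 'a
    by (metis scaleC_add_left scaleC_of_real zz(1))
  have quad: "z *\<^sub>C cnj z *\<^sub>C x = ((Re z)\<^sup>2 + (Im z)\<^sup>2) *\<^sub>R x" "cnj z *\<^sub>C z *\<^sub>C x = ((Re z)\<^sup>2 + (Im z)\<^sup>2) *\<^sub>R x" for x :: 'a
    by (metis scaleC_scaleC scaleC_of_real zz(2) mult.commute)+
  have left: "X (X x - cnj z *\<^sub>C x) - z *\<^sub>C (X x - cnj z *\<^sub>C x) =
      X (X x) - (z *\<^sub>C X x + cnj z *\<^sub>C X x) + z *\<^sub>C cnj z *\<^sub>C x" for x
    by (simp add: blinfun.diff_right comm scaleC_diff_right)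
  have left': "X (X x - z *\<^sub>C x) - cnj z *\<^sub>C (X x - z *\<^sub>C x) =
      X (X x) - (z *\<^sub>C X x + cnj z *\<^sub>C X x) + cnj z *\<^sub>C z *\<^sub>C x" for x
    by (simp add: blinfun.diff_right comm scaleC_diff_right)
  have right: "(((X - Re z *\<^sub>R id_blinfun) o\<^sub>L (X - Re z *\<^sub>R id_blinfun)) + (Im z)\<^sup>2 *\<^sub>R id_blinfun) x =
      X (X x) - (2 * Re z) *\<^sub>R X x + ((Re z)\<^sup>2 + (Im z)\<^sup>2) *\<^sub>R x" for x
    by (simp add: blinfun.bilinear_simps algebra_simps power2_eq_square scaleR_2 flip: scaleR_scaleR)
  have expand: "(X - scalar_op z) o\<^sub>L (X - scalar_op (cnj z)) =
      ((X - Re z *\<^sub>R id_blinfun) o\<^sub>L (X - Re z *\<^sub>R id_blinfun)) + (Im z)\<^sup>2 *\<^sub>R id_blinfun"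
    "(X - scalar_op (cnj z)) o\<^sub>L (X - scalar_op z) =
      ((X - Re z *\<^sub>R id_blinfun) o\<^sub>L (X - Re z *\<^sub>R id_blinfun)) + (Im z)\<^sup>2 *\<^sub>R id_blinfun"
    by (rule blinfun_eqI, unfold right,
        simp add: blinfun.diff_left left left' lin quad)+
  have "invertible_op (X - scalar_op z)"
  proof (rule invertible_op_factor)
    show "invertible_op ((X - scalar_op z) o\<^sub>L (X - scalar_op (cnj z)))"
      unfolding expand by (rule self_adjoint_op_square_plus[OF X b])
    show "clinear_op (X - scalar_op (cnj z))"
      using X by (intro clinear_op_intros self_adjoint_opD)
  qed (simp add: expand)
  with z show False by (simp add: op_spectrum_def)
qed

definition real_spectrum :: "('h::complex_hilbert \<Rightarrow>\<^sub>L 'h) \<Rightarrow> real set" where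
  "real_spectrum X = {r. complex_of_real r \<in> op_spectrum X}"

lemma real_spectrum_iff: "r \<in> real_spectrum X \<longleftrightarrow> \<not> invertible_op (X - r *\<^sub>R id_blinfun)"
  by (simp add: real_spectrum_def op_spectrum_def scalar_op_of_real)

lemma op_spectrum_subset_iff:
  assumes "self_adjoint_op X"
  shows "op_spectrum X \<subseteq> complex_of_real ` J \<longleftrightarrow> real_spectrum X \<subseteq> J"
  using op_spectrum_self_adjoint_real[OF assms] unfolding real_spectrum_def by fastforce

lemma real_spectrum_form_bounds:
  assumes "form_bounds a b X"
  shows "real_spectrum X \<subseteq> {a..b}"
proof
  fix r assume r: "r \<in> real_spectrum X"
  note X = form_boundsD[OF assms]
  have "\<not> r < a"
  proof
    assume "r < a"
    then have "invertible_op (X - r *\<^sub>R id_blinfun)"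
      using X(2) by (intro invertible_op_of_form_ge[where c = "a - r"])
        (auto intro!: self_adjoint_op_intros X(1) simp: blinfun.bilinear_simps inner_simps algebra_simps)
    with r show False by (simp add: real_spectrum_iff)
  qed
  moreover have "\<not> b < r"
  proof
    assume "b < r"
    then have "invertible_op (r *\<^sub>R id_blinfun - X)"
      using X(3) by (intro invertible_op_of_form_ge[where c = "r - b"])
        (auto intro!: self_adjoint_op_intros X(1) simp: blinfun.bilinear_simps inner_simps algebra_simps)
    from invertible_op_scaleR[OF this, of "-1"] r show False by (simp add: real_spectrum_iff)
  qed
  ultimately show "r \<in> {a..b}" by simp
qed

text \<open>
  If both \<open>T - \<mu>\<close> and \<open>T + \<mu>\<close> were invertible for \<open>\<mu> = \<parallel>T\<parallel>\<close>, then \<open>D = \<mu>\<^sup>2 - T\<^sup>2\<close> would be bounded below.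
  As \<open>\<parallel>Dx\<parallel>\<^sup>2 \<le> \<mu>\<^sup>2(\<mu>\<^sup>2\<parallel>x\<parallel>\<^sup>2 - \<parallel>Tx\<parallel>\<^sup>2)\<close>, this would leave a gap between \<open>\<parallel>Tx\<parallel>\<close> and \<open>\<mu>\<parallel>x\<parallel>\<close>.
\<close>

lemma norm_in_spectrum:
  fixes T :: "'h::complex_hilbert \<Rightarrow>\<^sub>L 'h"
  assumes T: "self_adjoint_op T" and nz: "T \<noteq> 0"
  shows "norm T \<in> real_spectrum T \<or> - norm T \<in> real_spectrum T"
proof (rule ccontr)
  define m where "m = norm T"
  have m: "0 < m" using nz by (simp add: m_def)
  assume "\<not> ?thesis"
  then have "invertible_op (T - m *\<^sub>R id_blinfun)" "invertible_op (T + m *\<^sub>R id_blinfun)"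
    by (auto simp: real_spectrum_iff m_def)
  then have "invertible_op ((T - m *\<^sub>R id_blinfun) o\<^sub>L (T + m *\<^sub>R id_blinfun))"
    by (rule invertible_op_compose)
  then obtain Y where "Y o\<^sub>L ((T - m *\<^sub>R id_blinfun) o\<^sub>L (T + m *\<^sub>R id_blinfun)) = id_blinfun"
    by (auto simp: invertible_op_def)
  moreover define D where "D = (T - m *\<^sub>R id_blinfun) o\<^sub>L (T + m *\<^sub>R id_blinfun)"
  ultimately have YD: "Y (D x) = x" for x
    by (metis blinfun_apply_blinfun_compose blinfun_apply_id_blinfun)
  have Dx: "D x = T (T x) - m\<^sup>2 *\<^sub>R x" for x
    by (simp add: D_def blinfun.bilinear_simps power2_eq_square algebra_simps)
  define K where "K = norm Y + 1"
  have K: "0 < K" by (simp add: K_def add_nonneg_pos)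
  have gap: "(norm x)\<^sup>2 \<le> K\<^sup>2 * m\<^sup>2 * (m\<^sup>2 * (norm x)\<^sup>2 - (norm (T x))\<^sup>2)" for x
  proof -
    have "norm x = norm (Y (D x))" by (simp add: YD)
    also have "\<dots> \<le> norm Y * norm (D x)" by (rule norm_blinfun)
    also have "\<dots> \<le> K * norm (D x)" by (simp add: K_def mult_right_mono)
    finally have 1: "(norm x)\<^sup>2 \<le> K\<^sup>2 * (norm (D x))\<^sup>2"
      by (metis norm_ge_zero power_mono power_mult_distrib)
    have "norm (T (T x)) \<le> m * norm (T x)"
      unfolding m_def by (rule norm_blinfun)
    then have 2: "(norm (T (T x)))\<^sup>2 \<le> m\<^sup>2 * (norm (T x))\<^sup>2"
      by (metis norm_ge_zero power_mono power_mult_distrib)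
    have "(norm (D x))\<^sup>2 = (norm (T (T x)))\<^sup>2 - 2 * m\<^sup>2 * (norm (T x))\<^sup>2 + m\<^sup>2 * m\<^sup>2 * (norm x)\<^sup>2"
      using self_adjoint_opD(2)[OF T, of "T x" x]
      by (simp add: power2_norm_eq_inner Dx inner_simps inner_commute algebra_simps)
    also have "\<dots> \<le> m\<^sup>2 * (m\<^sup>2 * (norm x)\<^sup>2 - (norm (T x))\<^sup>2)"
      using 2 by (simp add: algebra_simps)
    finally have "K\<^sup>2 * (norm (D x))\<^sup>2 \<le> K\<^sup>2 * (m\<^sup>2 * (m\<^sup>2 * (norm x)\<^sup>2 - (norm (T x))\<^sup>2))"
      by (intro mult_left_mono) auto
    with 1 show ?thesis by (simp add: mult.assoc)
  qed
  define q where "q = m\<^sup>2 - 1 / (K\<^sup>2 * m\<^sup>2)"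
  have Km: "0 < K\<^sup>2 * m\<^sup>2" using K m by simp
  have Tq: "(norm (T x))\<^sup>2 \<le> q * (norm x)\<^sup>2" for x
  proof -
    have "(norm x)\<^sup>2 / (K\<^sup>2 * m\<^sup>2) \<le> m\<^sup>2 * (norm x)\<^sup>2 - (norm (T x))\<^sup>2"
      using gap[of x] Km by (simp add: pos_divide_le_eq mult.commute mult.left_commute)
    then show ?thesis by (simp add: q_def left_diff_distrib)
  qed
  have q: "q < m\<^sup>2" using Km by (simp add: q_def)
  have "norm T \<le> sqrt (max q 0)"
  proof (rule norm_blinfun_bound)
    fix x
    have "(norm (T x))\<^sup>2 \<le> max q 0 * (norm x)\<^sup>2"
      using Tq[of x] by (smt (verit) mult_right_mono zero_le_power2)
    then show "norm (T x) \<le> sqrt (max q 0) * norm x"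
      by (metis norm_ge_zero real_sqrt_abs real_sqrt_le_iff real_sqrt_mult abs_of_nonneg)
  qed simp
  then have "m\<^sup>2 \<le> max q 0"
    by (metis m m_def less_imp_le real_sqrt_le_iff real_sqrt_abs abs_of_nonneg real_sqrt_unique real_le_rsqrt sqrt_le_D)
  with q m show False by (simp add: max_def split: if_splits)
qed

section \<open>Polynomials of an operator and spectral mapping\<close>

lemma op_poly_eq_sum:
  assumes "degree p \<le> n"
  shows "op_poly p X = (\<Sum>i\<le>n. coeff p i *\<^sub>R (((o\<^sub>L) X) ^^ i) id_blinfun)"
  unfolding op_poly_def using assms
  by (intro sum.mono_neutral_left) (auto simp: coeff_eq_0)

lemma op_poly_0 [simp]: "op_poly 0 X = 0"
  by (simp add: op_poly_def)

lemma op_poly_pCons: "op_poly (pCons a p) X = a *\<^sub>R id_blinfun + (X o\<^sub>L op_poly p X)"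
proof -
  have "op_poly (pCons a p) X = (\<Sum>i\<le>Suc (degree p). coeff (pCons a p) i *\<^sub>R (((o\<^sub>L) X) ^^ i) id_blinfun)"
    by (rule op_poly_eq_sum) (simp add: degree_pCons_le)
  also have "\<dots> = a *\<^sub>R id_blinfun + (\<Sum>i\<le>degree p. coeff p i *\<^sub>R (X o\<^sub>L ((((o\<^sub>L) X) ^^ i) id_blinfun)))"
    by (subst sum.atMost_Suc_shift) simp
  also have "\<dots> = a *\<^sub>R id_blinfun + (X o\<^sub>L op_poly p X)"
    by (rule blinfun_eqI) (simp add: op_poly_def blinfun.bilinear_simps blinfun.sum_left blinfun.sum_right)
  finally show ?thesis .
qed

lemma op_poly_pCons_apply: "op_poly (pCons a p) X x = a *\<^sub>R x + X (op_poly p X x)"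
  by (simp add: op_poly_pCons blinfun.bilinear_simps)

lemma op_poly_commute: "op_poly p X (X x) = X (op_poly p X x)"
  by (induction p) (auto simp: op_poly_pCons_apply blinfun.bilinear_simps)

lemma op_poly_add: "op_poly (p + q) X = op_poly p X + op_poly q X"
proof (rule blinfun_eqI)
  show "op_poly (p + q) X x = (op_poly p X + op_poly q X) x" for x
    by (induction p q rule: poly_induct2)
      (auto simp: op_poly_pCons_apply blinfun.bilinear_simps algebra_simps)
qed

lemma op_poly_smult: "op_poly (smult c p) X = c *\<^sub>R op_poly p X"
proof (rule blinfun_eqI)
  show "op_poly (smult c p) X x = (c *\<^sub>R op_poly p X) x" for x
    by (induction p) (auto simp: op_poly_pCons_apply blinfun.bilinear_simps algebra_simps)
qed

lemma op_poly_diff: "op_poly (p - q) X = op_poly p X - op_poly q X"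
  using op_poly_add[of p "smult (-1) q" X] unfolding op_poly_smult by simp

lemma op_poly_const: "op_poly [:c:] X = c *\<^sub>R id_blinfun"
  by (simp add: op_poly_pCons)

lemma op_poly_mult: "op_poly (p * q) X = op_poly p X o\<^sub>L op_poly q X"
proof (rule blinfun_eqI)
  show "op_poly (p * q) X x = (op_poly p X o\<^sub>L op_poly q X) x" for x
    by (induction p)
      (auto simp: op_poly_pCons_apply op_poly_add op_poly_smult blinfun.bilinear_simps algebra_simps)
qed

lemma op_poly_X: "op_poly [:0, 1:] X = X"
  by (rule blinfun_eqI) (simp add: op_poly_pCons_apply blinfun.bilinear_simps)

lemma op_poly_intertwine:
  fixes V :: "'h::complex_hilbert \<Rightarrow>\<^sub>L 'l::complex_hilbert" and X :: "'h \<Rightarrow>\<^sub>L 'h" and Z :: "'l \<Rightarrow>\<^sub>L 'l"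
  assumes "\<And>x. Z (V x) = V (X x)"
  shows "op_poly p Z (V x) = V (op_poly p X x)"
  by (induction p) (auto simp: op_poly_pCons_apply blinfun.bilinear_simps assms)

lemma self_adjoint_op_poly:
  assumes "self_adjoint_op X"
  shows "self_adjoint_op (op_poly p X)"
proof (induction p)
  case (pCons a p)
  have "X o\<^sub>L op_poly p X = op_poly p X o\<^sub>L X"
    by (rule blinfun_eqI) (simp add: op_poly_commute)
  then show ?case
    unfolding op_poly_pCons
    by (intro self_adjoint_op_intros self_adjoint_op_compose assms pCons)
qed auto

lemma tendsto_op_poly:
  assumes "(X \<longlongrightarrow> Y) F"
  shows "((\<lambda>n. op_poly p (X n)) \<longlongrightarrow> op_poly p Y) F"
proof (induction p)
  case (pCons a p)
  then show ?case
    unfolding op_poly_pCons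
    by (intro tendsto_add tendsto_const bounded_bilinear.tendsto[OF bounded_bilinear_blinfun_compose] assms)
qed auto

lemma poly_map_poly_of_real:
  "poly (map_poly complex_of_real q) (complex_of_real x) = complex_of_real (poly q x)"
  by (induction q) (auto simp: map_poly_pCons)

text \<open>
  A non-real root \<open>z\<close> comes with its conjugate. The divisor is \<open>(x - z)(x - cnj z)\<close>, and the remainder, which is
  of degree at most one with real coefficients, can vanish at \<open>z\<close> only if it is zero.
\<close>

lemma real_poly_complex_root_factor:
  fixes q :: "real poly"
  assumes z: "poly (map_poly complex_of_real q) z = 0" and im: "Im z \<noteq> 0"
  shows "[:(Re z)\<^sup>2 + (Im z)\<^sup>2, - 2 * Re z, 1:] dvd q"
proof -
  define d :: "real poly" where "d = [:(Re z)\<^sup>2 + (Im z)\<^sup>2, - 2 * Re z, 1:]"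
  define c where "c p = poly (map_poly complex_of_real p) z" for p
  have c_pCons: "c (pCons a p) = of_real a + z * c p" for a p
    by (simp add: c_def map_poly_pCons)
  have c_0: "c 0 = 0" by (simp add: c_def)
  have c_add: "c (p + r) = c p + c r" for p r
    by (induction p r rule: poly_induct2) (auto simp: c_pCons c_0 algebra_simps)
  have c_smult: "c (smult a p) = of_real a * c p" for a p
    by (induction p) (auto simp: c_pCons c_0 algebra_simps)
  have c_mult: "c (p * r) = c p * c r" for p r
    by (induction p) (auto simp: c_pCons c_0 c_add c_smult algebra_simps)
  have d0: "c d = 0"
    by (simp add: d_def c_pCons c_0 complex_eq_iff power2_eq_square algebra_simps)
  have dd: "degree d = 2" "d \<noteq> 0" by (auto simp: d_def)
  have "c (q mod d) = 0"
    using z c_add[of "q div d * d" "q mod d"] c_mult[of "q div d" d] d0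
    unfolding c_def by (simp add: div_mult_mod_eq)
  moreover obtain u v where uv: "q mod d = [:u, v:]"
  proof -
    have deg: "degree (q mod d) < 2"
      using degree_mod_less'[of d q] dd by (cases "q mod d = 0") auto
    obtain u r where ur: "q mod d = pCons u r" by (cases "q mod d")
    have "degree r = 0" using deg by (cases "r = 0") (auto simp: ur)
    then obtain v where "r = [:v:]" by (metis degree_eq_zeroE)
    with ur that show thesis by simp
  qed
  ultimately have "of_real u + z * of_real v = 0"
    by (simp add: c_pCons c_0)
  then have "v = 0" "u = 0" using im by (auto simp: complex_eq_iff)
  then have "q mod d = 0" by (simp add: uv)
  then show ?thesis by (simp add: d_def dvd_eq_mod_eq_0)
qed

text \<open>
  This is the contrapositive of spectral mapping. Over the reals \<open>q\<close> splits into linear and quadratic factors: the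
  linear factors \<open>X - r\<close> are invertible as \<open>r\<close> is not in the spectrum, and the quadratic
  ones \<open>(X - a)\<^sup>2 + b\<^sup>2\<close> always are.
\<close>

lemma invertible_op_poly:
  assumes X: "self_adjoint_op X" and q: "q \<noteq> 0" "\<And>r. r \<in> real_spectrum X \<Longrightarrow> poly q r \<noteq> 0"
  shows "invertible_op (op_poly q X)"
  using q
proof (induction "degree q" arbitrary: q rule: less_induct)
  case less
  show ?case
  proof (cases "degree q = 0")
    case True
    then obtain c where "q = [:c:]" by (metis degree_eq_zeroE)
    then show ?thesis
      using less.prems(1) by (auto simp: op_poly_const intro!: invertible_op_scaleR invertible_op_id)
  next
    case False
    then have "degree (map_poly complex_of_real q) \<noteq> 0"
      using less.prems(1) by (subst map_poly_degree_eq) auto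
    then obtain z where z: "poly (map_poly complex_of_real q) z = 0"
      using fundamental_theorem_of_algebra[of "map_poly complex_of_real q"] by (auto simp: constant_degree)
    obtain d q' where dq: "q = d * q'" and d: "degree d > 0"
      "(\<And>r. r \<in> real_spectrum X \<Longrightarrow> poly d r \<noteq> 0) \<Longrightarrow> invertible_op (op_poly d X)"
    proof (cases "Im z = 0")
      case True
      then have "z = of_real (Re z)" by (simp add: complex_eq_iff)
      then have "poly q (Re z) = 0"
        using z poly_map_poly_of_real[of q "Re z"] by simp
      then have "[:- Re z, 1:] dvd q" by (simp add: poly_eq_0_iff_dvd)
      then obtain q' where q': "q = [:- Re z, 1:] * q'" by (elim dvdE)
      have "invertible_op (op_poly [:- Re z, 1:] X)"
        if "\<And>r. r \<in> real_spectrum X \<Longrightarrow> poly [:- Re z, 1:] r \<noteq> 0"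
      proof -
        have "Re z \<notin> real_spectrum X" using that by force
        moreover have "op_poly [:- Re z, 1:] X = X - Re z *\<^sub>R id_blinfun"
          by (rule blinfun_eqI) (simp add: op_poly_pCons_apply blinfun.bilinear_simps)
        ultimately show ?thesis by (simp add: real_spectrum_iff)
      qed
      with q' that show ?thesis by fastforce
    next
      case False
      then obtain q' where q': "q = [:(Re z)\<^sup>2 + (Im z)\<^sup>2, - 2 * Re z, 1:] * q'"
        using real_poly_complex_root_factor[OF z False] by (elim dvdE)
      have "op_poly [:(Re z)\<^sup>2 + (Im z)\<^sup>2, - 2 * Re z, 1:] X =
          ((X - Re z *\<^sub>R id_blinfun) o\<^sub>L (X - Re z *\<^sub>R id_blinfun)) + (Im z)\<^sup>2 *\<^sub>R id_blinfun"
        by (rule blinfun_eqI)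
          (simp add: op_poly_pCons_apply blinfun.bilinear_simps algebra_simps power2_eq_square scaleR_2 flip: scaleR_scaleR)
      then have "invertible_op (op_poly [:(Re z)\<^sup>2 + (Im z)\<^sup>2, - 2 * Re z, 1:] X)"
        using self_adjoint_op_square_plus[OF X False] by simp
      with q' that show ?thesis by fastforce
    qed
    have nz: "d \<noteq> 0" "q' \<noteq> 0" using dq less.prems(1) by auto
    then have "degree q' < degree q" using dq d(1) by (simp add: degree_mult_eq)
    then have "invertible_op (op_poly q' X)"
      using less.hyps less.prems(2) nz dq by auto
    moreover have "invertible_op (op_poly d X)"
      using d(2) less.prems(2) dq by auto
    ultimately show ?thesis
      unfolding dq op_poly_mult by (intro invertible_op_compose)
  qed
qed

lemma zero_in_real_spectrum_zero:
  assumes "\<exists>x::'h::complex_hilbert. x \<noteq> 0"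
  shows "0 \<in> real_spectrum (0 :: 'h \<Rightarrow>\<^sub>L 'h)"
proof (rule ccontr)
  assume "0 \<notin> real_spectrum (0 :: 'h \<Rightarrow>\<^sub>L 'h)"
  then obtain Y where "(0 :: 'h \<Rightarrow>\<^sub>L 'h) o\<^sub>L Y = id_blinfun"
    by (auto simp: real_spectrum_iff invertible_op_def)
  then have "x = 0" for x :: 'h
    by (metis blinfun_apply_id_blinfun blinfun_compose_zero(1) zero_blinfun.rep_eq)
  with assms show False by blast
qed

lemma real_spectrum_nonempty:
  fixes X :: "'h::complex_hilbert \<Rightarrow>\<^sub>L 'h"
  assumes "self_adjoint_op X" and "\<exists>x::'h. x \<noteq> 0"
  shows "real_spectrum X \<noteq> {}"
  using norm_in_spectrum[OF assms(1)] zero_in_real_spectrum_zero[OF assms(2)]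
  by (cases "X = 0") auto

text \<open>
  The self-adjoint operator \<open>p(X)\<close> has \<open>m = \<plusminus>\<parallel>p(X)\<parallel>\<close> in its spectrum; so \<open>p - m\<close>, which maps \<open>X\<close> to a
  non-invertible operator, vanishes somewhere on the spectrum of \<open>X\<close>.
\<close>

lemma norm_op_poly_attained:
  fixes X :: "'h::complex_hilbert \<Rightarrow>\<^sub>L 'h"
  assumes X: "self_adjoint_op X" and nontriv: "\<exists>x::'h. x \<noteq> 0"
  shows "\<exists>r\<in>real_spectrum X. \<bar>poly p r\<bar> = norm (op_poly p X)"
proof -
  have *: "\<exists>r\<in>real_spectrum X. poly p r = m" if m: "m \<in> real_spectrum (op_poly p X)" for m
  proof (cases "p = [:m:]")
    case True
    then show ?thesis using real_spectrum_nonempty[OF assms] by auto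
  next
    case False
    have "\<not> invertible_op (op_poly (p - [:m:]) X)"
      using m by (simp add: real_spectrum_iff op_poly_diff op_poly_const)
    with False invertible_op_poly[OF X, of "p - [:m:]"] show ?thesis by auto
  qed
  show ?thesis
  proof (cases "op_poly p X = 0")
    case True
    then have "0 \<in> real_spectrum (op_poly p X)"
      using zero_in_real_spectrum_zero[OF nontriv] by simp
    from *[OF this] True show ?thesis by auto
  next
    case False
    from norm_in_spectrum[OF self_adjoint_op_poly[OF X] this] * show ?thesis
      by (metis abs_minus_cancel abs_norm_cancel)
  qed
qed

lemma norm_op_poly_le:
  fixes X :: "'h::complex_hilbert \<Rightarrow>\<^sub>L 'h"
  assumes X: "self_adjoint_op X" and le: "\<And>r. r \<in> real_spectrum X \<Longrightarrow> \<bar>poly p r\<bar> \<le> c" and "0 \<le> c"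
  shows "norm (op_poly p X) \<le> c"
proof (cases "\<exists>x::'h. x \<noteq> 0")
  case True
  then show ?thesis using norm_op_poly_attained[OF X, of p] le by force
next
  case False
  then have "op_poly p X = 0"
    by (intro blinfun_eqI) metis
  then show ?thesis using assms(3) by simp
qed

text \<open>
  For \<open>c = \<parallel>X\<parallel>\<close> the operators \<open>c - X\<close> and \<open>c + X\<close> are positive, so their norms are attained
  at the lowest and at the highest point of the spectrum of \<open>X\<close>.
\<close>

lemma form_bounds_in_spectrum:
  fixes X :: "'h::complex_hilbert \<Rightarrow>\<^sub>L 'h"
  assumes X: "self_adjoint_op X" and nontriv: "\<exists>x::'h. x \<noteq> 0"
  obtains a b where "a \<in> real_spectrum X" "b \<in> real_spectrum X" "form_bounds a b X"
proof -
  define c where "c = norm X"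
  have bd: "\<bar>r\<bar> \<le> c" if "r \<in> real_spectrum X" for r
    using real_spectrum_form_bounds[OF form_bounds_norm[OF X]] that unfolding c_def by force
  have cX: "op_poly [:c, -1:] X = c *\<^sub>R id_blinfun - X" "op_poly [:c, 1:] X = c *\<^sub>R id_blinfun + X"
    by (auto intro!: blinfun_eqI simp: op_poly_pCons_apply blinfun.bilinear_simps)
  obtain a where a: "a \<in> real_spectrum X" "\<bar>c - a\<bar> = norm (c *\<^sub>R id_blinfun - X)"
    using norm_op_poly_attained[OF assms, of "[:c, -1:]"]
    unfolding cX by auto
  obtain b where b: "b \<in> real_spectrum X" "\<bar>c + b\<bar> = norm (c *\<^sub>R id_blinfun + X)"
    using norm_op_poly_attained[OF assms, of "[:c, 1:]"] unfolding cX by auto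
  have "form_bounds (- (c - a)) (c - a) (c *\<^sub>R id_blinfun - X)"
    using form_bounds_norm[of "c *\<^sub>R id_blinfun - X"] a bd[OF a(1)]
    by (auto intro!: self_adjoint_op_intros X)
  moreover have "form_bounds (- (c + b)) (c + b) (c *\<^sub>R id_blinfun + X)"
    using form_bounds_norm[of "c *\<^sub>R id_blinfun + X"] b bd[OF b(1)]
    by (auto intro!: self_adjoint_op_intros X)
  ultimately have "form_bounds a b X"
    using X by (auto simp: form_bounds_def blinfun.bilinear_simps inner_simps algebra_simps)
  with a b that show thesis by blast
qed

section \<open>The continuous functional calculus\<close>

lemma polynomial_uniform_approx:
  fixes f :: "real \<Rightarrow> real"
  assumes "continuous_on {a..b} f"
  obtains p :: "nat \<Rightarrow> real poly" where "uniform_limit {a..b} (\<lambda>n. poly (p n)) f sequentially"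
proof -
  have "\<exists>p::real poly. \<forall>x\<in>{a..b}. \<bar>f x - poly p x\<bar> < inverse (real (Suc n))" for n
  proof -
    obtain g where g: "real_polynomial_function g" "\<And>x. x \<in> {a..b} \<Longrightarrow> \<bar>f x - g x\<bar> < inverse (real (Suc n))"
      using Stone_Weierstrass_real_polynomial_function[OF compact_Icc assms, of "inverse (real (Suc n))"] by auto
    obtain c m where "g = (\<lambda>x. \<Sum>i\<le>m. c i * x ^ i)"
      using g(1) by (auto simp: real_polynomial_function_iff_sum)
    then have "g = poly (\<Sum>i\<le>m. monom (c i) i)"
      by (simp add: fun_eq_iff poly_sum poly_monom)
    with g(2) show ?thesis by blast
  qed
  then obtain p :: "nat \<Rightarrow> real poly"
    where p: "\<And>n x. x \<in> {a..b} \<Longrightarrow> \<bar>f x - poly (p n) x\<bar> < inverse (real (Suc n))"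
    by metis
  have "uniform_limit {a..b} (\<lambda>n. poly (p n)) f sequentially"
  proof (rule uniform_limitI)
    fix e :: real assume "0 < e"
    then have "\<forall>\<^sub>F n in sequentially. inverse (real (Suc n)) < e"
      using LIMSEQ_inverse_real_of_nat by (auto dest: order_tendstoD)
    then show "\<forall>\<^sub>F n in sequentially. \<forall>x\<in>{a..b}. dist (poly (p n) x) (f x) < e"
    proof eventually_elim
      case (elim n)
      then show ?case using p[of _ n] by (force simp: dist_real_def abs_minus_commute)
    qed
  qed
  with that show thesis .
qed

text \<open>
  Two sequences of polynomials with the same uniform limit on the spectrum have differences tending to
  zero there, and the supremum over the spectrum controls the operator norm; so the description that
  defines the functional calculus is satisfied by at most one operator.
\<close>

lemma cfc_eqI:
  assumes X: "self_adjoint_op X"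
    and p: "uniform_limit (real_spectrum X) (\<lambda>n. poly (p n)) f sequentially"
    and Y: "(\<lambda>n. op_poly (p n) X) \<longlonglongrightarrow> Y"
  shows "cfc f X = Y"
  unfolding cfc_def real_spectrum_def[symmetric]
proof (rule the_equality)
  show "\<exists>p. uniform_limit (real_spectrum X) (\<lambda>n. poly (p n)) f sequentially \<and> (\<lambda>n. op_poly (p n) X) \<longlonglongrightarrow> Y"
    using p Y by blast
  fix Y'
  assume "\<exists>p. uniform_limit (real_spectrum X) (\<lambda>n. poly (p n)) f sequentially \<and> (\<lambda>n. op_poly (p n) X) \<longlonglongrightarrow> Y'"
  then obtain q where q: "uniform_limit (real_spectrum X) (\<lambda>n. poly (q n)) f sequentially"
    and Y': "(\<lambda>n. op_poly (q n) X) \<longlonglongrightarrow> Y'" by blast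
  have "(\<lambda>n. op_poly (q n) X - op_poly (p n) X) \<longlonglongrightarrow> 0"
  proof (rule LIMSEQ_I)
    fix e :: real assume e: "0 < e"
    then have e4: "0 < e / 4" by simp
    have "\<forall>\<^sub>F n in sequentially. norm (op_poly (q n) X - op_poly (p n) X) < e"
      using uniform_limitD[OF p e4] uniform_limitD[OF q e4]
    proof eventually_elim
      case (elim n)
      note * = elim
      have "norm (op_poly (q n - p n) X) \<le> e / 2"
      proof (rule norm_op_poly_le[OF X])
        fix r assume "r \<in> real_spectrum X"
        with * have "\<bar>poly (p n) r - f r\<bar> < e / 4" "\<bar>poly (q n) r - f r\<bar> < e / 4"
          unfolding dist_real_def by blast+
        then show "\<bar>poly (q n - p n) r\<bar> \<le> e / 2" by (simp only: poly_diff abs_le_iff abs_less_iff) linarith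
      qed (use e in simp)
      then show ?case
        using e by (simp add: op_poly_diff)
    qed
    then show "\<exists>no. \<forall>n\<ge>no. norm (op_poly (q n) X - op_poly (p n) X - 0) < e"
      by (simp add: eventually_sequentially)
  qed
  moreover have "(\<lambda>n. op_poly (q n) X - op_poly (p n) X) \<longlonglongrightarrow> Y' - Y"
    by (intro tendsto_diff Y Y')
  ultimately show "Y' = Y" using LIMSEQ_unique by fastforce
qed

lemma tendsto_op_poly_cfc:
  assumes X: "form_bounds a b X"
    and p: "uniform_limit {a..b} (\<lambda>n. poly (p n)) f sequentially"
  shows "(\<lambda>n. op_poly (p n) X) \<longlonglongrightarrow> cfc f X"
proof -
  note spec = real_spectrum_form_bounds[OF X]
  have "Cauchy (\<lambda>n. op_poly (p n) X)"
  proof (rule CauchyI)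
    fix e :: real assume e: "0 < e"
    then have e4: "0 < e / 4" by simp
    from uniform_limitD[OF p e4]
    obtain N where N: "\<And>n x. n \<ge> N \<Longrightarrow> x \<in> {a..b} \<Longrightarrow> dist (poly (p n) x) (f x) < e / 4"
      unfolding eventually_sequentially by blast
    have "norm (op_poly (p m) X - op_poly (p n) X) < e" if "m \<ge> N" "n \<ge> N" for m n
    proof -
      have "norm (op_poly (p m - p n) X) \<le> e / 2"
      proof (rule norm_op_poly_le[OF form_boundsD(1)[OF X]])
        fix r assume "r \<in> real_spectrum X"
        with spec N[OF that(1), of r] N[OF that(2), of r]
        have "\<bar>poly (p m) r - f r\<bar> < e / 4" "\<bar>poly (p n) r - f r\<bar> < e / 4"
          unfolding dist_real_def by blast+
        then show "\<bar>poly (p m - p n) r\<bar> \<le> e / 2" by (simp only: poly_diff abs_le_iff abs_less_iff) linarith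
      qed (use e in simp)
      then show ?thesis using e by (simp add: op_poly_diff)
    qed
    then show "\<exists>M. \<forall>m\<ge>M. \<forall>n\<ge>M. norm (op_poly (p m) X - op_poly (p n) X) < e" by blast
  qed
  then obtain Y where Y: "(\<lambda>n. op_poly (p n) X) \<longlonglongrightarrow> Y"
    using convergent_eq_Cauchy by blast
  with cfc_eqI[OF form_boundsD(1)[OF X] uniform_limit_on_subset[OF p spec] Y] show ?thesis by simp
qed

text \<open>The polynomial may be chosen before the operator, and even before the Hilbert space.\<close>

lemma cfc_poly_approx:
  assumes X: "form_bounds a b X" and f: "continuous_on {a..b} f"
    and p: "\<And>r. r \<in> {a..b} \<Longrightarrow> \<bar>poly p r - f r\<bar> \<le> e" and e: "0 \<le> e"
  shows "norm (op_poly p X - cfc f X) \<le> e"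
proof -
  obtain q :: "nat \<Rightarrow> real poly" where q: "uniform_limit {a..b} (\<lambda>n. poly (q n)) f sequentially"
    using polynomial_uniform_approx[OF f] .
  have lim: "(\<lambda>n. norm (op_poly p X - op_poly (q n) X)) \<longlonglongrightarrow> norm (op_poly p X - cfc f X)"
    by (intro tendsto_intros tendsto_op_poly_cfc[OF X q])
  show ?thesis
  proof (rule field_le_epsilon)
    fix d :: real assume d: "0 < d"
    have "\<forall>\<^sub>F n in sequentially. norm (op_poly p X - op_poly (q n) X) \<le> e + d"
      using uniform_limitD[OF q d]
    proof eventually_elim
      case (elim n)
      have "norm (op_poly (p - q n) X) \<le> e + d"
      proof (rule norm_op_poly_le[OF form_boundsD(1)[OF X]])
        fix r assume "r \<in> real_spectrum X"
        then have r: "r \<in> {a..b}" using real_spectrum_form_bounds[OF X] by blast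
        then have "\<bar>poly (q n) r - f r\<bar> < d" using elim by (auto simp: dist_real_def)
        with p[OF r] show "\<bar>poly (p - q n) r\<bar> \<le> e + d" by (simp add: abs_if split: if_splits)
      qed (use d e in simp)
      then show ?case by (simp add: op_poly_diff)
    qed
    then show "norm (op_poly p X - cfc f X) \<le> e + d"
      by (intro tendsto_upperbound[OF lim]) auto
  qed
qed

lemma self_adjoint_cfc:
  assumes "form_bounds a b X" "continuous_on {a..b} f"
  shows "self_adjoint_op (cfc f X)"
proof -
  obtain p where "uniform_limit {a..b} (\<lambda>n. poly (p n)) f sequentially"
    using polynomial_uniform_approx[OF assms(2)] .
  from self_adjoint_op_lim[OF self_adjoint_op_poly[OF form_boundsD(1)[OF assms(1)]]
      tendsto_op_poly_cfc[OF assms(1) this]]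
  show ?thesis .
qed

lemma cfc_intertwine:
  fixes V :: "'h::complex_hilbert \<Rightarrow>\<^sub>L 'l::complex_hilbert"
  assumes X: "form_bounds a b X" and Z: "form_bounds a b Z" and f: "continuous_on {a..b} f"
    and V: "\<And>x. Z (V x) = V (X x)"
  shows "cfc f Z (V x) = V (cfc f X x)"
proof -
  obtain p where p: "uniform_limit {a..b} (\<lambda>n. poly (p n)) f sequentially"
    using polynomial_uniform_approx[OF f] .
  have "(\<lambda>n. op_poly (p n) Z (V x)) \<longlonglongrightarrow> cfc f Z (V x)"
    by (intro tendsto_intros tendsto_op_poly_cfc[OF Z p])
  moreover have "(\<lambda>n. V (op_poly (p n) X x)) \<longlonglongrightarrow> V (cfc f X x)"
    by (intro tendsto_intros tendsto_op_poly_cfc[OF X p])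
  ultimately show ?thesis
    using op_poly_intertwine[OF V] by (simp add: LIMSEQ_unique)
qed

lemma cfc_mult:
  assumes X: "form_bounds a b X" and f: "continuous_on {a..b} f" and g: "continuous_on {a..b} g"
  shows "cfc (\<lambda>r. f r * g r) X = cfc f X o\<^sub>L cfc g X"
proof -
  obtain p where p: "uniform_limit {a..b} (\<lambda>n. poly (p n)) f sequentially"
    using polynomial_uniform_approx[OF f] .
  obtain q where q: "uniform_limit {a..b} (\<lambda>n. poly (q n)) g sequentially"
    using polynomial_uniform_approx[OF g] .
  have "bounded (f ` {a..b})" "bounded (g ` {a..b})"
    using f g by (auto intro!: compact_imp_bounded compact_continuous_image)
  then have "uniform_limit {a..b} (\<lambda>n r. poly (p n) r * poly (q n) r) (\<lambda>r. f r * g r) sequentially"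
    by (intro uniform_lim_mult p q)
  then have "uniform_limit {a..b} (\<lambda>n. poly (p n * q n)) (\<lambda>r. f r * g r) sequentially"
    by (simp add: poly_mult[abs_def])
  from tendsto_op_poly_cfc[OF X this]
  have "(\<lambda>n. op_poly (p n) X o\<^sub>L op_poly (q n) X) \<longlonglongrightarrow> cfc (\<lambda>r. f r * g r) X"
    by (simp add: op_poly_mult)
  moreover have "(\<lambda>n. op_poly (p n) X o\<^sub>L op_poly (q n) X) \<longlonglongrightarrow> (cfc f X o\<^sub>L cfc g X)"
    by (intro bounded_bilinear.tendsto[OF bounded_bilinear_blinfun_compose] tendsto_op_poly_cfc[OF X] p q)
  ultimately show ?thesis by (rule LIMSEQ_unique)
qed

lemma cfc_eq_op_poly:
  assumes X: "form_bounds a b X" and p: "\<And>r. r \<in> {a..b} \<Longrightarrow> f r = poly p r"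
  shows "cfc f X = op_poly p X"
proof -
  have "uniform_limit {a..b} (\<lambda>n. poly p) f sequentially"
    using p by (intro uniform_limitI) auto
  from tendsto_op_poly_cfc[OF X this] show ?thesis
    using LIMSEQ_unique tendsto_const by metis
qed

lemma tendsto_cfc:
  assumes X: "\<forall>\<^sub>F n in F. form_bounds a b (X n)" and Y: "form_bounds a b Y"
    and f: "continuous_on {a..b} f" and lim: "(X \<longlongrightarrow> Y) F"
  shows "((\<lambda>n. cfc f (X n)) \<longlongrightarrow> cfc f Y) F"
proof (rule tendstoI)
  fix e :: real assume e: "0 < e"
  obtain p :: "nat \<Rightarrow> real poly" where p: "uniform_limit {a..b} (\<lambda>n. poly (p n)) f sequentially"
    using polynomial_uniform_approx[OF f] .
  obtain q :: "real poly" where q: "\<And>r. r \<in> {a..b} \<Longrightarrow> \<bar>poly q r - f r\<bar> \<le> e / 4"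
    using uniform_limitD[OF p, of "e / 4"] e
    by (force simp: eventually_sequentially dist_real_def intro: less_imp_le)
  have "\<forall>\<^sub>F n in F. dist (op_poly q (X n)) (op_poly q Y) < e / 4"
    using tendstoD[OF tendsto_op_poly[OF lim, of q], of "e / 4"] e by simp
  with X show "\<forall>\<^sub>F n in F. dist (cfc f (X n)) (cfc f Y) < e"
  proof eventually_elim
    case (elim n)
    have 1: "norm (op_poly q (X n) - cfc f (X n)) \<le> e / 4"
      by (rule cfc_poly_approx[OF elim(1) f q]) (use e in auto)
    have 2: "norm (op_poly q Y - cfc f Y) \<le> e / 4"
      by (rule cfc_poly_approx[OF Y f q]) (use e in auto)
    have "cfc f (X n) - cfc f Y = - (op_poly q (X n) - cfc f (X n)) + (op_poly q (X n) - op_poly q Y)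
        + (op_poly q Y - cfc f Y)" by simp
    then have "norm (cfc f (X n) - cfc f Y) \<le>
        norm (op_poly q (X n) - cfc f (X n)) + norm (op_poly q (X n) - op_poly q Y) + norm (op_poly q Y - cfc f Y)"
      by (metis norm_minus_cancel norm_triangle_le norm_triangle_mono order_refl)
    with 1 2 elim(2) e show ?case by (simp add: dist_norm)
  qed
qed

section \<open>Transport of operator convexity between Hilbert spaces\<close>

lemma cinner_adjoint:
  fixes W :: "'l::complex_hilbert \<Rightarrow>\<^sub>L 'k::complex_hilbert" and W' :: "'k \<Rightarrow>\<^sub>L 'l"
  assumes "\<And>c y. W' (c *\<^sub>C y) = c *\<^sub>C W' y" "\<And>x y. inner (W x) y = inner x (W' y)"
  shows "cinner (W x) y = cinner x (W' y)"
  by (simp add: cinner_eq_Complex assms)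

lemma scaleC_zero_left [simp]: "0 *\<^sub>C (x::'a::complex_hilbert) = 0"
  using scaleC_of_real[of 0 x] by simp

definition rank_one :: "'l::complex_hilbert \<Rightarrow> 'k::complex_hilbert \<Rightarrow> 'l \<Rightarrow>\<^sub>L 'k" where
  "rank_one e k = Blinfun (\<lambda>x. cinner x e *\<^sub>C k)"

lemma rank_one_apply:
  fixes e :: "'l::complex_hilbert" and k :: "'k::complex_hilbert"
  shows "rank_one e k x = cinner x e *\<^sub>C k"
proof -
  have "cinner x e *\<^sub>C k = inner x e *\<^sub>R k + inner x (\<i> *\<^sub>C e) *\<^sub>R (\<i> *\<^sub>C k)" for x :: 'l
  proof -
    have "cinner x e *\<^sub>C k = (of_real (inner x e) + of_real (inner x (\<i> *\<^sub>C e)) * \<i>) *\<^sub>C k"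
      by (simp add: cinner_eq_Complex Complex_eq mult.commute)
    then show ?thesis
      by (simp only: scaleC_add_left scaleC_of_real scaleC_scaleC[symmetric])
  qed
  then have "bounded_linear (\<lambda>x. cinner x e *\<^sub>C k)"
    by (auto intro!: bounded_linear_add bounded_linear_scaleR_const bounded_linear_inner_left)
  then show ?thesis
    by (simp add: rank_one_def bounded_linear_Blinfun_apply)
qed

definition partial_isometry_pair ::
    "('l::complex_hilbert \<Rightarrow>\<^sub>L 'k::complex_hilbert) \<Rightarrow> ('k \<Rightarrow>\<^sub>L 'l) \<Rightarrow> bool" where
  "partial_isometry_pair W W' \<longleftrightarrow>
     (\<forall>c x. W (c *\<^sub>C x) = c *\<^sub>C W x) \<and> (\<forall>c y. W' (c *\<^sub>C y) = c *\<^sub>C W' y) \<and>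
     (\<forall>x y. inner (W x) y = inner x (W' y)) \<and> (\<forall>x. W (W' (W x)) = W x)"

lemma partial_isometry_pairD:
  assumes "partial_isometry_pair W W'"
  shows "W (c *\<^sub>C x) = c *\<^sub>C W x" "W' (c *\<^sub>C y) = c *\<^sub>C W' y"
    "inner (W x) y = inner x (W' y)" "W (W' (W x)) = W x" "W' (W (W' y)) = W' y"
proof -
  show *: "W (c *\<^sub>C x) = c *\<^sub>C W x" "W' (c *\<^sub>C y) = c *\<^sub>C W' y"
    "inner (W x) y = inner x (W' y)" "W (W' (W x)) = W x" for c x y
    using assms by (simp_all add: partial_isometry_pair_def)
  have "inner z (W' (W (W' y))) = inner z (W' y)" for z
    by (metis *(3) *(4) inner_commute)
  then show "W' (W (W' y)) = W' y" using vector_eq_ldot by blast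
qed

text \<open>
  Each new vector contributes to \<open>W\<close> the rank-one map that takes its normalised component orthogonal to the
  previous ones to a unit vector orthogonal to the range reached so far. Such a unit vector exists
  because the range is spanned by a finite set \<open>S\<close>, while the target space is infinite-dimensional.
\<close>

lemma finite_partial_isometry:
  fixes F :: "'l::complex_hilbert set"
  assumes inf: "\<not> (\<exists>S :: 'k::complex_hilbert set. finite S \<and> span S = UNIV)" and F: "finite F"
  shows "\<exists>(W :: 'l \<Rightarrow>\<^sub>L 'k) W' S. partial_isometry_pair W W' \<and> (\<forall>u\<in>F. W' (W u) = u) \<and>
    finite S \<and> range W \<subseteq> span S"
  using F
proof induction
  case empty
  have "partial_isometry_pair (0 :: 'l \<Rightarrow>\<^sub>L 'k) 0"
    by (simp add: partial_isometry_pair_def)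
  then show ?case
    by (intro exI[of _ 0] exI[of _ "{}"]) auto
next
  case (insert u F)
  obtain W :: "'l \<Rightarrow>\<^sub>L 'k" and W' S where WW': "partial_isometry_pair W W'"
    and fix_F: "\<forall>u\<in>F. W' (W u) = u" and S: "finite S" "range W \<subseteq> span S"
    using insert.IH by blast
  note lin = partial_isometry_pairD(1,2)[OF WW'] and adj = partial_isometry_pairD(3)[OF WW']
    and WWW = partial_isometry_pairD(4)[OF WW'] and W'WW' = partial_isometry_pairD(5)[OF WW']
  note cadj = cinner_adjoint[OF lin(2) adj]
  show ?case
  proof (cases "W' (W u) = u")
    case True
    then show ?thesis using WW' fix_F S by blast
  next
    case False
    define r where "r = u - W' (W u)"
    define e where "e = (1 / norm r) *\<^sub>R r"
    have r: "norm r \<noteq> 0" "W r = 0"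
      using False by (auto simp: r_def blinfun.bilinear_simps WWW)
    then have We: "W e = 0" by (simp add: e_def blinfun.bilinear_simps)
    have e: "norm e = 1" using r by (simp add: e_def)
    obtain k0 where k0: "k0 \<notin> span S"
      using inf S(1) by blast
    define k1 where "k1 = k0 - W (W' k0)"
    define k where "k = (1 / norm k1) *\<^sub>R k1"
    have k1: "norm k1 \<noteq> 0" "W' k1 = 0"
      using k0 S(2) by (auto simp: k1_def blinfun.bilinear_simps W'WW')
    then have W'k: "W' k = 0" and k: "norm k = 1"
      by (auto simp: k_def blinfun.bilinear_simps)
    have cunit: "cinner v v = 1" if "norm v = 1" for v :: "'b::complex_hilbert"
    proof -
      have "inner v (\<i> *\<^sub>C v) = Re (cnj \<i> * cinner v v)"
        by (simp add: inner_eq_Re_cinner cinner_scaleC_right)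
      moreover have "Im (cinner v v) = 0"
        using arg_cong[OF cinner_commute[of v v], of Im] by simp
      ultimately show ?thesis
        using that by (simp add: cinner_eq_Complex complex_eq_iff norm_eq_1)
    qed
    define V where "V = W + rank_one e k"
    define V' where "V' = W' + rank_one k e"
    have V: "V x = W x + cinner x e *\<^sub>C k" and V': "V' y = W' y + cinner y k *\<^sub>C e" for x y
      by (simp_all add: V_def V'_def blinfun.add_left rank_one_apply)
    have ortho: "cinner (W x) k = 0" "cinner (W' y) e = 0" for x y
    proof -
      show "cinner (W x) k = 0"
        unfolding cadj W'k by (simp add: cinner_eq_Complex complex_eq_iff)
      have "cinner e (W' y) = 0"
        using cadj[of e y] by (simp add: We cinner_eq_Complex complex_eq_iff)
      then show "cinner (W' y) e = 0"
        by (metis cinner_commute complex_cnj_zero)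
    qed
    have V'V: "V' (V x) = W' (W x) + cinner x e *\<^sub>C e" for x
      by (simp add: V V' blinfun.bilinear_simps lin W'k ortho cinner_add_left cinner_scaleC_left cunit k)
    have "V (V' (V x)) = V x" for x
      unfolding V'V by (simp add: V blinfun.bilinear_simps WWW lin We ortho
          cinner_add_left cinner_scaleC_left cunit e)
    moreover have fix_u: "V' (V u) = u"
    proof -
      have "cinner u r = cinner (W' (W u)) r + cinner r r"
        by (simp add: cinner_add_left[symmetric] r_def)
      also have "cinner (W' (W u)) r = of_real (norm r) * cinner (W' (W u)) e"
        using r by (simp add: e_def scaleC_of_real[symmetric] cinner_scaleC_right)
      finally have "cinner u r = cinner r r" by (simp add: ortho)
      also have "\<dots> = (of_real (norm r))\<^sup>2"
        using cunit[OF e] r by (simp add: e_def scaleC_of_real[symmetric] cinner_scaleC_right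
            cinner_scaleC_left field_simps power2_eq_square)
      finally have "cinner u e = of_real (norm r)"
        using r by (simp add: e_def scaleC_of_real[symmetric] cinner_scaleC_right power2_eq_square)
      then have "cinner u e *\<^sub>C e = r" using r by (simp add: scaleC_of_real e_def)
      then show ?thesis by (simp add: V'V r_def)
    qed
    moreover have "\<forall>x\<in>F. V' (V x) = x"
    proof
      fix x assume "x \<in> F"
      then show "V' (V x) = x"
        using bspec[OF fix_F] ortho(2)[of "W x"] by (simp add: V'V)
    qed
    moreover have "V (c *\<^sub>C x) = c *\<^sub>C V x" "V' (c *\<^sub>C y) = c *\<^sub>C V' y" for c x y
      by (simp_all add: V V' lin scaleC_add_right cinner_scaleC_left scaleC_scaleC)
    moreover have "inner (V x) y = inner x (V' y)" for x y
      by (simp add: V V' inner_add_left inner_add_right adj)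
        (simp add: inner_eq_Re_cinner cinner_scaleC_left cinner_scaleC_right cinner_commute[of y k] mult.commute)
    moreover have "range V \<subseteq> span (S \<union> {k, \<i> *\<^sub>C k})"
    proof
      fix y assume "y \<in> range V"
      then obtain x where "y = V x" by blast
      then have y: "y = W x + (Re (cinner x e) *\<^sub>R k + Im (cinner x e) *\<^sub>R (\<i> *\<^sub>C k))"
        unfolding V by (metis (no_types, lifting) complex_eq scaleC_add_left scaleC_of_real
            scaleC_scaleC mult.commute)
      have "W x \<in> span (S \<union> {k, \<i> *\<^sub>C k})"
        using S(2) span_mono[of S "S \<union> {k, \<i> *\<^sub>C k}"] by blast
      then show "y \<in> span (S \<union> {k, \<i> *\<^sub>C k})"
        unfolding y by (intro span_add span_scale) (auto intro: span_base)
    qed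
    ultimately have "partial_isometry_pair V V'" "\<forall>x\<in>insert u F. V' (V x) = x"
      "finite (S \<union> {k, \<i> *\<^sub>C k})" "range V \<subseteq> span (S \<union> {k, \<i> *\<^sub>C k})"
      using S(1) by (simp_all add: partial_isometry_pair_def)
    then show ?thesis by blast
  qed
qed

lemma op_poly_apply_sum: "op_poly p X x = (\<Sum>i\<le>degree p. coeff p i *\<^sub>R (blinfun_apply X ^^ i) x)"
proof -
  have "((((o\<^sub>L) X) ^^ i) id_blinfun) x = (blinfun_apply X ^^ i) x" for i
    by (induction i) auto
  then show ?thesis
    by (simp add: op_poly_def blinfun.sum_left blinfun.scaleR_left)
qed

lemma form_diff_le_norm:
  fixes A B :: "'h::complex_hilbert \<Rightarrow>\<^sub>L 'h"
  assumes "norm (A - B) \<le> e"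
  shows "\<bar>inner (A x) x - inner (B x) x\<bar> \<le> e * inner x x"
proof -
  have "inner ((A - B) x) x \<le> norm (A - B) * inner x x" "inner ((B - A) x) x \<le> norm (A - B) * inner x x"
    using form_le_norm[of "A - B" x] form_le_norm[of "B - A" x] by (simp_all add: norm_minus_commute)
  moreover have "norm (A - B) * inner x x \<le> e * inner x x"
    using assms by (intro mult_right_mono) auto
  ultimately show ?thesis
    by (simp add: blinfun.diff_left inner_diff_left abs_le_iff)
qed

text \<open>
  At a given
  vector \<open>v\<close> the quadratic forms of \<open>p(X)\<close>, \<open>p(Y)\<close> and \<open>p(lX + (1-l)Y)\<close>, for a polynomial \<open>p\<close> close to
  \<open>f\<close>, only involve the images of \<open>v\<close> under powers up to the degree of \<open>p\<close>. A partial isometry \<open>W\<close> moves these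
  finitely many vectors into the given space, and \<open>N \<mapsto> WNW' + a(1 - WW')\<close> is an affine map that keeps
  the form bounds and does not change the three values.
\<close>

lemma operator_convex_on_transport:
  fixes X Y :: "'l::complex_hilbert \<Rightarrow>\<^sub>L 'l"
  assumes inf: "\<not> (\<exists>S :: 'k::complex_hilbert set. finite S \<and> span S = UNIV)"
    and oc: "operator_convex_on TYPE('k) J f"
    and J: "{a..b} \<subseteq> J" and X: "form_bounds a b X" and Y: "form_bounds a b Y" and l: "l \<in> {0..1}"
  shows "inner (cfc f (l *\<^sub>R X + (1 - l) *\<^sub>R Y) v) v \<le> l * inner (cfc f X v) v + (1 - l) * inner (cfc f Y v) v"
proof (cases "v = 0")
  case False
  define n where "n = inner v v"
  have n: "0 < n" using False by (simp add: n_def)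
  have "a * n \<le> b * n"
    using form_boundsD(2,3)[OF X, of v] unfolding n_def by linarith
  with n have ab: "a \<le> b" by simp
  have f: "continuous_on {a..b} f"
    using oc J unfolding operator_convex_on_def by (blast intro: continuous_on_subset)
  define M where "M = l *\<^sub>R X + (1 - l) *\<^sub>R Y"
  have M: "form_bounds a b M"
  proof -
    have "a * inner x x \<le> inner (M x) x \<and> inner (M x) x \<le> b * inner x x" for x
    proof -
      have eq: "l * (c * inner x x) + (1 - l) * (c * inner x x) = c * inner x x" for c
        by (simp add: algebra_simps)
      have Mx: "inner (M x) x = l * inner (X x) x + (1 - l) * inner (Y x) x"
        by (simp add: M_def blinfun.bilinear_simps inner_simps)
      have "l * (a * inner x x) + (1 - l) * (a * inner x x) \<le> inner (M x) x"
        unfolding Mx using l form_boundsD(2)[OF X, of x] form_boundsD(2)[OF Y, of x]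
        by (intro add_mono mult_left_mono) auto
      moreover have "inner (M x) x \<le> l * (b * inner x x) + (1 - l) * (b * inner x x)"
        unfolding Mx using l form_boundsD(3)[OF X, of x] form_boundsD(3)[OF Y, of x]
        by (intro add_mono mult_left_mono) auto
      ultimately show ?thesis unfolding eq by simp
    qed
    then show ?thesis
      unfolding form_bounds_def M_def by (auto intro!: self_adjoint_op_intros form_boundsD(1)[OF X] form_boundsD(1)[OF Y])
  qed
  show ?thesis
  proof (rule field_le_epsilon)
    fix d :: real assume d: "0 < d"
    \<comment> \<open>passing from \<open>N\<close> to \<open>Z N\<close> changes a form by at most \<open>2 e \<parallel>v\<parallel>\<^sup>2\<close>, on either side of the inequality\<close>
    define e where "e = d / (4 * n)"
    have e: "0 < e" "4 * (e * n) = d" using d n by (auto simp: e_def)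
    obtain ps :: "nat \<Rightarrow> real poly" where ps: "uniform_limit {a..b} (\<lambda>n. poly (ps n)) f sequentially"
      using polynomial_uniform_approx[OF f] .
    obtain p :: "real poly" where p: "\<And>r. r \<in> {a..b} \<Longrightarrow> \<bar>poly p r - f r\<bar> \<le> e"
      using uniform_limitD[OF ps e(1)]
      by (force simp: eventually_sequentially dist_real_def intro: less_imp_le)
    define F where "F = (\<Union>N\<in>{X, Y, M}. (\<lambda>j. (blinfun_apply N ^^ j) v) ` {..degree p})"
    have "finite F" by (simp add: F_def)
    from finite_partial_isometry[OF inf this]
    obtain W :: "'l \<Rightarrow>\<^sub>L 'k" and W' where WW': "partial_isometry_pair W W'"
      and fix_F: "\<forall>u\<in>F. W' (W u) = u"
      by blast
    note lin = partial_isometry_pairD(1,2)[OF WW'] and adj = partial_isometry_pairD(3)[OF WW']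
      and WWW = partial_isometry_pairD(4)[OF WW'] and W'WW' = partial_isometry_pairD(5)[OF WW']
    have adj': "inner (W' y) x = inner y (W x)" for x y
      by (metis adj inner_commute)
    have fix_F': "W' (W ((blinfun_apply N ^^ j) v)) = (blinfun_apply N ^^ j) v"
      if "N \<in> {X, Y, M}" "j \<le> degree p" for N j
      by (rule bspec[OF fix_F]) (use that in \<open>unfold F_def, blast\<close>)
    have fix_v: "W' (W v) = v" using fix_F'[of X 0] by simp
    have WW'_le: "inner (W' y) (W' y) \<le> inner y y" for y
    proof -
      have "0 \<le> inner (y - W (W' y)) (y - W (W' y))" by simp
      also have "\<dots> = inner y y - inner (W' y) (W' y)"
        by (simp add: inner_diff_left inner_diff_right adj W'WW' inner_commute[of y "W (W' y)"])
      finally show ?thesis by simp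
    qed
    define Z where "Z N = (W o\<^sub>L N o\<^sub>L W') + a *\<^sub>R (id_blinfun - (W o\<^sub>L W'))" for N
    have Z_apply: "Z N y = W (N (W' y)) + a *\<^sub>R (y - W (W' y))" for N y
      by (simp add: Z_def blinfun.bilinear_simps)
    have Z: "form_bounds a b (Z N)" if N: "form_bounds a b N" for N
      unfolding form_bounds_def self_adjoint_op_iff
    proof (intro conjI allI)
      show "clinear_op (Z N)"
        using form_boundsD(1)[OF N]
        by (auto simp: clinear_op_def Z_apply lin scaleC_add_right scaleC_diff_right
            scaleC_scaleR_commute self_adjoint_opD(1)[THEN clinear_opD])
      show "inner (Z N y) z = inner y (Z N z)" for y z
        using self_adjoint_opD(2)[OF form_boundsD(1)[OF N], of "W' y" "W' z"]
        by (simp add: Z_apply inner_simps adj adj'[symmetric])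
      have form: "inner (Z N y) y = inner (N (W' y)) (W' y) + a * (inner y y - inner (W' y) (W' y))" for y
        by (simp add: Z_apply inner_simps adj)
      show "a * inner y y \<le> inner (Z N y) y" for y
        using form_boundsD(2)[OF N, of "W' y"] by (simp add: form algebra_simps)
      show "inner (Z N y) y \<le> b * inner y y" for y
      proof -
        have "a * (inner y y - inner (W' y) (W' y)) \<le> b * (inner y y - inner (W' y) (W' y))"
          using ab WW'_le[of y] by (intro mult_right_mono) auto
        then show ?thesis
          using form_boundsD(3)[OF N, of "W' y"] unfolding form by (simp add: algebra_simps)
      qed
    qed
    have Z_M: "Z M = l *\<^sub>R Z X + (1 - l) *\<^sub>R Z Y"
      by (rule blinfun_eqI) (simp add: Z_apply M_def blinfun.bilinear_simps algebra_simps)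
    have poly_Z: "inner (op_poly p (Z N) (W v)) (W v) = inner (op_poly p N v) v" if N: "N \<in> {X, Y, M}" for N
    proof -
      have "(blinfun_apply (Z N) ^^ j) (W v) = W ((blinfun_apply N ^^ j) v)" if "j \<le> degree p" for j
        using that by (induction j) (auto simp: Z_apply WWW fix_F'[OF N])
      then have "op_poly p (Z N) (W v) = W (op_poly p N v)"
        by (simp add: op_poly_apply_sum blinfun.sum_right blinfun.scaleR_right)
      then show ?thesis by (simp add: adj fix_v)
    qed
    have near: "\<bar>inner (cfc f (Z N) (W v)) (W v) - inner (cfc f N v) v\<bar> \<le> 2 * (e * n)"
      if "N \<in> {X, Y, M}" "form_bounds a b N" for N
    proof -
      have "\<bar>inner (op_poly p N v) v - inner (cfc f N v) v\<bar> \<le> e * n"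
        unfolding n_def using e by (intro form_diff_le_norm cfc_poly_approx[OF that(2) f p]) auto
      moreover have "\<bar>inner (op_poly p (Z N) (W v)) (W v) - inner (cfc f (Z N) (W v)) (W v)\<bar> \<le> e * inner (W v) (W v)"
        using e by (intro form_diff_le_norm cfc_poly_approx[OF Z[OF that(2)] f p]) auto
      moreover have "inner (W v) (W v) = n" by (simp add: n_def adj fix_v)
      ultimately show ?thesis using poly_Z[OF that(1)] by (simp add: abs_le_iff)
    qed
    have spec: "self_adjoint_op (Z N)" "op_spectrum (Z N) \<subseteq> complex_of_real ` J" if "form_bounds a b N" for N
      using form_boundsD(1)[OF Z[OF that]] real_spectrum_form_bounds[OF Z[OF that]] J
      by (auto simp: op_spectrum_subset_iff)
    have "cfc f (Z M) \<preceq> l *\<^sub>R cfc f (Z X) + (1 - l) *\<^sub>R cfc f (Z Y)"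
      unfolding Z_M using oc l spec[OF X] spec[OF Y] unfolding operator_convex_on_def by blast
    from op_leD[OF this, of "W v"]
    have "inner (cfc f (Z M) (W v)) (W v) \<le>
        l * inner (cfc f (Z X) (W v)) (W v) + (1 - l) * inner (cfc f (Z Y) (W v)) (W v)"
      by (simp add: blinfun.bilinear_simps inner_simps)
    also have "\<dots> \<le> l * (inner (cfc f X v) v + 2 * (e * n)) + (1 - l) * (inner (cfc f Y v) v + 2 * (e * n))"
      using l near[OF _ X] near[OF _ Y] by (intro add_mono mult_left_mono) (auto simp: abs_le_iff)
    also have "\<dots> = l * inner (cfc f X v) v + (1 - l) * inner (cfc f Y v) v + 2 * (e * n)"
      by (simp add: algebra_simps)
    finally show "inner (cfc f (l *\<^sub>R X + (1 - l) *\<^sub>R Y) v) v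
        \<le> l * inner (cfc f X v) v + (1 - l) * inner (cfc f Y v) v + d"
      using near[OF _ M] e unfolding M_def by (auto simp: abs_le_iff)
  qed
qed simp

section \<open>Jensen's inequality for an isometry\<close>

lemma form_bounds_compression:
  fixes V :: "'h::complex_hilbert \<Rightarrow>\<^sub>L 'l::complex_hilbert" and V' :: "'l \<Rightarrow>\<^sub>L 'h"
  assumes lin: "\<And>c x. V (c *\<^sub>C x) = c *\<^sub>C V x" "\<And>c y. V' (c *\<^sub>C y) = c *\<^sub>C V' y"
    and adj: "\<And>x y. inner (V x) y = inner x (V' y)" and iso: "\<And>x. V' (V x) = x"
    and X: "form_bounds a b X"
  shows "form_bounds a b (V' o\<^sub>L X o\<^sub>L V)"
  unfolding form_bounds_def self_adjoint_op_iff
proof (intro conjI allI)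
  have adj': "inner (V' y) x = inner y (V x)" for x y
    by (metis adj inner_commute)
  show "clinear_op (V' o\<^sub>L X o\<^sub>L V)"
    using self_adjoint_opD(1)[OF form_boundsD(1)[OF X]] by (auto simp: clinear_op_def lin)
  show "inner ((V' o\<^sub>L X o\<^sub>L V) x) y = inner x ((V' o\<^sub>L X o\<^sub>L V) y)" for x y
    using self_adjoint_opD(2)[OF form_boundsD(1)[OF X], of "V x" "V y"] by (simp add: adj adj')
  show "a * inner x x \<le> inner ((V' o\<^sub>L X o\<^sub>L V) x) x" "inner ((V' o\<^sub>L X o\<^sub>L V) x) x \<le> b * inner x x" for x
    using form_boundsD(2,3)[OF X, of "V x"] by (simp_all add: adj adj' iso)
qed

text \<open>
  The pinching argument of Hansen and Pedersen: the reflection \<open>S = 2VV' - 1\<close> fixes the range of \<open>V\<close>,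
  and \<open>Z = (X + SXS)/2\<close> satisfies \<open>ZV = V(V'XV)\<close>, so that \<open>f(Z)V = V f(V'XV)\<close>. Convexity bounds
  \<open>f(Z)\<close> by \<open>(f(X) + S f(X) S)/2\<close>, whose quadratic form on the range of \<open>V\<close> is that of \<open>f(X)\<close>.
\<close>

lemma cfc_isometry_jensen:
  fixes V :: "'h::complex_hilbert \<Rightarrow>\<^sub>L 'l::complex_hilbert" and V' :: "'l \<Rightarrow>\<^sub>L 'h"
  assumes inf: "\<not> (\<exists>S :: 'k::complex_hilbert set. finite S \<and> span S = UNIV)"
    and oc: "operator_convex_on TYPE('k) J f" and J: "{a..b} \<subseteq> J"
    and lin: "\<And>c x. V (c *\<^sub>C x) = c *\<^sub>C V x" "\<And>c y. V' (c *\<^sub>C y) = c *\<^sub>C V' y"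
    and adj: "\<And>x y. inner (V x) y = inner x (V' y)" and iso: "\<And>x. V' (V x) = x"
    and X: "form_bounds a b X"
  shows "inner (cfc f (V' o\<^sub>L X o\<^sub>L V) x) x \<le> inner (cfc f X (V x)) (V x)"
proof -
  have f: "continuous_on {a..b} f"
    using oc J unfolding operator_convex_on_def by (blast intro: continuous_on_subset)
  have adj': "inner (V' y) x = inner y (V x)" for x y
    by (metis adj inner_commute)
  define S where "S = 2 *\<^sub>R (V o\<^sub>L V') - id_blinfun"
  have S_apply: "S y = 2 *\<^sub>R V (V' y) - y" for y
    by (simp add: S_def blinfun.bilinear_simps)
  have S_S: "S (S y) = y" for y
    by (simp add: S_apply blinfun.bilinear_simps iso scaleR_2)
  have S_V: "S (V x) = V x" for x
    by (simp add: S_apply iso scaleR_2)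
  have S: "self_adjoint_op S"
    by (auto simp: self_adjoint_op_iff clinear_op_def S_apply lin scaleC_diff_right
        scaleC_scaleR_commute inner_simps adj adj'[symmetric])
  define T where "T = S o\<^sub>L X o\<^sub>L S"
  have T: "form_bounds a b T"
    unfolding form_bounds_def
  proof (intro conjI allI)
    show "self_adjoint_op T"
      unfolding T_def by (intro self_adjoint_op_intros S form_boundsD(1)[OF X])
    fix y
    have "inner (T y) y = inner (X (S y)) (S y)" "inner (S y) (S y) = inner y y"
      using self_adjoint_opD(2)[OF S] by (simp_all add: T_def S_S)
    with form_boundsD(2,3)[OF X, of "S y"]
    show "a * inner y y \<le> inner (T y) y" "inner (T y) y \<le> b * inner y y" by simp_all
  qed
  have fT: "cfc f T y = S (cfc f X (S y))" for y
    using cfc_intertwine[OF X T f, of S "S y"] by (simp add: T_def S_S)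
  define Z where "Z = (1/2) *\<^sub>R X + (1 - 1/2) *\<^sub>R T"
  have Z: "form_bounds a b Z"
    unfolding form_bounds_def
  proof (intro conjI allI)
    show "self_adjoint_op Z"
      unfolding Z_def by (intro self_adjoint_op_intros form_boundsD(1)[OF X] form_boundsD(1)[OF T])
    show "a * inner y y \<le> inner (Z y) y" "inner (Z y) y \<le> b * inner y y" for y
      using form_boundsD(2,3)[OF X, of y] form_boundsD(2,3)[OF T, of y]
      by (simp_all add: Z_def blinfun.bilinear_simps inner_simps)
  qed
  have ZV: "Z (V x) = V ((V' o\<^sub>L X o\<^sub>L V) x)" for x
    by (simp add: Z_def T_def blinfun.bilinear_simps S_V S_apply[of "X (V x)"] scaleR_diff_right)
  have "inner (cfc f (V' o\<^sub>L X o\<^sub>L V) x) x = inner (cfc f Z (V x)) (V x)"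
    using cfc_intertwine[OF form_bounds_compression[OF lin adj iso X] Z f ZV, of x]
    by (simp add: adj iso)
  also have "\<dots> \<le> 1/2 * inner (cfc f X (V x)) (V x) + (1 - 1/2) * inner (cfc f T (V x)) (V x)"
    unfolding Z_def by (rule operator_convex_on_transport[OF inf oc J X T]) auto
  also have "inner (cfc f T (V x)) (V x) = inner (cfc f X (V x)) (V x)"
    using self_adjoint_opD(2)[OF S, of "cfc f X (V x)" "V x"] by (simp add: fT S_V)
  finally show ?thesis by simp
qed

section \<open>Direct sums\<close>

instantiation prod :: (complex_hilbert, complex_hilbert) complex_hilbert
begin

definition scaleC_prod_def: "c *\<^sub>C x = (c *\<^sub>C fst x, c *\<^sub>C snd x)"

definition cinner_prod_def: "cinner x y = cinner (fst x) (fst y) + cinner (snd x) (snd y)"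

instance
proof
  fix c d :: complex and x y z :: "'a \<times> 'b" and r :: real
  show "c *\<^sub>C (x + y) = c *\<^sub>C x + c *\<^sub>C y" "(c + d) *\<^sub>C x = c *\<^sub>C x + d *\<^sub>C x"
    "c *\<^sub>C d *\<^sub>C x = (c * d) *\<^sub>C x" "complex_of_real r *\<^sub>C x = r *\<^sub>R x"
    by (simp_all add: scaleC_prod_def scaleC_add_right scaleC_add_left scaleC_scaleC scaleC_of_real
        scaleR_prod_def)
  show "cinner x y = cnj (cinner y x)"
    by (simp add: cinner_prod_def cinner_commute[symmetric])
  show "cinner (x + y) z = cinner x z + cinner y z" "cinner (c *\<^sub>C x) y = c * cinner x y"
    "inner x y = Re (cinner x y)"
    by (simp_all add: cinner_prod_def scaleC_prod_def cinner_add_left cinner_scaleC_left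
        inner_prod_def inner_eq_Re_cinner algebra_simps)
qed

end

section \<open>The perspective\<close>

lemma strictly_positive_opI:
  assumes "form_bounds c C R" "0 < c"
  shows "strictly_positive_op R"
proof -
  have "0 \<le> inner (R x) x" for x
    using form_boundsD(2)[OF assms(1), of x] assms(2) by (meson inner_ge_zero less_imp_le mult_nonneg_nonneg order_trans)
  then show ?thesis
    using form_boundsD[OF assms(1)] assms(2)
    by (auto simp: strictly_positive_op_def positive_op_iff intro!: invertible_op_of_form_ge)
qed

lemma strictly_positive_op_form_bounds:
  fixes R :: "'h::complex_hilbert \<Rightarrow>\<^sub>L 'h"
  assumes "strictly_positive_op R"
  obtains c where "0 < c" "form_bounds c (norm R) R"
proof -
  have R: "self_adjoint_op R" "\<And>x. 0 \<le> inner (R x) x" "invertible_op R"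
    using assms by (auto simp: strictly_positive_op_def positive_op_iff)
  have R0: "form_bounds 0 (norm R) R"
    using R form_boundsD(3)[OF form_bounds_norm[OF R(1)]] by (auto simp: form_bounds_def)
  show thesis
  proof (cases "\<exists>x::'h. x \<noteq> 0")
    case True
    then obtain a b where ab: "a \<in> real_spectrum R" "form_bounds a b R"
      using form_bounds_in_spectrum[OF R(1)] by metis
    have "0 \<le> a" using real_spectrum_form_bounds[OF R0] ab(1) by auto
    moreover have "a \<noteq> 0" using ab(1) R(3) by (auto simp: real_spectrum_iff)
    ultimately have "0 < a" by simp
    moreover have "form_bounds a (norm R) R"
      using ab(2) R0 by (simp add: form_bounds_def)
    ultimately show thesis using that by blast
  next
    case False
    then show thesis using that[of 1] form_bounds_trivial by fastforce
  qed
qed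

lemma continuous_on_powr_pos:
  assumes "0 < (c::real)"
  shows "continuous_on {c..C} (\<lambda>r. r powr s)"
  using assms by (intro continuous_intros) auto

lemma self_adjoint_op_powr:
  assumes "strictly_positive_op R"
  shows "self_adjoint_op (op_powr R s)"
proof -
  obtain c where "0 < c" "form_bounds c (norm R) R"
    using strictly_positive_op_form_bounds[OF assms] .
  then show ?thesis unfolding op_powr_def
    by (intro self_adjoint_cfc continuous_on_powr_pos)
qed

lemma op_powr_half:
  assumes "strictly_positive_op R"
  shows "op_powr R (1/2) (op_powr R (1/2) x) = R x"
    "op_powr R (1/2) (op_powr R (- (1/2)) x) = x"
    "op_powr R (- (1/2)) (op_powr R (1/2) x) = x"
proof -
  obtain c where c: "0 < c" and R: "form_bounds c (norm R) R"
    using strictly_positive_op_form_bounds[OF assms] .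
  note mult = cfc_mult[OF R continuous_on_powr_pos[OF c] continuous_on_powr_pos[OF c], folded op_powr_def]
  have "cfc (\<lambda>r. r powr (1/2) * r powr (1/2)) R = op_poly [:0, 1:] R"
    using c by (intro cfc_eq_op_poly[OF R]) (auto simp: powr_add[symmetric])
  then have "op_powr R (1/2) o\<^sub>L op_powr R (1/2) = R"
    by (simp add: mult op_poly_X)
  then show "op_powr R (1/2) (op_powr R (1/2) x) = R x"
    by (metis blinfun_apply_blinfun_compose)
  have "cfc (\<lambda>r. r powr (1/2) * r powr (- (1/2))) R = op_poly [:1:] R"
    using c by (intro cfc_eq_op_poly[OF R]) (auto simp: powr_add[symmetric])
  then have "op_powr R (1/2) o\<^sub>L op_powr R (- (1/2)) = id_blinfun"
    by (simp add: mult op_poly_const)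
  then show "op_powr R (1/2) (op_powr R (- (1/2)) x) = x"
    by (metis blinfun_apply_blinfun_compose blinfun_apply_id_blinfun)
  have "cfc (\<lambda>r. r powr (- (1/2)) * r powr (1/2)) R = op_poly [:1:] R"
    using c by (intro cfc_eq_op_poly[OF R]) (auto simp: powr_add[symmetric])
  then have "op_powr R (- (1/2)) o\<^sub>L op_powr R (1/2) = id_blinfun"
    by (simp add: mult op_poly_const)
  then show "op_powr R (- (1/2)) (op_powr R (1/2) x) = x"
    by (metis blinfun_apply_blinfun_compose blinfun_apply_id_blinfun)
qed

text \<open>
  These are the form bounds of \<open>R\<^sup>-\<^sup>\<onehalf>LR\<^sup>-\<^sup>\<onehalf>\<close>, stated so that they are linear in the pair \<open>(L, R)\<close>.
\<close>

definition rel_bounds :: "real \<Rightarrow> real \<Rightarrow> ('h::complex_hilbert \<Rightarrow>\<^sub>L 'h) \<Rightarrow> ('h \<Rightarrow>\<^sub>L 'h) \<Rightarrow> bool" where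
  "rel_bounds a b L R \<longleftrightarrow> self_adjoint_op L \<and>
     (\<forall>x. a * inner (R x) x \<le> inner (L x) x \<and> inner (L x) x \<le> b * inner (R x) x)"

lemma rel_boundsD:
  assumes "rel_bounds a b L R"
  shows "self_adjoint_op L" "a * inner (R x) x \<le> inner (L x) x" "inner (L x) x \<le> b * inner (R x) x"
  using assms by (auto simp: rel_bounds_def)

lemma rel_bounds_mono:
  assumes "rel_bounds a b L R" "a' \<le> a" "b \<le> b'" "strictly_positive_op R"
  shows "rel_bounds a' b' L R"
proof -
  have "0 \<le> inner (R x) x" for x
    using assms(4) by (auto simp: strictly_positive_op_def positive_op_iff)
  then have "a' * inner (R x) x \<le> a * inner (R x) x" "b * inner (R x) x \<le> b' * inner (R x) x" for x
    using assms by (auto intro: mult_right_mono)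
  then show ?thesis
    using assms(1) unfolding rel_bounds_def by (meson order_trans)
qed

lemma rel_op_apply: "rel_op L R x = op_powr R (- (1/2)) (L (op_powr R (- (1/2)) x))"
  by (simp add: rel_op_def)

lemma self_adjoint_rel_op:
  assumes "strictly_positive_op R" "self_adjoint_op L"
  shows "self_adjoint_op (rel_op L R)"
  unfolding rel_op_def using assms by (intro self_adjoint_op_intros self_adjoint_op_powr)

lemma form_bounds_rel_op_iff:
  assumes R: "strictly_positive_op R" and L: "self_adjoint_op L"
  shows "form_bounds a b (rel_op L R) \<longleftrightarrow> rel_bounds a b L R"
proof -
  define H where "H = op_powr R (1/2)"
  define K where "K = op_powr R (- (1/2))"
  note half = op_powr_half[OF R, folded H_def K_def]
  have adj: "inner (H x) y = inner x (H y)" "inner (K x) y = inner x (K y)" for x y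
    unfolding H_def K_def by (rule self_adjoint_opD(2)[OF self_adjoint_op_powr[OF R]])+
  have K_eq: "inner (rel_op L R y) y = inner (L (K y)) (K y)" "inner y y = inner (R (K y)) (K y)" for y
    by (simp_all add: rel_op_apply K_def[symmetric] adj half(1)[symmetric] half(2))
  have H_eq: "inner (L x) x = inner (rel_op L R (H x)) (H x)" "inner (R x) x = inner (H x) (H x)" for x
    unfolding K_eq half by (simp_all add: adj half(1)[symmetric])
  show ?thesis
    using L self_adjoint_rel_op[OF R L] unfolding form_bounds_def rel_bounds_def
    by (metis H_eq K_eq)
qed

lemma perspective_form:
  assumes "strictly_positive_op R"
  shows "inner (perspective f L R x) x =
    inner (cfc f (rel_op L R) (op_powr R (1/2) x)) (op_powr R (1/2) x)"
  using self_adjoint_opD(2)[OF self_adjoint_op_powr[OF assms]] by (simp add: perspective_def)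

lemma self_adjoint_perspective:
  assumes "strictly_positive_op R" "rel_bounds a b L R" "continuous_on {a..b} f"
  shows "self_adjoint_op (perspective f L R)"
proof -
  have "form_bounds a b (rel_op L R)"
    using assms rel_boundsD(1) form_bounds_rel_op_iff by blast
  from self_adjoint_cfc[OF this assms(3)] self_adjoint_op_powr[OF assms(1)]
  show ?thesis unfolding perspective_def by (intro self_adjoint_op_intros)
qed

lemma perspective_0_0: "perspective f 0 0 = (0 :: 'h::complex_hilbert \<Rightarrow>\<^sub>L 'h)"
proof -
  have "form_bounds 0 0 (0 :: 'h \<Rightarrow>\<^sub>L 'h)"
    using form_bounds_id[of 0] by simp
  then have "op_powr 0 (1/2) = op_poly 0 (0 :: 'h \<Rightarrow>\<^sub>L 'h)"
    unfolding op_powr_def by (rule cfc_eq_op_poly) auto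
  then show ?thesis
    by (simp add: perspective_def)
qed

lemma strictly_positive_op_add:
  assumes "strictly_positive_op R1" "strictly_positive_op R2"
  shows "strictly_positive_op (R1 + R2)"
proof -
  obtain c1 c2 where c: "0 < c1" "form_bounds c1 (norm R1) R1" "0 < c2" "form_bounds c2 (norm R2) R2"
    using assms strictly_positive_op_form_bounds by metis
  have "form_bounds (c1 + c2) (norm R1 + norm R2) (R1 + R2)"
    using c unfolding form_bounds_def
    by (auto intro!: self_adjoint_op_intros simp: blinfun.add_left inner_add_left distrib_right add_mono)
  then show ?thesis by (rule strictly_positive_opI) (use c in simp)
qed

lemma rel_bounds_add:
  assumes "rel_bounds a b L1 R1" "rel_bounds a b L2 R2"
  shows "rel_bounds a b (L1 + L2) (R1 + R2)"
  using assms unfolding rel_bounds_def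
  by (auto intro!: self_adjoint_op_intros simp: blinfun.add_left inner_add_left distrib_left add_mono)

text \<open>
  This is Jensen's inequality for the isometry \<open>V x = (R\<^sub>1\<^sup>\<onehalf>R\<^sup>-\<^sup>\<onehalf>x, R\<^sub>2\<^sup>\<onehalf>R\<^sup>-\<^sup>\<onehalf>x)\<close>, where \<open>R = R\<^sub>1 + R\<^sub>2\<close>, and
  the direct sum of the operators \<open>R\<^sub>i\<^sup>-\<^sup>\<onehalf>L\<^sub>iR\<^sub>i\<^sup>-\<^sup>\<onehalf>\<close>, whose compression by \<open>V\<close> is \<open>R\<^sup>-\<^sup>\<onehalf>(L\<^sub>1 + L\<^sub>2)R\<^sup>-\<^sup>\<onehalf>\<close>.
\<close>

lemma perspective_subadditive:
  fixes L1 L2 R1 R2 :: "'h::complex_hilbert \<Rightarrow>\<^sub>L 'h"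
  assumes inf: "\<not> (\<exists>S :: 'k::complex_hilbert set. finite S \<and> span S = UNIV)"
    and oc: "operator_convex_on TYPE('k) J f" and J: "{a..b} \<subseteq> J"
    and R1: "strictly_positive_op R1" and R2: "strictly_positive_op R2"
    and L1: "rel_bounds a b L1 R1" and L2: "rel_bounds a b L2 R2"
  shows "perspective f (L1 + L2) (R1 + R2) \<preceq> perspective f L1 R1 + perspective f L2 R2"
proof -
  have f: "continuous_on {a..b} f"
    using oc J unfolding operator_convex_on_def by (blast intro: continuous_on_subset)
  define R where "R = R1 + R2"
  have R: "strictly_positive_op R"
    unfolding R_def by (rule strictly_positive_op_add[OF R1 R2])
  define H1 H2 H where "H1 = op_powr R1 (1/2)" and "H2 = op_powr R2 (1/2)" and "H = op_powr R (1/2)"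
  define K1 K2 K where "K1 = op_powr R1 (- (1/2))" and "K2 = op_powr R2 (- (1/2))" and "K = op_powr R (- (1/2))"
  note half1 = op_powr_half[OF R1, folded H1_def K1_def]
    and half2 = op_powr_half[OF R2, folded H2_def K2_def]
    and half = op_powr_half[OF R, folded H_def K_def]
  have sa: "self_adjoint_op H1" "self_adjoint_op H2" "self_adjoint_op K"
    unfolding H1_def H2_def K_def by (rule self_adjoint_op_powr R R1 R2)+
  define X1 X2 where "X1 = rel_op L1 R1" and "X2 = rel_op L2 R2"
  have X1: "form_bounds a b X1" and X2: "form_bounds a b X2"
    unfolding X1_def X2_def using R1 R2 L1 L2 rel_boundsD(1) form_bounds_rel_op_iff by blast+
  define V :: "'h \<Rightarrow>\<^sub>L ('h \<times> 'h)" where "V = Blinfun (\<lambda>x. (H1 (K x), H2 (K x)))"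
  define V' :: "('h \<times> 'h) \<Rightarrow>\<^sub>L 'h" where "V' = Blinfun (\<lambda>y. K (H1 (fst y)) + K (H2 (snd y)))"
  define X :: "('h \<times> 'h) \<Rightarrow>\<^sub>L ('h \<times> 'h)" where "X = Blinfun (\<lambda>y. (X1 (fst y), X2 (snd y)))"
  define I1 I2 :: "'h \<Rightarrow>\<^sub>L ('h \<times> 'h)" where "I1 = Blinfun (\<lambda>x. (x, 0))" and "I2 = Blinfun (\<lambda>x. (0, x))"
  have V: "V x = (H1 (K x), H2 (K x))" for x
    unfolding V_def by (subst bounded_linear_Blinfun_apply)
      (auto intro!: bounded_linear_Pair blinfun.bounded_linear_right bounded_linear_compose[OF blinfun.bounded_linear_right])
  have V': "V' y = K (H1 (fst y)) + K (H2 (snd y))" for y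
    unfolding V'_def by (subst bounded_linear_Blinfun_apply)
      (auto intro!: bounded_linear_add bounded_linear_compose[OF blinfun.bounded_linear_right] bounded_linear_fst bounded_linear_snd)
  have X: "X y = (X1 (fst y), X2 (snd y))" for y
    unfolding X_def by (subst bounded_linear_Blinfun_apply)
      (auto intro!: bounded_linear_Pair bounded_linear_compose[OF blinfun.bounded_linear_right] bounded_linear_fst bounded_linear_snd)
  have I1: "I1 x = (x, 0)" and I2: "I2 x = (0, x)" for x
    unfolding I1_def I2_def by (auto simp: bounded_linear_Blinfun_apply bounded_linear_Pair bounded_linear_ident)
  have clin: "T (c *\<^sub>C x) = c *\<^sub>C T x" if "self_adjoint_op T" for T c and x :: 'h
    using that self_adjoint_opD(1) clinear_opD by blast
  have Xb: "form_bounds a b X"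
    using form_boundsD[OF X1] form_boundsD[OF X2] unfolding form_bounds_def self_adjoint_op_iff
    by (auto simp: clinear_op_def X inner_prod_def scaleC_prod_def self_adjoint_op_iff distrib_left add_mono)
  have lin: "V (c *\<^sub>C x) = c *\<^sub>C V x" "V' (c *\<^sub>C y) = c *\<^sub>C V' y" for c x y
    by (simp_all add: V V' scaleC_prod_def clin sa scaleC_add_right)
  have adj: "inner (V x) y = inner x (V' y)" for x y
    by (simp add: V V' inner_prod_def inner_add_right sa[THEN self_adjoint_opD(2)])
  have iso: "V' (V x) = x" for x
  proof -
    have "V' (V x) = K (R (K x))"
      by (simp add: V V' half1 half2 R_def blinfun.bilinear_simps)
    then show ?thesis by (simp add: half(1)[symmetric] half)
  qed
  have comp: "V' o\<^sub>L X o\<^sub>L V = rel_op (L1 + L2) R"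
    by (rule blinfun_eqI)
      (simp add: V V' X X1_def X2_def rel_op_apply K1_def[symmetric] K2_def[symmetric] K_def[symmetric]
        half1 half2 blinfun.bilinear_simps)
  have fX: "cfc f X (u, w) = (cfc f X1 u, cfc f X2 w)" for u w
  proof -
    have "cfc f X (I1 u) = I1 (cfc f X1 u)" "cfc f X (I2 w) = I2 (cfc f X2 w)"
      by (rule cfc_intertwine[OF X1 Xb f] cfc_intertwine[OF X2 Xb f], simp add: X I1 I2)+
    moreover have "(u, w) = I1 u + I2 w" by (simp add: I1 I2)
    ultimately have "cfc f X (u, w) = I1 (cfc f X1 u) + I2 (cfc f X2 w)"
      by (metis blinfun.add_right)
    then show ?thesis by (simp add: I1 I2)
  qed
  have "inner (perspective f (L1 + L2) R x) x \<le> inner ((perspective f L1 R1 + perspective f L2 R2) x) x" for x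
  proof -
    have "inner (perspective f (L1 + L2) R x) x = inner (cfc f (V' o\<^sub>L X o\<^sub>L V) (H x)) (H x)"
      by (simp add: perspective_form[OF R] comp H_def)
    also have "\<dots> \<le> inner (cfc f X (V (H x))) (V (H x))"
      by (rule cfc_isometry_jensen[OF inf oc J lin adj iso Xb])
    also have "V (H x) = (H1 x, H2 x)"
      by (simp add: V half)
    also have "inner (cfc f X (H1 x, H2 x)) (H1 x, H2 x) =
        inner ((perspective f L1 R1 + perspective f L2 R2) x) x"
      by (simp add: fX inner_prod_def perspective_form R1 R2 blinfun.add_left inner_add_left X1_def X2_def H1_def H2_def)
    finally show ?thesis .
  qed
  then show ?thesis
    unfolding R_def[symmetric]
    by (intro op_leI self_adjoint_op_intros self_adjoint_perspective[OF _ _ f] R R1 R2 L1 L2)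
      (auto simp: R_def intro: rel_bounds_add L1 L2)
qed

lemma op_poly_pcompose_scale: "op_poly (pcompose p [:0, c:]) R = op_poly p (c *\<^sub>R R)"
proof (rule blinfun_eqI)
  show "op_poly (pcompose p [:0, c:]) R x = op_poly p (c *\<^sub>R R) x" for x
    by (induction p)
      (auto simp: pcompose_pCons op_poly_add op_poly_mult op_poly_const op_poly_smult op_poly_pCons blinfun.bilinear_simps)
qed

lemma strictly_positive_op_scaleR:
  assumes "strictly_positive_op R" "0 < c"
  shows "strictly_positive_op (c *\<^sub>R R)"
  using assms by (auto simp: strictly_positive_op_def positive_op_iff blinfun.scaleR_left
      intro!: self_adjoint_op_intros invertible_op_scaleR)

text \<open>
  If \<open>p\<close> is near the power function on the spectrum of \<open>cR\<close>, then \<open>c\<^sup>-\<^sup>sp(c\<cdot>)\<close> is near it on that of \<open>R\<close>.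
\<close>

lemma op_powr_scaleR:
  assumes R: "strictly_positive_op R" and c: "0 < c"
  shows "op_powr (c *\<^sub>R R) s = c powr s *\<^sub>R op_powr R s"
proof -
  obtain d where d: "0 < d" and Rb: "form_bounds d (norm R) R"
    using strictly_positive_op_form_bounds[OF R] .
  have cR: "form_bounds (c * d) (c * norm R) (c *\<^sub>R R)"
    using form_boundsD[OF Rb] c unfolding form_bounds_def
    by (auto simp: blinfun.scaleR_left mult.assoc intro!: self_adjoint_op_intros)
  obtain p where p: "uniform_limit {c * d..c * norm R} (\<lambda>n. poly (p n)) (\<lambda>r. r powr s) sequentially"
    using polynomial_uniform_approx[OF continuous_on_powr_pos] c d by (metis mult_pos_pos)
  have "uniform_limit {d..norm R} (\<lambda>n r. poly (p n) (c * r)) (\<lambda>r. (c * r) powr s) sequentially"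
    using c by (intro uniform_limit_compose'[OF p]) auto
  then have "uniform_limit {d..norm R} (\<lambda>n r. c powr (-s) * poly (p n) (c * r))
      (\<lambda>r. c powr (-s) * (c * r) powr s) sequentially"
    by (intro uniform_limit_intros)
  then have "uniform_limit {d..norm R} (\<lambda>n. poly (smult (c powr (-s)) (pcompose (p n) [:0, c:])))
      (\<lambda>r. r powr s) sequentially"
    by (rule uniform_limit_cong'[THEN iffD1, rotated -1])
      (use c d in \<open>auto simp: poly_pcompose mult.commute powr_mult powr_minus\<close>)
  from tendsto_op_poly_cfc[OF Rb this]
  have "(\<lambda>n. c powr (-s) *\<^sub>R op_poly (p n) (c *\<^sub>R R)) \<longlonglongrightarrow> op_powr R s"
    by (simp add: op_poly_smult op_poly_pcompose_scale op_powr_def)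
  moreover have "(\<lambda>n. c powr (-s) *\<^sub>R op_poly (p n) (c *\<^sub>R R)) \<longlonglongrightarrow> c powr (-s) *\<^sub>R op_powr (c *\<^sub>R R) s"
    unfolding op_powr_def by (intro tendsto_intros tendsto_op_poly_cfc[OF cR p])
  ultimately have "op_powr R s = c powr (-s) *\<^sub>R op_powr (c *\<^sub>R R) s"
    by (rule LIMSEQ_unique)
  then show ?thesis using c by (simp add: powr_minus)
qed

lemma rel_op_scaleR:
  assumes "strictly_positive_op R" "0 < c"
  shows "rel_op (c *\<^sub>R L) (c *\<^sub>R R) = rel_op L R"
proof (rule blinfun_eqI)
  have "c powr (- (1/2)) * c * c powr (- (1/2)) = 1"
    using assms(2) powr_add[of c "-(1/2)" "-(1/2)"] by (simp add: powr_minus field_simps)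
  then show "rel_op (c *\<^sub>R L) (c *\<^sub>R R) x = rel_op L R x" for x
    by (simp add: rel_op_apply op_powr_scaleR assms blinfun.bilinear_simps)
qed

lemma perspective_scaleR:
  assumes "strictly_positive_op R" "0 < c"
  shows "perspective f (c *\<^sub>R L) (c *\<^sub>R R) = c *\<^sub>R perspective f L R"
proof (rule blinfun_eqI)
  have "c powr (1/2) * c powr (1/2) = c"
    using assms(2) powr_add[of c "1/2" "1/2"] by simp
  then show "perspective f (c *\<^sub>R L) (c *\<^sub>R R) x = (c *\<^sub>R perspective f L R) x" for x
    by (simp add: perspective_def rel_op_scaleR op_powr_scaleR assms blinfun.bilinear_simps)
qed

lemma form_bounds_close:
  assumes "form_bounds a b X" "self_adjoint_op Y" "norm (Y - X) \<le> e"
  shows "form_bounds (a - e) (b + e) Y"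
  unfolding form_bounds_def
proof (intro conjI allI)
  fix x
  show "(a - e) * inner x x \<le> inner (Y x) x" "inner (Y x) x \<le> (b + e) * inner x x"
    using form_diff_le_norm[OF assms(3), of x] form_boundsD(2,3)[OF assms(1), of x]
    by (auto simp: algebra_simps abs_le_iff)
qed fact

lemma tendsto_rel_op_and_op_powr:
  assumes R: "\<And>n. strictly_positive_op (R n)" "strictly_positive_op R'" "(R \<longlonglongrightarrow> R')"
    and L: "L \<longlonglongrightarrow> L'"
  shows "(\<lambda>n. op_powr (R n) s) \<longlonglongrightarrow> op_powr R' s" "(\<lambda>n. rel_op (L n) (R n)) \<longlonglongrightarrow> rel_op L' R'"
proof -
  obtain c where c: "0 < c" and R': "form_bounds c (norm R') R'"
    using strictly_positive_op_form_bounds[OF R(2)] .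
  have "\<forall>\<^sub>F n in sequentially. form_bounds (c - c / 2) (norm R' + c / 2) (R n)"
    using tendstoD[OF R(3), of "c / 2"] c
  proof (simp, elim eventually_mono)
    fix n assume "dist (R n) R' * 2 < c"
    then show "form_bounds (c / 2) (norm R' + c / 2) (R n)"
      using form_bounds_close[OF R' , of "R n" "c / 2"] R(1)[of n]
      by (auto simp: dist_norm strictly_positive_op_def positive_op_iff)
  qed
  moreover have "form_bounds (c - c / 2) (norm R' + c / 2) R'"
    using form_bounds_mono[OF R'] c by simp
  ultimately have powr: "(\<lambda>n. op_powr (R n) s) \<longlonglongrightarrow> op_powr R' s" for s
    unfolding op_powr_def by (rule tendsto_cfc[OF _ _ continuous_on_powr_pos R(3)]) (use c in auto)
  then show "(\<lambda>n. op_powr (R n) s) \<longlonglongrightarrow> op_powr R' s" .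
  show "(\<lambda>n. rel_op (L n) (R n)) \<longlonglongrightarrow> rel_op L' R'"
    unfolding rel_op_def
    by (intro bounded_bilinear.tendsto[OF bounded_bilinear_blinfun_compose] powr L)
qed

text \<open>
  The approximating relative operators need a common compact interval inside \<open>J\<close>. If \<open>J\<close>
  extends beyond the bound of the limit, there is room for all but finitely many of them; otherwise that
  bound is the end of \<open>J\<close>, and all of them respect it.
\<close>

lemma tendsto_perspective:
  assumes J: "is_interval J" and f: "continuous_on J f"
    and R: "\<And>n. strictly_positive_op (R n)" "strictly_positive_op R'" "(R \<longlonglongrightarrow> R')"
    and L: "L \<longlonglongrightarrow> L'"
    and ab: "\<And>n. \<exists>a\<in>J. \<exists>b\<in>J. rel_bounds a b (L n) (R n)" "a \<in> J" "b \<in> J" "rel_bounds a b L' R'"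
  shows "(\<lambda>n. perspective f (L n) (R n)) \<longlonglongrightarrow> perspective f L' R'"
proof -
  note rel = tendsto_rel_op_and_op_powr(2)[OF R L]
  have X': "form_bounds a b (rel_op L' R')"
    using R(2) ab(4) rel_boundsD(1) form_bounds_rel_op_iff by blast
  have "\<exists>a'\<in>J. a' \<le> a \<and> (a' = a \<longrightarrow> (\<forall>y\<in>J. a \<le> y))"
    using ab(2) by (metis less_eq_real_def linorder_not_le order_less_irrefl)
  then obtain a' where a': "a' \<in> J" "a' \<le> a" "a' = a \<longrightarrow> (\<forall>y\<in>J. a \<le> y)" by blast
  have "\<exists>b'\<in>J. b \<le> b' \<and> (b' = b \<longrightarrow> (\<forall>y\<in>J. y \<le> b))"
    using ab(3) by (metis less_eq_real_def linorder_not_le order_less_irrefl)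
  then obtain b' where b': "b' \<in> J" "b \<le> b'" "b' = b \<longrightarrow> (\<forall>y\<in>J. y \<le> b)" by blast
  \<comment> \<open>the room left beyond \<open>a\<close> and \<open>b\<close>; an end without room imposes no restriction\<close>
  define e where "e = min (if a' = a then 1 else a - a') (if b' = b then 1 else b' - b)"
  have e: "0 < e" using a'(2) b'(2) by (auto simp: e_def)
  have J': "{a'..b'} \<subseteq> J"
    using J a'(1) b'(1) unfolding is_interval_1 by (metis atLeastAtMost_iff subsetI)
  have "\<forall>\<^sub>F n in sequentially. form_bounds a' b' (rel_op (L n) (R n))"
    using tendstoD[OF rel e]
  proof eventually_elim
    case (elim n)
    obtain an bn where n: "an \<in> J" "bn \<in> J" "rel_bounds an bn (L n) (R n)"
      using ab(1) by blast
    have Xn: "form_bounds an bn (rel_op (L n) (R n))"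
      using R(1) n(3) rel_boundsD(1) form_bounds_rel_op_iff by blast
    have Xe: "form_bounds (a - e) (b + e) (rel_op (L n) (R n))"
      using form_bounds_close[OF X' form_boundsD(1)[OF Xn]] elim by (simp add: dist_norm)
    have "a' * inner x x \<le> inner (rel_op (L n) (R n) x) x" for x
    proof (cases "a' = a")
      case True
      then have "a' * inner x x \<le> an * inner x x"
        using a'(3) n(1) by (intro mult_right_mono) auto
      then show ?thesis using form_boundsD(2)[OF Xn, of x] by simp
    next
      case False
      then have "a' * inner x x \<le> (a - e) * inner x x"
        by (intro mult_right_mono) (auto simp: e_def)
      then show ?thesis using form_boundsD(2)[OF Xe, of x] by simp
    qed
    moreover have "inner (rel_op (L n) (R n) x) x \<le> b' * inner x x" for x
    proof (cases "b' = b")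
      case True
      then have "bn * inner x x \<le> b' * inner x x"
        using b'(3) n(2) by (intro mult_right_mono) auto
      then show ?thesis using form_boundsD(3)[OF Xn, of x] by simp
    next
      case False
      then have "(b + e) * inner x x \<le> b' * inner x x"
        by (intro mult_right_mono) (auto simp: e_def)
      then show ?thesis using form_boundsD(3)[OF Xe, of x] by simp
    qed
    ultimately show ?case using form_boundsD(1)[OF Xn] by (simp add: form_bounds_def)
  qed
  moreover have "form_bounds a' b' (rel_op L' R')"
    using form_bounds_mono[OF X' a'(2) b'(2)] .
  ultimately have "(\<lambda>n. cfc f (rel_op (L n) (R n))) \<longlonglongrightarrow> cfc f (rel_op L' R')"
    by (rule tendsto_cfc[OF _ _ continuous_on_subset[OF f J'] rel])
  then show ?thesis
    unfolding perspective_def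
    by (intro bounded_bilinear.tendsto[OF bounded_bilinear_blinfun_compose]
        tendsto_rel_op_and_op_powr(1)[OF R L])
qed

section \<open>Bochner integrals of fields of operators\<close>

text \<open>
  In a non-separable space two Borel measurable functions need not form a Borel measurable pair, so that
  the integrals of several fields could not be approximated together. It is enough for all purposes here
  that the distances of the function to its approximants are measurable, and this passes to pairs.
\<close>

definition simple_approx :: "'t measure \<Rightarrow> ('t \<Rightarrow> 'b::real_normed_vector) \<Rightarrow> 'b \<Rightarrow> bool" where
  "simple_approx M F I \<longleftrightarrow>
     (\<exists>s. (\<forall>i. Bochner_Integration.simple_bochner_integrable M (s i)) \<and>
          (\<forall>i. (\<lambda>t. norm (F t - s i t)) \<in> borel_measurable M) \<and>
          (\<lambda>i. \<integral>\<^sup>+t. ennreal (norm (F t - s i t)) \<partial>M) \<longlonglongrightarrow> 0 \<and>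
          (\<lambda>i. Bochner_Integration.simple_bochner_integral M (s i)) \<longlonglongrightarrow> I)"

lemma borel_measurable_norm_diff_simple:
  fixes F s :: "'t \<Rightarrow> 'b::real_normed_vector"
  assumes F: "F \<in> borel_measurable M" and s: "simple_function M s"
  shows "(\<lambda>t. norm (F t - s t)) \<in> borel_measurable M"
proof (rule measurable_compose_countable'[where I = "s ` space M" and g = s and f = "\<lambda>y t. norm (F t - y)"])
  show "(\<lambda>t. norm (F t - y)) \<in> borel_measurable M" for y
    by (rule measurable_compose[OF F]) (intro borel_measurable_continuous_onI continuous_intros)
  show "s \<in> measurable M (count_space (s ` space M))"
    using s by (subst measurable_count_space_eq2) (auto simp: simple_function_def)
  show "countable (s ` space M)"
    using s by (auto simp: simple_function_def intro: countable_finite)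
qed

lemma simple_approx_if_has_bochner_int:
  assumes "has_bochner_int M F I"
  shows "simple_approx M F I"
proof -
  obtain s where F: "F \<in> borel_measurable M"
    and s: "\<And>i. Bochner_Integration.simple_bochner_integrable M (s i)"
      "(\<lambda>i. \<integral>\<^sup>+t. ennreal (norm (F t - s i t)) \<partial>M) \<longlonglongrightarrow> 0"
      "(\<lambda>i. Bochner_Integration.simple_bochner_integral M (s i)) \<longlonglongrightarrow> I"
    using assms unfolding has_bochner_int_def by blast
  have "(\<lambda>t. norm (F t - s i t)) \<in> borel_measurable M" for i
    using s(1)[of i] by (intro borel_measurable_norm_diff_simple[OF F])
      (auto elim: simple_bochner_integrable.cases)
  with s show ?thesis unfolding simple_approx_def by blast
qed

lemma dist_simple_bochner_integral_le:
  fixes F :: "'t \<Rightarrow> 'b::real_normed_vector"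
  assumes s: "Bochner_Integration.simple_bochner_integrable M s" "(\<lambda>t. norm (F t - s t)) \<in> borel_measurable M"
    and r: "Bochner_Integration.simple_bochner_integrable M r" "(\<lambda>t. norm (F t - r t)) \<in> borel_measurable M"
  shows "ennreal (dist (Bochner_Integration.simple_bochner_integral M s)
      (Bochner_Integration.simple_bochner_integral M r)) \<le>
    (\<integral>\<^sup>+t. norm (F t - s t) \<partial>M) + (\<integral>\<^sup>+t. norm (F t - r t) \<partial>M)"
proof -
  have "dist (Bochner_Integration.simple_bochner_integral M s) (Bochner_Integration.simple_bochner_integral M r) =
      norm (Bochner_Integration.simple_bochner_integral M (\<lambda>t. s t - r t))"
    using s r by (simp add: simple_bochner_integral_diff dist_norm)
  also have "\<dots> \<le> Bochner_Integration.simple_bochner_integral M (\<lambda>t. norm (s t - r t))"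
    by (rule simple_bochner_integral_norm_bound[OF
        simple_bochner_integrable_compose2[where p = "(-)", OF _ s(1) r(1)]]) simp
  finally have "ennreal (dist (Bochner_Integration.simple_bochner_integral M s) (Bochner_Integration.simple_bochner_integral M r)) \<le>
      ennreal (Bochner_Integration.simple_bochner_integral M (\<lambda>t. norm (s t - r t)))"
    by (rule ennreal_leI)
  also have "\<dots> = (\<integral>\<^sup>+t. norm (s t - r t) \<partial>M)"
    by (rule simple_bochner_integral_eq_nn_integral[OF
        simple_bochner_integrable_compose2[where p = "\<lambda>x y. norm (x - y)", OF _ s(1) r(1)]]) simp_all
  also have "\<dots> \<le> (\<integral>\<^sup>+t. ennreal (norm (F t - s t)) + ennreal (norm (F t - r t)) \<partial>M)"
  proof (rule nn_integral_mono)
    fix t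
    have "norm (s t - r t) \<le> norm (F t - s t) + norm (F t - r t)"
      by (metis dual_order.refl norm_diff_triangle_le norm_minus_commute)
    then show "ennreal (norm (s t - r t)) \<le> ennreal (norm (F t - s t)) + ennreal (norm (F t - r t))"
      by (metis ennreal_leI ennreal_plus norm_ge_zero)
  qed
  also have "\<dots> = (\<integral>\<^sup>+t. norm (F t - s t) \<partial>M) + (\<integral>\<^sup>+t. norm (F t - r t) \<partial>M)"
    by (rule nn_integral_add) (use s(2) r(2) in measurable)
  finally show ?thesis .
qed

lemma tendsto_0_ennreal_le:
  fixes u v :: "nat \<Rightarrow> ennreal"
  assumes "v \<longlonglongrightarrow> 0" "\<And>i. u i \<le> v i"
  shows "u \<longlonglongrightarrow> 0"
  using assms by (intro tendsto_sandwich[of "\<lambda>i. 0" u sequentially v 0]) simp_all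

lemma simple_approx_unique:
  assumes "simple_approx M F I" "simple_approx M F I'"
  shows "I = I'"
proof -
  obtain s where s: "\<And>i. Bochner_Integration.simple_bochner_integrable M (s i)"
      "\<And>i. (\<lambda>t. norm (F t - s i t)) \<in> borel_measurable M"
      "(\<lambda>i. \<integral>\<^sup>+t. ennreal (norm (F t - s i t)) \<partial>M) \<longlonglongrightarrow> 0"
      "(\<lambda>i. Bochner_Integration.simple_bochner_integral M (s i)) \<longlonglongrightarrow> I"
    using assms(1) unfolding simple_approx_def by blast
  obtain r where r: "\<And>i. Bochner_Integration.simple_bochner_integrable M (r i)"
      "\<And>i. (\<lambda>t. norm (F t - r i t)) \<in> borel_measurable M"
      "(\<lambda>i. \<integral>\<^sup>+t. ennreal (norm (F t - r i t)) \<partial>M) \<longlonglongrightarrow> 0"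
      "(\<lambda>i. Bochner_Integration.simple_bochner_integral M (r i)) \<longlonglongrightarrow> I'"
    using assms(2) unfolding simple_approx_def by blast
  have "(\<lambda>i. (\<integral>\<^sup>+t. ennreal (norm (F t - s i t)) \<partial>M) + (\<integral>\<^sup>+t. ennreal (norm (F t - r i t)) \<partial>M)) \<longlonglongrightarrow> 0"
    using tendsto_add[OF s(3) r(3)] by simp
  then have "(\<lambda>i. ennreal (dist (Bochner_Integration.simple_bochner_integral M (s i)) (Bochner_Integration.simple_bochner_integral M (r i)))) \<longlonglongrightarrow> 0"
    by (rule tendsto_0_ennreal_le[OF _ dist_simple_bochner_integral_le[OF s(1,2) r(1,2)]])
  then have "(\<lambda>i. dist (Bochner_Integration.simple_bochner_integral M (s i)) (Bochner_Integration.simple_bochner_integral M (r i))) \<longlonglongrightarrow> 0"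
    by (simp add: ennreal_tendsto_0_iff)
  moreover have "(\<lambda>i. dist (Bochner_Integration.simple_bochner_integral M (s i)) (Bochner_Integration.simple_bochner_integral M (r i))) \<longlonglongrightarrow> dist I I'"
    by (intro tendsto_dist s r)
  ultimately show ?thesis
    using LIMSEQ_unique by fastforce
qed

lemma bochner_int_eq:
  assumes "has_bochner_int M F I"
  shows "bochner_int M F = I"
  unfolding bochner_int_def
proof (rule the_equality)
  show "J = I" if "has_bochner_int M F J" for J
    by (rule simple_approx_unique[OF that[THEN simple_approx_if_has_bochner_int]
          assms[THEN simple_approx_if_has_bochner_int]])
qed fact

lemma simple_approx_bochner_int:
  assumes "bochner_integrable M F"
  shows "simple_approx M F (bochner_int M F)"
proof -
  obtain I where "has_bochner_int M F I"
    using assms unfolding bochner_integrable_def by blast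
  then show ?thesis
    using bochner_int_eq simple_approx_if_has_bochner_int by fastforce
qed

lemma bochner_integrable_indicator:
  fixes F :: "'t \<Rightarrow> 'b::banach"
  assumes F: "bochner_integrable M F" and S: "S \<in> sets M"
  shows "bochner_integrable M (\<lambda>t. indicat_real S t *\<^sub>R F t)"
proof -
  obtain s I where F_meas: "F \<in> borel_measurable M"
    and s: "\<And>i. Bochner_Integration.simple_bochner_integrable M (s i)"
      "(\<lambda>i. \<integral>\<^sup>+t. ennreal (norm (F t - s i t)) \<partial>M) \<longlonglongrightarrow> 0"
    using F unfolding bochner_integrable_def has_bochner_int_def by blast
  let ?F = "\<lambda>t. indicat_real S t *\<^sub>R F t"
  define r where "r i t = indicat_real S t *\<^sub>R s i t" for i t
  have "?F = (\<lambda>t. if t \<in> S then F t else 0)"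
    by (auto simp: fun_eq_iff)
  then have F'_meas: "?F \<in> borel_measurable M"
    using F_meas S by (auto intro!: measurable_If_set)
  have r_int: "Bochner_Integration.simple_bochner_integrable M (r i)" for i
  proof (rule simple_bochner_integrable.intros)
    have si: "simple_function M (s i)" "emeasure M {y\<in>space M. s i y \<noteq> 0} \<noteq> \<infinity>"
      using s(1)[of i] by (auto elim: simple_bochner_integrable.cases)
    show "simple_function M (r i)"
      unfolding r_def
      by (rule simple_function_compose2[OF simple_function_indicator[OF S] si(1)])
    have "emeasure M {y\<in>space M. r i y \<noteq> 0} \<le> emeasure M {y\<in>space M. s i y \<noteq> 0}"
    proof (rule emeasure_mono)
      show "{y\<in>space M. s i y \<noteq> 0} \<in> sets M"
        using simple_functionD(2)[OF si(1), of "UNIV - {0}"] by (simp add: vimage_def Int_def conj_commute)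
    qed (auto simp: r_def)
    then show "emeasure M {y\<in>space M. r i y \<noteq> 0} \<noteq> \<infinity>"
      using si(2) by (auto simp: top_unique)
  qed
  have r_meas: "(\<lambda>t. norm (?F t - r i t)) \<in> borel_measurable M" for i
    using r_int[of i] by (intro borel_measurable_norm_diff_simple[OF F'_meas])
      (auto elim: simple_bochner_integrable.cases)
  have r_lim: "(\<lambda>i. \<integral>\<^sup>+t. ennreal (norm (?F t - r i t)) \<partial>M) \<longlonglongrightarrow> 0"
    by (rule tendsto_0_ennreal_le[OF s(2)], rule nn_integral_mono)
      (auto simp: r_def indicator_def)
  have "Cauchy (\<lambda>i. Bochner_Integration.simple_bochner_integral M (r i))"
  proof (rule metric_CauchyI)
    fix e :: real assume e: "0 < e"
    then have "\<forall>\<^sub>F i in sequentially. (\<integral>\<^sup>+t. ennreal (norm (?F t - r i t)) \<partial>M) < ennreal (e / 2)"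
      using order_tendstoD(2)[OF r_lim, of "ennreal (e / 2)"] by simp
    then obtain N where N: "\<And>i. i \<ge> N \<Longrightarrow> (\<integral>\<^sup>+t. ennreal (norm (?F t - r i t)) \<partial>M) < ennreal (e / 2)"
      by (auto simp: eventually_sequentially)
    have "dist (Bochner_Integration.simple_bochner_integral M (r i)) (Bochner_Integration.simple_bochner_integral M (r j)) < e"
      if "N \<le> i" "N \<le> j" for i j
    proof -
      have "ennreal (dist (Bochner_Integration.simple_bochner_integral M (r i)) (Bochner_Integration.simple_bochner_integral M (r j))) \<le>
          (\<integral>\<^sup>+t. norm (?F t - r i t) \<partial>M) + (\<integral>\<^sup>+t. norm (?F t - r j t) \<partial>M)"
        by (intro dist_simple_bochner_integral_le r_int r_meas)
      also have "\<dots> < ennreal (e / 2) + ennreal (e / 2)"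
        by (intro add_strict_mono N that)
      also have "\<dots> = ennreal e"
        using e by (simp flip: ennreal_plus)
      finally show ?thesis
        using e by (simp add: ennreal_less_iff)
    qed
    then show "\<exists>N. \<forall>m\<ge>N. \<forall>n\<ge>N. dist (Bochner_Integration.simple_bochner_integral M (r m)) (Bochner_Integration.simple_bochner_integral M (r n)) < e"
      by blast
  qed
  then obtain I' where "(\<lambda>i. Bochner_Integration.simple_bochner_integral M (r i)) \<longlonglongrightarrow> I'"
    using convergent_eq_Cauchy by blast
  with F'_meas r_int r_lim show ?thesis
    unfolding bochner_integrable_def has_bochner_int_def by blast
qed

lemma simple_approx_set_bochner_int:
  assumes "bochner_integrable M F" "S \<in> sets M"
  shows "simple_approx M (\<lambda>t. indicat_real S t *\<^sub>R F t) (set_bochner_int M S F)"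
  unfolding set_bochner_int_def
  by (intro simple_approx_bochner_int bochner_integrable_indicator assms)

lemma simple_approx_Pair:
  assumes "simple_approx M F I" "simple_approx M G I'"
  shows "simple_approx M (\<lambda>t. (F t, G t)) (I, I')"
proof -
  obtain s where s: "\<And>i. Bochner_Integration.simple_bochner_integrable M (s i)"
      "\<And>i. (\<lambda>t. norm (F t - s i t)) \<in> borel_measurable M"
      "(\<lambda>i. \<integral>\<^sup>+t. ennreal (norm (F t - s i t)) \<partial>M) \<longlonglongrightarrow> 0"
      "(\<lambda>i. Bochner_Integration.simple_bochner_integral M (s i)) \<longlonglongrightarrow> I"
    using assms(1) unfolding simple_approx_def by blast
  obtain r where r: "\<And>i. Bochner_Integration.simple_bochner_integrable M (r i)"
      "\<And>i. (\<lambda>t. norm (G t - r i t)) \<in> borel_measurable M"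
      "(\<lambda>i. \<integral>\<^sup>+t. ennreal (norm (G t - r i t)) \<partial>M) \<longlonglongrightarrow> 0"
      "(\<lambda>i. Bochner_Integration.simple_bochner_integral M (r i)) \<longlonglongrightarrow> I'"
    using assms(2) unfolding simple_approx_def by blast
  define q where "q i t = (s i t, r i t)" for i t
  have q_int: "Bochner_Integration.simple_bochner_integrable M (q i)" for i
    unfolding q_def
    by (rule simple_bochner_integrable_compose2[where p = Pair, OF _ s(1) r(1)]) (simp add: zero_prod_def)
  have norm_q: "norm ((F t, G t) - q i t) = sqrt ((norm (F t - s i t))\<^sup>2 + (norm (G t - r i t))\<^sup>2)" for i t
    by (simp add: q_def norm_Pair)
  have "(\<lambda>t. norm ((F t, G t) - q i t)) \<in> borel_measurable M" for i
    unfolding norm_q using s(2)[of i] r(2)[of i] by measurable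
  moreover have "(\<lambda>i. \<integral>\<^sup>+t. ennreal (norm ((F t, G t) - q i t)) \<partial>M) \<longlonglongrightarrow> 0"
  proof (rule tendsto_sandwich[OF _ _ tendsto_const])
    have "(\<lambda>i. (\<integral>\<^sup>+t. ennreal (norm (F t - s i t)) \<partial>M) + (\<integral>\<^sup>+t. ennreal (norm (G t - r i t)) \<partial>M)) \<longlonglongrightarrow> 0 + 0"
      by (intro tendsto_add s r)
    then show "(\<lambda>i. (\<integral>\<^sup>+t. ennreal (norm (F t - s i t)) \<partial>M) + (\<integral>\<^sup>+t. ennreal (norm (G t - r i t)) \<partial>M)) \<longlonglongrightarrow> 0"
      by simp
    have "(\<integral>\<^sup>+t. ennreal (norm ((F t, G t) - q i t)) \<partial>M) \<le>
        (\<integral>\<^sup>+t. ennreal (norm (F t - s i t)) + ennreal (norm (G t - r i t)) \<partial>M)" for i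
      by (rule nn_integral_mono)
        (simp add: norm_q sqrt_sum_squares_le_sum ennreal_leI flip: ennreal_plus)
    then show "\<forall>\<^sub>F i in sequentially. (\<integral>\<^sup>+t. ennreal (norm ((F t, G t) - q i t)) \<partial>M) \<le>
        (\<integral>\<^sup>+t. ennreal (norm (F t - s i t)) \<partial>M) + (\<integral>\<^sup>+t. ennreal (norm (G t - r i t)) \<partial>M)"
      using s(2) r(2) by (simp add: nn_integral_add)
  qed simp
  moreover have "Bochner_Integration.simple_bochner_integral M (q i) = (Bochner_Integration.simple_bochner_integral M (s i), Bochner_Integration.simple_bochner_integral M (r i))" for i
    using simple_bochner_integral_linear[OF bounded_linear.linear[OF bounded_linear_fst] q_int[of i]]
      simple_bochner_integral_linear[OF bounded_linear.linear[OF bounded_linear_snd] q_int[of i]]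
    by (simp add: q_def prod_eq_iff)
  ultimately show ?thesis
    unfolding simple_approx_def using q_int s(4) r(4)
    by (intro exI[of _ q]) (auto intro!: tendsto_Pair)
qed

lemma simple_approx_if_has_bochner_integral:
  fixes F :: "'t \<Rightarrow> real"
  assumes "has_bochner_integral M F I"
  shows "simple_approx M F I"
  using assms
proof cases
  case (1 s)
  then have "(\<lambda>t. norm (F t - s i t)) \<in> borel_measurable M" for i
    by (metis borel_measurable_norm_diff_simple simple_bochner_integrable.cases)
  with 1 show ?thesis unfolding simple_approx_def by blast
qed

lemma simple_approx_null_set:
  fixes F :: "'t \<Rightarrow> 'b::banach"
  assumes "simple_approx M (\<lambda>t. indicat_real S t *\<^sub>R F t) I" "S \<in> null_sets M" "F \<in> borel_measurable M"
  shows "I = 0"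
proof (rule simple_approx_unique[OF assms(1)])
  let ?F = "\<lambda>t. indicat_real S t *\<^sub>R F t"
  have "?F = (\<lambda>t. if t \<in> S then F t else 0)"
    by (auto simp: fun_eq_iff)
  then have meas: "?F \<in> borel_measurable M"
    using assms(2,3) by (auto intro!: measurable_If_set)
  have "AE t in M. ?F t = 0"
    using AE_not_in[OF assms(2)] by eventually_elim simp
  then have "(\<integral>\<^sup>+t. ennreal (norm (?F t - 0)) \<partial>M) = (\<integral>\<^sup>+t. 0 \<partial>M)"
    by (intro nn_integral_cong_AE) auto
  moreover have "Bochner_Integration.simple_bochner_integrable M (\<lambda>t. 0 :: 'b)" "Bochner_Integration.simple_bochner_integral M (\<lambda>t. 0 :: 'b) = 0"
    by (auto intro!: simple_bochner_integrable.intros sum.neutral simp: simple_bochner_integral_def)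
  moreover have "(\<lambda>t. norm (?F t - 0)) \<in> borel_measurable M"
    by (rule borel_measurable_norm_diff_simple[OF meas]) simp
  ultimately show "simple_approx M ?F 0"
    unfolding simple_approx_def by (intro exI[of _ "\<lambda>i t. 0"]) simp
qed

text \<open>
  On each level set \<open>E\<close> of an approximating simple function \<open>s\<close> choose a point \<open>t\<^sub>E\<close> at which the
  error \<open>\<parallel>F - s\<parallel>\<close> is nearly smallest. The finite sum \<open>\<Sum> \<mu>(E) F(t\<^sub>E)\<close> belongs to the cone, and its distance
  from \<open>\<integral>s\<close> is at most slightly more than \<open>\<integral>\<parallel>F - s\<parallel>\<close>.
\<close>

lemma simple_approx_in_closure_cone:
  fixes F :: "'t \<Rightarrow> 'b::real_normed_vector"
  assumes I: "simple_approx M F I" and fin: "finite_measure M"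
    and C0: "0 \<in> C" and C_add: "\<And>x y. x \<in> C \<Longrightarrow> y \<in> C \<Longrightarrow> x + y \<in> C"
    and C_scale: "\<And>c x. 0 < c \<Longrightarrow> x \<in> C \<Longrightarrow> c *\<^sub>R x \<in> C"
    and F: "\<And>t. t \<in> space M \<Longrightarrow> F t \<in> C"
  shows "I \<in> closure C"
proof -
  interpret finite_measure M by fact
  obtain s where s: "\<And>i. Bochner_Integration.simple_bochner_integrable M (s i)"
      "\<And>i. (\<lambda>t. norm (F t - s i t)) \<in> borel_measurable M"
      "(\<lambda>i. \<integral>\<^sup>+t. ennreal (norm (F t - s i t)) \<partial>M) \<longlonglongrightarrow> 0"
      "(\<lambda>i. Bochner_Integration.simple_bochner_integral M (s i)) \<longlonglongrightarrow> I"
    using I unfolding simple_approx_def by blast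
  have "\<exists>x\<in>C. ennreal (dist x (Bochner_Integration.simple_bochner_integral M (s i))) \<le>
      (\<integral>\<^sup>+t. ennreal (norm (F t - s i t)) \<partial>M) + ennreal (d * measure M (space M))" if d: "0 < d" for i d
  proof -
    define E where "E y = {t\<in>space M. s i t = y}" for y
    have sf: "simple_function M (s i)"
      using s(1)[of i] by (auto elim: simple_bochner_integrable.cases)
    then have finY: "finite (s i ` space M)"
      by (simp add: simple_function_def)
    define m where "m y = (INF t\<in>E y. norm (F t - y))" for y
    have bdd: "bdd_below ((\<lambda>t. norm (F t - y)) ` E y)" for y
      by (rule bdd_belowI2[of _ 0]) simp
    have "\<exists>t\<in>E y. norm (F t - y) < m y + d" if "y \<in> s i ` space M" for y
      using cInf_lessD[of "(\<lambda>t. norm (F t - y)) ` E y" "m y + d"] that d by (auto simp: m_def E_def)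
    then obtain pt where pt: "\<And>y. y \<in> s i ` space M \<Longrightarrow> pt y \<in> E y"
      "\<And>y. y \<in> s i ` space M \<Longrightarrow> norm (F (pt y) - y) < m y + d"
      by metis
    define x where "x = (\<Sum>y\<in>s i ` space M. measure M (E y) *\<^sub>R F (pt y))"
    have "x \<in> C"
    proof -
      have cm: "measure M (E y) *\<^sub>R F (pt y) \<in> C" if "y \<in> s i ` space M" for y
        using C_scale[of "measure M (E y)" "F (pt y)"] F[of "pt y"] pt(1)[OF that] C0
        by (cases "measure M (E y) = 0") (auto simp: E_def zero_less_measure_iff)
      have "(\<Sum>y\<in>Y. measure M (E y) *\<^sub>R F (pt y)) \<in> C" if "finite Y" "Y \<subseteq> s i ` space M" for Y
        using that
      proof (induction Y rule: finite_induct)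
        case (insert y Y)
        then show ?case using C_add[OF cm[of y] insert.IH] by simp
      qed (simp add: C0)
      then show ?thesis
        unfolding x_def using finY by blast
    qed
    \<comment> \<open>\<open>m \<ge> 0\<close> on the values of \<open>s i\<close>; the maximum only makes \<open>g\<close> nonnegative outside the space as well\<close>
    define g where "g t = max 0 (m (s i t)) + d" for t
    have g: "Bochner_Integration.simple_bochner_integrable M g"
      unfolding g_def using emeasure_finite
      by (intro simple_bochner_integrable.intros simple_function_compose1[OF sf]) (auto simp: less_top)
    have "dist x (Bochner_Integration.simple_bochner_integral M (s i)) = norm (\<Sum>y\<in>s i ` space M. measure M (E y) *\<^sub>R (F (pt y) - y))"
      by (simp add: x_def simple_bochner_integral_def dist_norm E_def scaleR_diff_right sum_subtractf)
    also have "\<dots> \<le> (\<Sum>y\<in>s i ` space M. measure M (E y) *\<^sub>R (max 0 (m y) + d))"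
    proof (rule sum_norm_le)
      fix y assume "y \<in> s i ` space M"
      then have "norm (F (pt y) - y) \<le> max 0 (m y) + d"
        using pt(2)[of y] by linarith
      then show "norm (measure M (E y) *\<^sub>R (F (pt y) - y)) \<le> measure M (E y) *\<^sub>R (max 0 (m y) + d)"
        by (simp add: mult_left_mono)
    qed
    also have "\<dots> = Bochner_Integration.simple_bochner_integral M g"
      unfolding E_def using sf
      by (intro simple_bochner_integral_partition[OF g, symmetric]) (auto simp: g_def)
    finally have "ennreal (dist x (Bochner_Integration.simple_bochner_integral M (s i))) \<le> ennreal (Bochner_Integration.simple_bochner_integral M g)"
      by (rule ennreal_leI)
    also have "\<dots> = (\<integral>\<^sup>+t. g t \<partial>M)"
      using d by (intro simple_bochner_integral_eq_nn_integral g) (simp add: g_def)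
    also have "\<dots> \<le> (\<integral>\<^sup>+t. ennreal (norm (F t - s i t)) + ennreal d \<partial>M)"
    proof (rule nn_integral_mono)
      fix t assume t: "t \<in> space M"
      then have "m (s i t) \<le> norm (F t - s i t)"
        unfolding m_def by (intro cINF_lower bdd) (auto simp: E_def)
      then have "g t \<le> norm (F t - s i t) + d"
        by (simp add: g_def)
      then show "ennreal (g t) \<le> ennreal (norm (F t - s i t)) + ennreal d"
        using d by (simp add: ennreal_leI flip: ennreal_plus)
    qed
    also have "\<dots> = (\<integral>\<^sup>+t. ennreal (norm (F t - s i t)) \<partial>M) + ennreal (d * measure M (space M))"
      using s(2)[of i] d by (simp add: nn_integral_add emeasure_eq_measure ennreal_mult)
    finally show ?thesis using \<open>x \<in> C\<close> by blast
  qed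
  then have "\<exists>x\<in>C. ennreal (dist x (Bochner_Integration.simple_bochner_integral M (s i))) \<le>
      (\<integral>\<^sup>+t. ennreal (norm (F t - s i t)) \<partial>M) + ennreal (inverse (real (Suc i)) * measure M (space M))" for i
    by simp
  then obtain x where x: "\<And>i. x i \<in> C" "\<And>i. ennreal (dist (x i) (Bochner_Integration.simple_bochner_integral M (s i))) \<le>
      (\<integral>\<^sup>+t. ennreal (norm (F t - s i t)) \<partial>M) + ennreal (inverse (real (Suc i)) * measure M (space M))"
    by metis
  have "(\<lambda>i. inverse (real (Suc i)) * measure M (space M)) \<longlonglongrightarrow> 0"
    using tendsto_mult[OF LIMSEQ_inverse_real_of_nat tendsto_const] by simp
  then have "(\<lambda>i. ennreal (inverse (real (Suc i)) * measure M (space M))) \<longlonglongrightarrow> 0"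
    by (subst ennreal_tendsto_0_iff) auto
  then have "(\<lambda>i. (\<integral>\<^sup>+t. ennreal (norm (F t - s i t)) \<partial>M) + ennreal (inverse (real (Suc i)) * measure M (space M))) \<longlonglongrightarrow> 0"
    using tendsto_add[OF s(3)] by fastforce
  then have "(\<lambda>i. ennreal (dist (x i) (Bochner_Integration.simple_bochner_integral M (s i)))) \<longlonglongrightarrow> 0"
    by (rule tendsto_0_ennreal_le[OF _ x(2)])
  then have "(\<lambda>i. dist (x i) (Bochner_Integration.simple_bochner_integral M (s i))) \<longlonglongrightarrow> 0"
    by (simp add: ennreal_tendsto_0_iff)
  then have "(\<lambda>i. (x i - Bochner_Integration.simple_bochner_integral M (s i)) + Bochner_Integration.simple_bochner_integral M (s i)) \<longlonglongrightarrow> 0 + I"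
    by (intro tendsto_add s(4)) (simp add: dist_norm tendsto_norm_zero_iff)
  then show ?thesis
    unfolding closure_sequential using x(1) by auto
qed

lemma simple_approx_in_closed_cone:
  fixes F :: "'t \<Rightarrow> 'b::real_normed_vector"
  assumes "simple_approx M F I" "finite_measure M" "closed C"
    and "0 \<in> C" "\<And>x y. x \<in> C \<Longrightarrow> y \<in> C \<Longrightarrow> x + y \<in> C" "\<And>c x. 0 < c \<Longrightarrow> x \<in> C \<Longrightarrow> c *\<^sub>R x \<in> C"
    and "\<And>t. t \<in> space M \<Longrightarrow> F t \<in> C"
  shows "I \<in> C"
  using simple_approx_in_closure_cone[OF assms(1,2,4-7)] assms(3) by (simp add: closure_closed)

section \<open>Strict positivity and relative bounds of integrals\<close>

text \<open>
  Continuity makes the sets where the form is bounded below by \<open>1/(n+1)\<close> closed. One of them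
  meets \<open>S\<close> in positive measure, and its indicator can be integrated along with the two fields.
\<close>

lemma integral_form_strictly_positive:
  fixes A B :: "'t::t2_space \<Rightarrow> 'h::complex_hilbert \<Rightarrow>\<^sub>L 'h"
  assumes fin: "finite_measure M" and M: "sets M = sets borel" and S: "S \<in> sets M" "S \<notin> null_sets M"
    and A: "continuous_on UNIV A" "simple_approx M (\<lambda>t. indicat_real S t *\<^sub>R A t) A'"
    and B: "continuous_on UNIV B" "simple_approx M (\<lambda>t. indicat_real S t *\<^sub>R B t) B'"
    and pos: "\<And>t. \<exists>d>0. \<forall>x. d * inner x x \<le> p * inner (A t x) x + q * inner (B t x) x"
  shows "\<exists>d>0. \<forall>x. d * inner x x \<le> p * inner (A' x) x + q * inner (B' x) x"
proof -
  interpret finite_measure M by fact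
  define E where "E n = {t. \<forall>x. inverse (real (Suc n)) * inner x x \<le> p * inner (A t x) x + q * inner (B t x) x}" for n
  have "closed (E n)" for n
    unfolding E_def using A(1) B(1)
    by (intro closed_Collect_all closed_Collect_le continuous_intros) auto
  then have E: "S \<inter> E n \<in> sets M" for n
    using S(1) M by auto
  have "(\<Union>n. E n) = UNIV"
  proof -
    have "t \<in> (\<Union>n. E n)" for t
    proof -
      obtain d where d: "0 < d" "\<And>x. d * inner x x \<le> p * inner (A t x) x + q * inner (B t x) x"
        using pos by blast
      obtain n where "inverse (real (Suc n)) < d"
        using reals_Archimedean[OF d(1)] by blast
      then have "inverse (real (Suc n)) * inner x x \<le> d * inner x x" for x :: 'h
        by (intro mult_right_mono) auto
      with d(2) have "t \<in> E n"
        unfolding E_def by (blast intro: order_trans)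
      then show ?thesis by blast
    qed
    then show ?thesis by blast
  qed
  then have "S = (\<Union>n. S \<inter> E n)" by blast
  have "\<exists>n. S \<inter> E n \<notin> null_sets M"
  proof (rule ccontr)
    assume "\<not> ?thesis"
    then have "(\<Union>n. S \<inter> E n) \<in> null_sets M" by (intro null_sets_UN) auto
    with S(2) \<open>S = (\<Union>n. S \<inter> E n)\<close> show False by simp
  qed
  then obtain n where n: "S \<inter> E n \<notin> null_sets M" by blast
  define d where "d = measure M (S \<inter> E n) *\<^sub>R inverse (real (Suc n))"
  have "0 < measure M (S \<inter> E n)"
    using n E by (simp add: null_sets_def emeasure_eq_measure zero_less_measure_iff)
  then have d: "0 < d" by (simp add: d_def)
  have "simple_approx M (\<lambda>t. indicat_real (S \<inter> E n) t *\<^sub>R inverse (real (Suc n))) d"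
    unfolding d_def using E
    by (intro simple_approx_if_has_bochner_integral has_bochner_integral_indicator) (auto simp: less_top[symmetric])
  from simple_approx_Pair[OF A(2) simple_approx_Pair[OF B(2) this]]
  have approx: "simple_approx M (\<lambda>t. (indicat_real S t *\<^sub>R A t, indicat_real S t *\<^sub>R B t,
      indicat_real (S \<inter> E n) t *\<^sub>R inverse (real (Suc n)))) (A', B', d)" .
  define C :: "(('h \<Rightarrow>\<^sub>L 'h) \<times> ('h \<Rightarrow>\<^sub>L 'h) \<times> real) set" where
    "C = {c. \<forall>x. snd (snd c) * inner x x \<le> p * inner (blinfun_apply (fst c) x) x + q * inner (blinfun_apply (fst (snd c)) x) x}"
  have "(A', B', d) \<in> C"
  proof (rule simple_approx_in_closed_cone[OF approx fin])
    show "closed C"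
      unfolding C_def by (intro closed_Collect_all closed_Collect_le continuous_intros)
    show "0 \<in> C" by (simp add: C_def)
    show "x + y \<in> C" if "x \<in> C" "y \<in> C" for x y
    proof -
      have "snd (snd (x + y)) * inner v v \<le> p * inner (blinfun_apply (fst (x + y)) v) v + q * inner (blinfun_apply (fst (snd (x + y))) v) v" for v
      proof -
        have "snd (snd z) * inner v v \<le> p * inner (blinfun_apply (fst z) v) v + q * inner (blinfun_apply (fst (snd z)) v) v"
          if "z \<in> C" for z
          using that unfolding C_def by blast
        from this[OF that(1)] this[OF that(2)] show ?thesis
          by (simp add: blinfun.add_left inner_add_left algebra_simps)
      qed
      then show ?thesis by (simp add: C_def)
    qed
    show "c *\<^sub>R x \<in> C" if "0 < c" "x \<in> C" for c x
    proof -
      have "snd (snd (c *\<^sub>R x)) * inner v v \<le> p * inner (blinfun_apply (fst (c *\<^sub>R x)) v) v + q * inner (blinfun_apply (fst (snd (c *\<^sub>R x))) v) v" for v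
      proof -
        have "c * (snd (snd x) * inner v v) \<le> c * (p * inner (blinfun_apply (fst x) v) v + q * inner (blinfun_apply (fst (snd x)) v) v)"
          using that by (intro mult_left_mono) (auto simp: C_def)
        then show ?thesis by (simp add: blinfun.scaleR_left algebra_simps)
      qed
      then show ?thesis by (simp add: C_def)
    qed
    show "(indicat_real S t *\<^sub>R A t, indicat_real S t *\<^sub>R B t,
      indicat_real (S \<inter> E n) t *\<^sub>R inverse (real (Suc n))) \<in> C" for t
    proof -
      have "0 \<le> p * inner (A t x) x + q * inner (B t x) x" for x
        using pos[of t] by (meson inner_ge_zero less_imp_le mult_nonneg_nonneg order_trans)
      then show ?thesis
        by (cases "t \<in> S"; cases "t \<in> E n") (auto simp: C_def E_def)
    qed
  qed
  with d show ?thesis by (auto simp: C_def)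
qed

text \<open>
  The infimum \<open>\<alpha>\<close> of \<open>J\<close> is inherited by the integrals as a closed condition if it lies in \<open>J\<close>. Otherwise
  all forms of \<open>pA\<^sub>t - \<alpha>B\<^sub>t\<close> are strictly positive, hence so is their integral, which leaves room for an
  element of \<open>J\<close> above \<open>\<alpha>\<close>. If \<open>J\<close> is unbounded below, boundedness of the integral of \<open>A\<close> suffices.
  The factor \<open>p\<close> is there for the upper end of \<open>J\<close>, which is the lower end for \<open>-J\<close> and \<open>p = -1\<close>.
\<close>

lemma integral_relative_lower_bound:
  fixes A B :: "'t::t2_space \<Rightarrow> 'h::complex_hilbert \<Rightarrow>\<^sub>L 'h"
  assumes fin: "finite_measure M" and M: "sets M = sets borel" and S: "S \<in> sets M" "S \<notin> null_sets M"
    and A: "continuous_on UNIV A" "simple_approx M (\<lambda>t. indicat_real S t *\<^sub>R A t) A'"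
    and B: "continuous_on UNIV B" "simple_approx M (\<lambda>t. indicat_real S t *\<^sub>R B t) B'"
    and B_pos: "\<And>t. strictly_positive_op (B t)"
    and rel: "\<And>t. \<exists>a\<in>J. \<forall>x. a * inner (B t x) x \<le> p * inner (A t x) x"
  shows "\<exists>a\<in>J. \<forall>x. a * inner (B' x) x \<le> p * inner (A' x) x"
proof -
  have B_form: "\<exists>c>0. \<forall>x. c * inner x x \<le> inner (B t x) x" for t
    using strictly_positive_op_form_bounds[OF B_pos[of t]] form_boundsD(2) by metis
  have B_nonneg: "0 \<le> inner (B t x) x" for t x
    using B_pos[of t] by (auto simp: strictly_positive_op_def positive_op_iff)
  obtain c where c: "0 < c" "\<And>x. c * inner x x \<le> inner (B' x) x"
    using integral_form_strictly_positive[OF fin M S B B, where p = 1 and q = 0] B_form by auto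
  have J: "J \<noteq> {}" using rel by blast
  consider "\<not> bdd_below J" | "Inf J \<in> J" "bdd_below J" | "Inf J \<notin> J" "bdd_below J" by blast
  then show ?thesis
  proof cases
    case 1
    define K where "K = norm (p *\<^sub>R A') / c"
    obtain a where a: "a \<in> J" "a < - K" using 1 unfolding bdd_below_def by (meson not_le)
    have "a * inner (B' x) x \<le> p * inner (A' x) x" for x
    proof -
      have "0 \<le> inner (B' x) x"
        using c by (meson inner_ge_zero less_imp_le mult_nonneg_nonneg order_trans)
      then have "a * inner (B' x) x \<le> - K * inner (B' x) x"
        using a(2) by (intro mult_right_mono) auto
      moreover have "K * (c * inner x x) \<le> K * inner (B' x) x"
        using c by (intro mult_left_mono) (auto simp: K_def)
      moreover have "K * (c * inner x x) = norm (p *\<^sub>R A') * inner x x"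
        using c(1) by (simp add: K_def)
      moreover have "- inner ((p *\<^sub>R A') x) x \<le> norm (p *\<^sub>R A') * inner x x"
        using form_le_norm[of "- (p *\<^sub>R A')" x] by (simp add: blinfun.minus_left)
      ultimately show ?thesis by (simp add: blinfun.scaleR_left)
    qed
    with a(1) show ?thesis by blast
  next
    case 2
    have ge: "Inf J * inner (B t x) x \<le> p * inner (A t x) x" for t x
    proof -
      obtain a where a: "a \<in> J" "\<And>x. a * inner (B t x) x \<le> p * inner (A t x) x" using rel by blast
      have "Inf J * inner (B t x) x \<le> a * inner (B t x) x"
        using cInf_lower[OF a(1) 2(2)] B_nonneg by (intro mult_right_mono) auto
      with a(2) show ?thesis by (meson order_trans)
    qed
    define C :: "(('h \<Rightarrow>\<^sub>L 'h) \<times> ('h \<Rightarrow>\<^sub>L 'h)) set" where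
      "C = {c. \<forall>x. Inf J * inner (blinfun_apply (snd c) x) x \<le> p * inner (blinfun_apply (fst c) x) x}"
    have "(A', B') \<in> C"
    proof (rule simple_approx_in_closed_cone[OF simple_approx_Pair[OF A(2) B(2)] fin])
      show "closed C"
        unfolding C_def by (intro closed_Collect_all closed_Collect_le continuous_intros)
      show "0 \<in> C" by (simp add: C_def)
      show "x + y \<in> C" if "x \<in> C" "y \<in> C" for x y
        using that by (auto simp: C_def blinfun.add_left inner_add_left distrib_left intro: add_mono)
      show "c *\<^sub>R x \<in> C" if "0 < c" "x \<in> C" for c x
      proof -
        have "c * (Inf J * inner (blinfun_apply (snd x) v) v) \<le> c * (p * inner (blinfun_apply (fst x) v) v)" for v
          using that by (intro mult_left_mono) (auto simp: C_def)
        then show ?thesis by (auto simp: C_def blinfun.scaleR_left mult.left_commute)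
      qed
      show "(indicat_real S t *\<^sub>R A t, indicat_real S t *\<^sub>R B t) \<in> C" for t
        using ge by (cases "t \<in> S") (auto simp: C_def)
    qed
    with 2 show ?thesis by (auto simp: C_def)
  next
    case 3
    have "\<exists>d>0. \<forall>x. d * inner x x \<le> p * inner (A t x) x + (- Inf J) * inner (B t x) x" for t
    proof -
      obtain a where a: "a \<in> J" "\<And>x. a * inner (B t x) x \<le> p * inner (A t x) x" using rel by blast
      have aJ: "Inf J < a"
        using cInf_lower[OF a(1) 3(2)] a(1) 3(1) by (metis less_eq_real_def)
      obtain c where c: "0 < c" "\<And>x. c * inner x x \<le> inner (B t x) x" using B_form by blast
      have "(a - Inf J) * c * inner x x \<le> p * inner (A t x) x + (- Inf J) * inner (B t x) x" for x
      proof -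
        have "(a - Inf J) * (c * inner x x) \<le> (a - Inf J) * inner (B t x) x"
          using aJ c(2) by (intro mult_left_mono) auto
        with a(2)[of x] show ?thesis by (simp add: algebra_simps)
      qed
      moreover have "0 < (a - Inf J) * c" using aJ c(1) by simp
      ultimately show ?thesis by blast
    qed
    from integral_form_strictly_positive[OF fin M S A B this]
    obtain d where d: "0 < d" "\<And>x. d * inner x x \<le> p * inner (A' x) x + (- Inf J) * inner (B' x) x"
      by blast
    define K where "K = norm B' + 1"
    have K: "0 < K" by (simp add: K_def add_nonneg_pos)
    have BK: "inner (B' x) x \<le> K * inner x x" for x
      using form_le_norm[of B' x] unfolding K_def by (smt (verit) inner_ge_zero mult_right_mono)
    obtain a where a: "a \<in> J" "a < Inf J + d / K"
      using cInf_lessD[OF J, of "Inf J + d / K"] d(1) K by auto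
    have "a * inner (B' x) x \<le> p * inner (A' x) x" for x
    proof -
      have "0 \<le> inner (B' x) x"
        using c by (meson inner_ge_zero less_imp_le mult_nonneg_nonneg order_trans)
      then have "a * inner (B' x) x \<le> (Inf J + d / K) * inner (B' x) x"
        using a(2) by (intro mult_right_mono) auto
      moreover have "d / K * inner (B' x) x \<le> d / K * (K * inner x x)"
        using d(1) K BK by (intro mult_left_mono) auto
      moreover have "d / K * (K * inner x x) = d * inner x x" using K by simp
      ultimately show ?thesis using d(2)[of x] by (simp add: algebra_simps)
    qed
    with a(1) show ?thesis by blast
  qed
qed

section \<open>The perspective of an integral\<close>

text \<open>
  The pair \<open>(0, 0)\<close>, at which the perspective is zero, is the pair of integrals over a set of measure zero.
\<close>

definition perspective_dom :: "real set \<Rightarrow> ('h::complex_hilbert \<Rightarrow>\<^sub>L 'h) \<Rightarrow> ('h \<Rightarrow>\<^sub>L 'h) \<Rightarrow> bool" where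
  "perspective_dom J L R \<longleftrightarrow> (L = 0 \<and> R = 0) \<or>
     (strictly_positive_op R \<and> (\<exists>a\<in>J. \<exists>b\<in>J. rel_bounds a b L R))"

lemma op_le_refl: "X \<preceq> X"
  by (auto simp: op_le_def positive_op_iff)

lemma op_le_trans:
  assumes "X \<preceq> Y" "Y \<preceq> Z"
  shows "X \<preceq> Z"
proof -
  have "Z - X = (Z - Y) + (Y - X)" by simp
  then show ?thesis
    using assms unfolding op_le_def positive_op_iff
    by (metis self_adjoint_op_intros(3) blinfun.add_left inner_add_left add_nonneg_nonneg)
qed

lemma op_le_add_mono:
  assumes "X \<preceq> Y" "Z \<preceq> U"
  shows "X + Z \<preceq> Y + U"
proof -
  have "Y + U - (X + Z) = (Y - X) + (U - Z)" by simp
  then show ?thesis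
    using assms unfolding op_le_def positive_op_iff
    by (metis self_adjoint_op_intros(3) blinfun.add_left inner_add_left add_nonneg_nonneg)
qed

lemma op_le_scaleR_mono:
  assumes "X \<preceq> Y" "0 \<le> c"
  shows "c *\<^sub>R X \<preceq> c *\<^sub>R Y"
  using assms unfolding op_le_def positive_op_iff scaleR_diff_right[symmetric]
  by (auto simp: blinfun.scaleR_left intro!: self_adjoint_op_intros)

lemma perspective_dom_subadditive:
  assumes inf: "\<not> (\<exists>S :: 'k::complex_hilbert set. finite S \<and> span S = UNIV)"
    and oc: "operator_convex_on TYPE('k) J f" and J: "is_interval J"
    and 1: "perspective_dom J L1 R1" and 2: "perspective_dom J L2 R2"
  shows "perspective_dom J (L1 + L2) (R1 + R2) \<and>
    perspective f (L1 + L2) (R1 + R2) \<preceq> perspective f L1 R1 + perspective f L2 R2"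
proof (cases "(L1 = 0 \<and> R1 = 0) \<or> (L2 = 0 \<and> R2 = 0)")
  case True
  then show ?thesis using 1 2 by (auto simp: perspective_0_0 op_le_refl)
next
  case False
  then obtain a1 b1 a2 b2 where ab: "a1 \<in> J" "b1 \<in> J" "a2 \<in> J" "b2 \<in> J"
    and R: "strictly_positive_op R1" "strictly_positive_op R2"
    and L: "rel_bounds a1 b1 L1 R1" "rel_bounds a2 b2 L2 R2"
    using 1 2 by (auto simp: perspective_dom_def)
  define a b where "a = min a1 a2" and "b = max b1 b2"
  have abJ: "a \<in> J" "b \<in> J" using ab by (auto simp: a_def b_def min_def max_def)
  then have "{a..b} \<subseteq> J"
    using J unfolding is_interval_1 by (metis atLeastAtMost_iff subsetI)
  moreover have L': "rel_bounds a b L1 R1" "rel_bounds a b L2 R2"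
    using L R by (auto intro!: rel_bounds_mono[OF L(1)] rel_bounds_mono[OF L(2)] simp: a_def b_def)
  ultimately have "perspective f (L1 + L2) (R1 + R2) \<preceq> perspective f L1 R1 + perspective f L2 R2"
    by (intro perspective_subadditive[OF inf oc] R)
  moreover have "perspective_dom J (L1 + L2) (R1 + R2)"
    using abJ rel_bounds_add[OF L'] strictly_positive_op_add[OF R] by (auto simp: perspective_dom_def)
  ultimately show ?thesis by blast
qed

lemma perspective_dom_scaleR:
  assumes "perspective_dom J L R" "0 < c"
  shows "perspective_dom J (c *\<^sub>R L) (c *\<^sub>R R) \<and>
    perspective f (c *\<^sub>R L) (c *\<^sub>R R) = c *\<^sub>R perspective f L R"
proof (cases "L = 0 \<and> R = 0")
  case True
  then show ?thesis by (simp add: perspective_0_0 perspective_dom_def)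
next
  case False
  then obtain a b where R: "strictly_positive_op R" and ab: "a \<in> J" "b \<in> J" "rel_bounds a b L R"
    using assms(1) by (auto simp: perspective_dom_def)
  have "rel_bounds a b (c *\<^sub>R L) (c *\<^sub>R R)"
    using ab(3) assms(2) unfolding rel_bounds_def
    by (auto intro!: self_adjoint_op_intros simp: blinfun.scaleR_left mult.left_commute[of _ c])
  with R ab assms(2) show ?thesis
    by (auto simp: perspective_dom_def perspective_scaleR strictly_positive_op_scaleR)
qed

text \<open>
  The triples \<open>(L, R, G)\<close> with \<open>g(L, R) \<le> G\<close> form a convex cone, as \<open>g\<close> is
  subadditive and homogeneous. The triple of integrals lies in its closure, and the inequality
  passes to the limit by the continuity of \<open>g\<close> at the point \<open>(\<integral>A, \<integral>B)\<close> of its domain.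
\<close>

lemma perspective_integral_le:
  fixes A B :: "'t::t2_space \<Rightarrow> 'h::complex_hilbert \<Rightarrow>\<^sub>L 'h"
  assumes nontriv: "\<exists>x::'h. x \<noteq> 0"
    and fin: "finite_measure M" and M: "sets M = sets borel" and S: "S \<in> sets M"
    and inf: "\<not> (\<exists>S :: 'k::complex_hilbert set. finite S \<and> span S = UNIV)"
    and oc: "operator_convex_on TYPE('k) J f" and J: "is_interval J"
    and A: "continuous_on UNIV A" "\<And>t. self_adjoint_op (A t)" "bochner_integrable M A"
    and B: "continuous_on UNIV B" "\<And>t. strictly_positive_op (B t)" "bochner_integrable M B"
    and spec: "\<And>t. op_spectrum (rel_op (A t) (B t)) \<subseteq> complex_of_real ` J"
    and G: "bochner_integrable M (\<lambda>t. perspective f (A t) (B t))"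
  defines "A' \<equiv> set_bochner_int M S A" and "B' \<equiv> set_bochner_int M S B"
    and "G' \<equiv> set_bochner_int M S (\<lambda>t. perspective f (A t) (B t))"
  shows "perspective_dom J A' B' \<and> perspective f A' B' \<preceq> G'"
proof -
  note A' = simple_approx_set_bochner_int[OF A(3) S, folded A'_def]
    and B' = simple_approx_set_bochner_int[OF B(3) S, folded B'_def]
    and G' = simple_approx_set_bochner_int[OF G S, folded G'_def]
  show ?thesis
  proof (cases "S \<in> null_sets M")
    case True
    have "A' = 0" "B' = 0" "G' = 0"
      using simple_approx_null_set[OF A' True] simple_approx_null_set[OF B' True] simple_approx_null_set[OF G' True]
        A(3) B(3) G by (auto simp: bochner_integrable_def has_bochner_int_def)
    then show ?thesis by (simp add: perspective_dom_def perspective_0_0 op_le_refl)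
  next
    case False
    have rel: "\<exists>a\<in>J. \<exists>b\<in>J. rel_bounds a b (A t) (B t)" for t
    proof -
      have X: "self_adjoint_op (rel_op (A t) (B t))"
        by (rule self_adjoint_rel_op[OF B(2) A(2)])
      obtain a b where "a \<in> real_spectrum (rel_op (A t) (B t))" "b \<in> real_spectrum (rel_op (A t) (B t))"
        "form_bounds a b (rel_op (A t) (B t))"
        using form_bounds_in_spectrum[OF X nontriv] .
      then show ?thesis
        using spec[of t] unfolding op_spectrum_subset_iff[OF X] form_bounds_rel_op_iff[OF B(2) A(2)] by blast
    qed
    have B_form: "\<exists>c>0. \<forall>x. c * inner x x \<le> 1 * inner (B t x) x + 0 * inner (B t x) x" for t
    proof -
      obtain c where "0 < c" "form_bounds c (norm (B t)) (B t)"
        using strictly_positive_op_form_bounds[OF B(2)] .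
      then show ?thesis by (auto simp: form_bounds_def)
    qed
    have sa: "closed {X :: 'h \<Rightarrow>\<^sub>L 'h. self_adjoint_op X}"
      unfolding closed_sequential_limits using self_adjoint_op_lim by blast
    have sa_int: "self_adjoint_op F'"
      if "simple_approx M (\<lambda>t. indicat_real S t *\<^sub>R F t) F'" "\<And>t. self_adjoint_op (F t)"
      for F :: "'t \<Rightarrow> 'h \<Rightarrow>\<^sub>L 'h" and F'
    proof -
      have "F' \<in> {X. self_adjoint_op X}"
        by (rule simple_approx_in_closed_cone[OF that(1) fin sa]) (use that(2) in auto)
      then show ?thesis by simp
    qed
    have B_sa: "self_adjoint_op (B t)" for t
      using B(2)[of t] by (simp add: strictly_positive_op_def positive_op_iff)
    have A'_sa: "self_adjoint_op A'" and B'_sa: "self_adjoint_op B'"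
      using sa_int[OF A' A(2)] sa_int[OF B' B_sa] .
    have B'_pos: "strictly_positive_op B'"
    proof -
      obtain d where d: "0 < d" "\<And>x. d * inner x x \<le> inner (B' x) x"
        using integral_form_strictly_positive[OF fin M S False B(1) B' B(1) B' B_form] by auto
      then have "form_bounds d (norm B') B'"
        using B'_sa form_le_norm[of B'] by (simp add: form_bounds_def)
      then show ?thesis using d(1) by (rule strictly_positive_opI)
    qed
    obtain a where a: "a \<in> J" "\<And>x. a * inner (B' x) x \<le> inner (A' x) x"
    proof -
      have "\<exists>a\<in>J. \<forall>x. a * inner (B t x) x \<le> 1 * inner (A t x) x" for t
        using rel[of t] by (auto simp: rel_bounds_def)
      from integral_relative_lower_bound[OF fin M S False A(1) A' B(1) B' B(2) this] that
      show thesis by auto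
    qed
    have "\<exists>b\<in>uminus ` J. \<forall>x. b * inner (B t x) x \<le> - 1 * inner (A t x) x" for t
      using rel[of t] by (force simp: rel_bounds_def)
    from integral_relative_lower_bound[OF fin M S False A(1) A' B(1) B' B(2) this]
    obtain b where b: "b \<in> J" "\<And>x. inner (A' x) x \<le> b * inner (B' x) x"
      by force
    have ab': "rel_bounds a b A' B'"
      using a b A'_sa by (simp add: rel_bounds_def)
    have dom: "perspective_dom J A' B'"
      using ab' a(1) b(1) B'_pos by (auto simp: perspective_dom_def)
    define C :: "(('h \<Rightarrow>\<^sub>L 'h) \<times> ('h \<Rightarrow>\<^sub>L 'h) \<times> ('h \<Rightarrow>\<^sub>L 'h)) set" where
      "C = {(L, R, G). perspective_dom J L R \<and> perspective f L R \<preceq> G}"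
    have "(A', B', G') \<in> closure C"
    proof (rule simple_approx_in_closure_cone[OF simple_approx_Pair[OF A' simple_approx_Pair[OF B' G']] fin])
      show 0: "0 \<in> C"
        by (simp add: C_def zero_prod_def perspective_dom_def perspective_0_0 op_le_refl)
      show "x + y \<in> C" if "x \<in> C" "y \<in> C" for x y
      proof -
        obtain L1 R1 G1 L2 R2 G2 where xy: "x = (L1, R1, G1)" "y = (L2, R2, G2)"
          by (metis prod.exhaust)
        have 1: "perspective_dom J L1 R1" "perspective f L1 R1 \<preceq> G1"
          and 2: "perspective_dom J L2 R2" "perspective f L2 R2 \<preceq> G2"
          using that by (auto simp: C_def xy)
        note sub = perspective_dom_subadditive[OF inf oc J 1(1) 2(1)]
        with op_le_trans[OF conjunct2[OF sub] op_le_add_mono[OF 1(2) 2(2)]] show ?thesis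
          by (simp add: C_def xy)
      qed
      show "c *\<^sub>R x \<in> C" if "0 < c" "x \<in> C" for c x
      proof -
        obtain L R G where x: "x = (L, R, G)" by (metis prod.exhaust)
        have 1: "perspective_dom J L R" "perspective f L R \<preceq> G"
          using that(2) by (auto simp: C_def x)
        from perspective_dom_scaleR[OF 1(1) that(1), of f] op_le_scaleR_mono[OF 1(2), of c] that(1)
        show ?thesis by (simp add: C_def x)
      qed
      show "(indicat_real S t *\<^sub>R A t, indicat_real S t *\<^sub>R B t,
          indicat_real S t *\<^sub>R perspective f (A t) (B t)) \<in> C" for t
      proof (cases "t \<in> S")
        case True
        with rel[of t] B(2)[of t] show ?thesis
          by (simp add: C_def perspective_dom_def op_le_refl)
      qed (use 0 in \<open>simp add: zero_prod_def\<close>)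
    qed
    then obtain c where c: "\<And>n. c n \<in> C" "c \<longlonglongrightarrow> (A', B', G')"
      unfolding closure_sequential by blast
    define L where "L n = fst (c n)" for n
    define R where "R n = fst (snd (c n))" for n
    define D where "D n = snd (snd (c n))" for n
    have lim: "L \<longlonglongrightarrow> A'" "R \<longlonglongrightarrow> B'" "D \<longlonglongrightarrow> G'"
      using tendsto_fst[OF c(2)] tendsto_fst[OF tendsto_snd[OF c(2)]] tendsto_snd[OF tendsto_snd[OF c(2)]]
      by (simp_all add: L_def[abs_def] R_def[abs_def] D_def[abs_def])
    have LRD: "perspective_dom J (L n) (R n)" "perspective f (L n) (R n) \<preceq> D n" for n
      using c(1)[of n] by (auto simp: C_def L_def R_def D_def split: prod.splits)
    have "B' \<noteq> 0"
      using zero_in_real_spectrum_zero[OF nontriv] B'_pos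
      by (auto simp: real_spectrum_iff strictly_positive_op_def)
    then have "\<forall>\<^sub>F n in sequentially. R n \<noteq> 0"
      using lim(2) by (rule tendsto_imp_eventually_ne[rotated])
    then obtain N where N: "\<And>n. n \<ge> N \<Longrightarrow> R n \<noteq> 0"
      by (auto simp: eventually_sequentially)
    have dom_n: "strictly_positive_op (R (n + N))" "\<exists>a\<in>J. \<exists>b\<in>J. rel_bounds a b (L (n + N)) (R (n + N))" for n
      using LRD(1)[of "n + N"] N[of "n + N"] by (auto simp: perspective_dom_def)
    have f: "continuous_on J f"
      using oc by (simp add: operator_convex_on_def)
    have "(\<lambda>n. perspective f (L (n + N)) (R (n + N))) \<longlonglongrightarrow> perspective f A' B'"
      by (rule tendsto_perspective[OF J f dom_n(1) B'_pos LIMSEQ_ignore_initial_segment[OF lim(2)]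
            LIMSEQ_ignore_initial_segment[OF lim(1)] dom_n(2) a(1) b(1) ab'])
    then have "(\<lambda>n. D (n + N) - perspective f (L (n + N)) (R (n + N))) \<longlonglongrightarrow> G' - perspective f A' B'"
      by (intro tendsto_diff LIMSEQ_ignore_initial_segment[OF lim(3)])
    then have "perspective f A' B' \<preceq> G'"
      unfolding op_le_def by (rule positive_op_lim[rotated]) (use LRD(2) in \<open>simp add: op_le_def\<close>)
    with dom show ?thesis by blast
  qed
qed

text \<open>The subspace \<open>z = x + y\<close> is a closed cone containing the values of the three integrands.\<close>

lemma set_bochner_int_Compl:
  fixes F :: "'t \<Rightarrow> 'b::banach"
  assumes F: "bochner_integrable M F" and fin: "finite_measure M" and S: "S \<in> sets M" "- S \<in> sets M"
  shows "bochner_int M F = set_bochner_int M S F + set_bochner_int M (- S) F"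
proof -
  define C :: "('b \<times> 'b \<times> 'b) set" where "C = {c. snd (snd c) = fst c + fst (snd c)}"
  have "(set_bochner_int M S F, set_bochner_int M (- S) F, bochner_int M F) \<in> C"
  proof (rule simple_approx_in_closed_cone[OF simple_approx_Pair[OF simple_approx_set_bochner_int[OF F S(1)]
          simple_approx_Pair[OF simple_approx_set_bochner_int[OF F S(2)] simple_approx_bochner_int[OF F]]] fin])
    show "closed C"
      unfolding C_def by (intro closed_Collect_eq continuous_intros)
    show "(indicat_real S t *\<^sub>R F t, indicat_real (- S) t *\<^sub>R F t, F t) \<in> C" for t
      by (cases "t \<in> S") (auto simp: C_def)
  qed (auto simp: C_def algebra_simps)
  then show ?thesis by (simp add: C_def)
qed

text \<open>
  If an open \<open>O'\<close> meets \<open>S\<close> inside a compact \<open>V \<subseteq> S\<close>, it meets the closure of \<open>S\<close> inside \<open>V\<close> too, as \<open>V\<close> is closed. So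
  \<open>S\<close> is the intersection of its closure with an open set.
\<close>

lemma borel_if_locally_compact:
  fixes S :: "'t::t2_space set"
  assumes "locally compact S"
  shows "S \<in> sets borel"
proof -
  have "\<exists>O'. open O' \<and> x \<in> O' \<and> O' \<inter> closure S \<subseteq> S" if x: "x \<in> S" for x
  proof -
    obtain U V where UV: "openin (top_of_set S) U" "compact V" "x \<in> U" "U \<subseteq> V" "V \<subseteq> S"
      using locallyE[OF assms, of S x] x by (metis openin_subtopology_self)
    then obtain O' where O': "open O'" "U = S \<inter> O'"
      by (auto simp: openin_open)
    have "O' \<inter> closure S \<subseteq> closure (O' \<inter> S)"
      by (rule open_Int_closure_subset[OF O'(1)])
    also have "\<dots> \<subseteq> V"
      using UV(2,4) O'(2) by (intro closure_minimal compact_imp_closed) auto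
    finally show ?thesis using O' UV(3,5) by blast
  qed
  then obtain W where W: "\<And>x. x \<in> S \<Longrightarrow> open (W x) \<and> x \<in> W x \<and> W x \<inter> closure S \<subseteq> S"
    by metis
  then have "S = (\<Union>x\<in>S. W x) \<inter> closure S"
    using closure_subset[of S] by blast
  moreover have "open (\<Union>x\<in>S. W x)"
    using W by blast
  then have "(\<Union>x\<in>S. W x) \<in> sets borel" by (rule borel_open)
  moreover have "closure S \<in> sets borel" by simp
  ultimately show ?thesis by (metis sets.Int)
qed

theorem corollary2p3:
  fixes T1 T2 :: "'t::t2_space set"
    and \<mu> :: "'t measure"
    and \<AA> :: "('h::complex_hilbert \<Rightarrow>\<^sub>L 'h) set"
    and A B :: "'t \<Rightarrow> 'h \<Rightarrow>\<^sub>L 'h"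
    and J :: "real set" and f :: "real \<Rightarrow> real"
  assumes "locally compact (UNIV :: 't set)"
    and "locally compact T1" and "locally compact T2"
    and "T1 \<inter> T2 = {}" and "T1 \<union> T2 = UNIV"
    and "radon_measure \<mu>" and "finite_measure \<mu>"
    and "operator_Cstar_algebra \<AA>"
    and "continuous_on UNIV A" and "\<And>t. A t \<in> \<AA>" and "\<And>t. self_adjoint_op (A t)"
    and "continuous_on UNIV B" and "\<And>t. B t \<in> \<AA>" and "\<And>t. strictly_positive_op (B t)"
    and "is_interval J"
    and "\<not> (\<exists>S :: 'k::complex_hilbert set. finite S \<and> span S = UNIV)"
    and "operator_convex_on TYPE('k) J f"
    and "\<And>t. op_spectrum (rel_op (A t) (B t)) \<subseteq> complex_of_real ` J"
    and "bochner_integrable \<mu> A" and "bochner_integrable \<mu> B"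
    and "bochner_integrable \<mu> (\<lambda>t. perspective f (A t) (B t))"
  shows
    "2 *\<^sub>R perspective f ((1/2) *\<^sub>R bochner_int \<mu> A) ((1/2) *\<^sub>R bochner_int \<mu> B)
       \<preceq> perspective f (set_bochner_int \<mu> T1 A) (set_bochner_int \<mu> T1 B)
         + perspective f (set_bochner_int \<mu> T2 A) (set_bochner_int \<mu> T2 B)
     \<and> perspective f (set_bochner_int \<mu> T1 A) (set_bochner_int \<mu> T1 B)
         + perspective f (set_bochner_int \<mu> T2 A) (set_bochner_int \<mu> T2 B)
       \<preceq> f_divergence \<mu> f A B"
proof (cases "\<exists>x::'h. x \<noteq> 0")
  \<comment> \<open>on the zero space spectra are empty, and even \<open>J\<close> may be\<close>
  case False
  then have "X = Y" for X Y :: "'h \<Rightarrow>\<^sub>L 'h"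
    by (intro blinfun_eqI) metis
  then have "X \<preceq> Y" for X Y :: "'h \<Rightarrow>\<^sub>L 'h"
    by (metis op_le_refl)
  then show ?thesis by blast
next
  case True
  have sets: "sets \<mu> = sets borel"
    using assms(6) by (simp add: radon_measure_def)
  have T2: "T2 = - T1" using assms(4,5) by blast
  have T: "T1 \<in> sets \<mu>" "T2 \<in> sets \<mu>"
    using assms(2,3) by (auto simp: sets borel_if_locally_compact)
  note jensen = perspective_integral_le[OF True assms(7) sets _ assms(16,17,15,9,11,19,12,14,20,18,21)]
  note split = set_bochner_int_Compl[OF _ assms(7) T(1) T(2)[unfolded T2], folded T2]
  let ?A1 = "set_bochner_int \<mu> T1 A" and ?B1 = "set_bochner_int \<mu> T1 B"
  let ?A2 = "set_bochner_int \<mu> T2 A" and ?B2 = "set_bochner_int \<mu> T2 B"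
  have sub: "perspective_dom J (?A1 + ?A2) (?B1 + ?B2)"
    "perspective f (?A1 + ?A2) (?B1 + ?B2) \<preceq> perspective f ?A1 ?B1 + perspective f ?A2 ?B2"
    using perspective_dom_subadditive[OF assms(16,17,15)] jensen[OF T(1)] jensen[OF T(2)] by blast+
  have "2 *\<^sub>R perspective f ((1/2) *\<^sub>R (?A1 + ?A2)) ((1/2) *\<^sub>R (?B1 + ?B2)) = perspective f (?A1 + ?A2) (?B1 + ?B2)"
    using perspective_dom_scaleR[OF sub(1), of "1/2" f] by simp
  moreover have "perspective f ?A1 ?B1 + perspective f ?A2 ?B2 \<preceq> f_divergence \<mu> f A B"
    unfolding f_divergence_def split[OF assms(21)]
    using jensen[OF T(1)] jensen[OF T(2)] by (intro op_le_add_mono) blast+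
  ultimately show ?thesis
    using sub(2) unfolding split[OF assms(19)] split[OF assms(20)] by simp
qed

end
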